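(* Let $k$ be a positive integer and let $w,w'\in[\overline k]^{*}$ be words. Then $w\equiv_C w'$ if and only if $P_C(w)=P_C(w')$.
   Context: Alphabet and tableaux. $[\overline{k}]=\{1,\overline1,\dots,k,\overline k\}$ with the total order $1<\overline1<2<\overline2<\cdots<k<\overline k$; $[\overline k]^{*}$ is the set of all finite words (including the empty word) in $[\overline k]$. Partitions are identified with Young diagrams in English notation. A King tableau of shape $\lambda$ is a filling of the Young diagram $\lambda$ by elements of $[\overline k]$ such that entries weakly increase along rows, strictly increase down columns, and all entries in row $i$ are $\ge i$ (for the order $1<\overline1<2<\overline2<\cdots<k<\overline k$) for every $i$. $\mathrm{KT}_k(\lambda)$ is the set of these and $\mathrm{KT}_k=\bigcup_\lambda \mathrm{KT}_k(\lambda)$ (the empty tableau is included). Berele insertion $T\leftarrow_C x$ ($T\in\mathrm{KT}_k$, $x\in[\overline k]$). Start as in Schensted row insertion: insert $x$ into row 1; inserting a letter $a$ into a row replaces (bumps) the leftmost entry that is strictly larger than $a$, and the bumped entry is then inserted into the next row; if no entry of the row is larger than $a$, then $a$ is put at the end of the row and the procedure stops. Exception: if at some moment the letter $i$ is to be inserted into row $i$ and row $i$ contains at least one $\overline i$, then instead: replace the first $\overline i$ of row $i$ by $i$, replace the first $i$ of row $i$ by an empty box, and play jeu de taquin with this empty box: repeatedly, if the empty box has a box with entry $b$ below it and/or a box with entry $r$ to its right, slide $b$ up when only $b$ exists or when both exist and $b\le r$, and slide $r$ left when only $r$ exists or when both exist and $b>r$; once the empty box is at a corner of the shape, delete it and stop.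 The result is again a King tableau. For a word $w=w_1\cdots w_n$, $P_C(w)=(\cdots((\emptyset\leftarrow_C w_1)\leftarrow_C w_2)\cdots)\leftarrow_C w_n$. Knuth equivalences. $\equiv_A$ is the equivalence relation on $[\overline k]^{*}$ generated by the following replacements of three adjacent letters in a word: $yxz\leftrightarrow yzx$ for $x<y\le z$, and $xzy\leftrightarrow zxy$ for $x\le y<z$. A column word is a word $c=c_n\cdots c_1$ in $[\overline k]$ with $c_{i+1}>c_i$ for all $i$ (the empty word is allowed). For column words, $c\sim c'$ means $P_C(c)=P_C(c')$. Write $w\equiv_5 w'$ if there exist a word $v$ and column words $c,c'$ with $w\equiv_A cv$, $w'\equiv_A c'v$ and $c\sim c'$. Type C Knuth equivalence $\equiv_C$: $w\equiv_C w'$ if there is a finite sequence of words $w=w_0,w_1,\dots,w_n=w'$ such that each $w_{j+1}$ is obtained from $w_j$ by one of the three-letter replacements $yxz\leftrightarrow yzx$ (for $x<y\le z$) and $xzy\leftrightarrow zxy$ (for $x\le y<z$) or satisfies $w_j\equiv_5 w_{j+1}$. *)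

theory Defs
  imports Main
begin

datatype letter = Plain nat | Barred nat

text \<open>The code realises the order \<open>1 < \<close>1-bar\<open> < 2 < \<close>2-bar\<open> < \<dots>\<close>.\<close>

fun letter_code :: "letter \<Rightarrow> nat" where
  "letter_code (Plain i) = 2 * i"
| "letter_code (Barred i) = 2 * i + 1"

lemma letter_code_inject: "letter_code x = letter_code y \<Longrightarrow> x = y"
  by (cases x; cases y; simp; presburger)

instantiation letter :: linorder
begin

definition less_eq_letter :: "letter \<Rightarrow> letter \<Rightarrow> bool" where
  "x \<le> y \<longleftrightarrow> letter_code x \<le> letter_code y"

definition less_letter :: "letter \<Rightarrow> letter \<Rightarrow> bool" where
  "x < y \<longleftrightarrow> letter_code x < letter_code y"

instance
  by standard (auto simp: less_eq_letter_def less_letter_def intro: letter_code_inject)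

end

definition letters :: "nat \<Rightarrow> letter set" where
  "letters k = Plain ` {1..k} \<union> Barred ` {1..k}"

definition words :: "nat \<Rightarrow> letter list set" where
  "words k = lists (letters k)"


text \<open>
  A tableau is the list of its nonempty rows, from top to bottom. Rows and columns are indexed
  from 0, so the row with index \<open>i\<close> is row \<open>Suc i\<close> of the diagram.
\<close>

type_synonym tableau = "letter list list"

definition entry :: "tableau \<Rightarrow> nat \<Rightarrow> nat \<Rightarrow> letter option" where
  "entry T i j = (if i < length T \<and> j < length (T ! i) then Some (T ! i ! j) else None)"

definition set_entry :: "tableau \<Rightarrow> nat \<Rightarrow> nat \<Rightarrow> letter \<Rightarrow> tableau" where
  "set_entry T i j a = T[i := (T ! i)[j := a]]"

text \<open>
  For a box \<open>(i, j)\<close> at the end of its row. If this was the only box of the row (then the last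
  row, when the box is a corner), the row disappears.
\<close>

definition delete_corner :: "tableau \<Rightarrow> nat \<Rightarrow> nat \<Rightarrow> tableau" where
  "delete_corner T i j = filter (\<lambda>row. row \<noteq> []) (T[i := take j (T ! i)])"

lemma length_set_entry [simp]: "length (set_entry T i j a) = length T"
  by (simp add: set_entry_def)

lemma map_length_set_entry [simp]: "map length (set_entry T i j a) = map length T"
  by (cases "i < length T") (simp_all add: set_entry_def map_update list_update_same_conv list_update_beyond)

lemma entry_bound:
  assumes "Some a = entry T i j"
  shows "i < length T \<and> j < sum_list (map length T)"
proof -
  have i: "i < length T"
    using assms by (simp add: entry_def split: if_splits)
  have "j < map length T ! i"
    using assms by (simp add: entry_def split: if_splits)
  also have "\<dots> \<le> sum_list (map length T)"
    using i by (intro elem_le_sum_list) simp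
  finally show ?thesis
    using i by blast
qed

text \<open>
  Jeu de taquin with the empty box at \<open>(i, j)\<close>; the letter stored at that position is never
  read.
\<close>

function jeu_de_taquin :: "tableau \<Rightarrow> nat \<Rightarrow> nat \<Rightarrow> tableau" where
  "jeu_de_taquin T i j =
    (case (entry T (Suc i) j, entry T i (Suc j)) of
      (None, None) \<Rightarrow> delete_corner T i j
    | (Some b, None) \<Rightarrow> jeu_de_taquin (set_entry T i j b) (Suc i) j
    | (None, Some r) \<Rightarrow> jeu_de_taquin (set_entry T i j r) i (Suc j)
    | (Some b, Some r) \<Rightarrow>
        if b \<le> r then jeu_de_taquin (set_entry T i j b) (Suc i) j
        else jeu_de_taquin (set_entry T i j r) i (Suc j))"
  by pat_completeness auto
termination
  by (relation "measure (\<lambda>(T, i, j). (length T - i) + (sum_list (map length T) - j))")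
    (auto dest!: entry_bound simp: diff_less_mono2)

declare jeu_de_taquin.simps [simp del]

definition first_index :: "('a \<Rightarrow> bool) \<Rightarrow> 'a list \<Rightarrow> nat" where
  "first_index P xs = length (takeWhile (\<lambda>x. \<not> P x) xs)"

text \<open>
  Insertion of the letter \<open>a\<close> into the row with index \<open>i\<close>, followed by all later steps. In the
  exceptional branch the first box of \<open>row'\<close> containing \<open>Plain (Suc i)\<close> becomes the empty box.
\<close>

function insert_from :: "nat \<Rightarrow> letter \<Rightarrow> tableau \<Rightarrow> tableau" where
  "insert_from i a T =
    (if length T \<le> i then T @ [[a]]
     else if a = Plain (Suc i) \<and> Barred (Suc i) \<in> set (T ! i) then
       (let row' = (T ! i)[first_index (\<lambda>b. b = Barred (Suc i)) (T ! i) := Plain (Suc i)]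
        in jeu_de_taquin (T[i := row']) i (first_index (\<lambda>b. b = Plain (Suc i)) row'))
     else if \<exists>b\<in>set (T ! i). a < b then
       (let j = first_index (\<lambda>b. a < b) (T ! i)
        in insert_from (Suc i) (T ! i ! j) (set_entry T i j a))
     else T[i := T ! i @ [a]])"
  by pat_completeness auto
termination
  by (relation "measure (\<lambda>(i, a, T). length T - i)") auto

declare insert_from.simps [simp del]

definition berele_insert :: "tableau \<Rightarrow> letter \<Rightarrow> tableau" where
  "berele_insert T x = insert_from 0 x T"

definition P\<^sub>C :: "letter list \<Rightarrow> tableau" where
  "P\<^sub>C w = foldl berele_insert [] w"


inductive knuth_move :: "letter list \<Rightarrow> letter list \<Rightarrow> bool" where
  "x < y \<Longrightarrow> y \<le> z \<Longrightarrow> knuth_move (u @ [y, x, z] @ v) (u @ [y, z, x] @ v)"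
| "x \<le> y \<Longrightarrow> y < z \<Longrightarrow> knuth_move (u @ [x, z, y] @ v) (u @ [z, x, y] @ v)"

text \<open>
  Knuth moves permute the letters of a word, so \<open>knuth_equiv\<close> relates words over a given
  alphabet only to words over the same alphabet and needs no parameter \<open>k\<close>.
\<close>

definition knuth_equiv :: "letter list \<Rightarrow> letter list \<Rightarrow> bool" where
  "knuth_equiv = equivclp knuth_move"

definition column_words :: "nat \<Rightarrow> letter list set" where
  "column_words k = {c \<in> words k. sorted_wrt (>) c}"

definition equiv5 :: "nat \<Rightarrow> letter list \<Rightarrow> letter list \<Rightarrow> bool" where
  "equiv5 k w w' \<longleftrightarrow>
    (\<exists>v\<in>words k. \<exists>c\<in>column_words k. \<exists>c'\<in>column_words k.
      knuth_equiv w (c @ v) \<and> knuth_equiv w' (c' @ v) \<and> P\<^sub>C c = P\<^sub>C c')"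

definition typeC_step :: "nat \<Rightarrow> letter list \<Rightarrow> letter list \<Rightarrow> bool" where
  "typeC_step k w w' \<longleftrightarrow>
    w \<in> words k \<and> w' \<in> words k \<and> (knuth_move w w' \<or> knuth_move w' w \<or> equiv5 k w w')"

definition typeC_equiv :: "nat \<Rightarrow> letter list \<Rightarrow> letter list \<Rightarrow> bool" where
  "typeC_equiv k = (typeC_step k)\<^sup>*\<^sup>*"

end

theory Submission
  imports Defs
begin

text \<open>
  If \<open>P\<^sub>C w\<close> is determined by the class of \<open>w\<close>, the converse follows by comparing \<open>w\<close> with the row word
  of \<open>P\<^sub>C w\<close>. As long as the insertion of \<open>x\<close> into \<open>T\<close> is Schensted's, the row word of \<open>T\<close>
  followed by \<open>x\<close> changes by Knuth moves. When the exception occurs in row \<open>i\<close>, the empty box lies in the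
  first column, and the word is Knuth equivalent to \<open>C v\<close>, where \<open>C\<close> is the first column including
  \<open>i\<close> and \<open>i\<close>-bar and \<open>v\<close> reads the other columns. Sliding the empty box preserves the column word up to Knuth moves,
  so the result reads \<open>C' v\<close> with \<open>C'\<close> obtained from \<open>C\<close> by deleting \<open>i\<close> and \<open>i\<close>-bar; and
  \<open>P\<^sub>C C = P\<^sub>C C'\<close>.

  The invariance of \<open>P\<^sub>C\<close> under \<open>\<equiv>\<^sub>5\<close> is immediate once Knuth moves are dealt with. For those, a tableau
  is encoded by the shapes of its subtableaux of entries at most \<open>c\<close>. An insertion adds or removes at most one box
  of each shape, and the box for \<open>c + 1\<close> is determined from the one for \<open>c\<close> by a local rule. A word of
  three letters thus becomes, for every \<open>c\<close>, a word of three steps. Words that differ by a Knuth move yield words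
  of steps that differ by a Knuth relation for the order
  \<open>New < Up 0 < Up 1 < \<dots> < Down 1 < Down 0\<close>, where in addition \<open>Up i, Down i\<close> may be
  exchanged with \<open>Down j, Up j\<close> if the rows \<open>i\<close> and \<open>j\<close> have equal length. This relation propagates through
  each pair of letters \<open>k\<close>, \<open>k\<close>-bar, so the final shapes agree.
\<close>

section \<open>Steps between shapes\<close>

text \<open>Two obstacles shape the argument. A relation between triples can break at a single code,
  when two neighbouring steps collide in adjacent rows. A common first step prevents the collision;
  a common last step does not, but then the collision turns the relation into one of the other kind,
  with a common first step. The second obstacle is the exception: at the plain letter the shape
  stands still, so there is no step to compare, and the comparison returns only at the bar. This is
  why letters are crossed in pairs. At the bar, \<open>Up K\<close> has become
  \<open>Down K\<close>. Rows beyond \<open>K\<close> are empty there, so these are the last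
  possible \<open>Up\<close> and the first possible \<open>Down\<close>; the order has to make them
  neighbours, hence the reversed rows of \<open>Down\<close>. The exchange comes from a box added
  and removed in one row: \<open>Up r, Down r\<close> can remain in row \<open>r\<close> while
  \<open>Down r, Up r\<close> drops to an equally long row beneath.\<close>

text \<open>
  \<open>New d\<close> means that the letter of code \<open>d\<close> is still to be inserted, so that the shape does not change yet.
  \<open>Hold\<close> records the exceptional insertion of a plain letter: the shape at that letter stays, and the shapes at
  larger letters lose a box.
\<close>

datatype step = New nat | Up nat | Down nat | Hold

abbreviation fresh where
  "fresh c s \<equiv> \<forall>d. s = New d \<longrightarrow> c \<le> d"

text \<open>The descent relation of two consecutive steps: for two \<open>New\<close> steps it says
  that the second letter is the smaller one, hence the reversed comparison of codes.
  \<open>Hold\<close> compares with nothing; a comparison that involves it is postponed to the end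
  of the layer.\<close>

fun below :: "step \<Rightarrow> step \<Rightarrow> bool" where
  "below (New c) (New d) = (d < c)"
| "below (New c) (Up r) = True"
| "below (New c) (Down r) = True"
| "below (Up r) (Up s) = (r < s)"
| "below (Up r) (Down s) = True"
| "below (Down r) (Down s) = (s < r)"
| "below _ _ = False"

fun act :: "step \<Rightarrow> (nat \<Rightarrow> int) \<Rightarrow> nat \<Rightarrow> int" where
  "act (Up r) f = (\<lambda>i. if i = r then f i + 1 else f i)"
| "act (Down r) f = (\<lambda>i. if i = r then f i - 1 else f i)"
| "act (New d) f = f"
| "act Hold f = f"

fun legal :: "step \<Rightarrow> (nat \<Rightarrow> int) \<Rightarrow> bool" where
  "legal (Up r) f = (r = 0 \<or> f r < f (r - 1))"
| "legal (Down r) f = (f (Suc r) < f r)"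
| "legal (New d) f = True"
| "legal Hold f = True"

text \<open>A growth rule, with \<open>f\<close> and \<open>g\<close> the shapes at the codes
  \<open>c - 1\<close> and \<open>c\<close>. The box gained in row \<open>r\<close> of
  \<open>f\<close> was held by a letter of code \<open>c\<close> exactly if
  \<open>f r < g r\<close>, and that letter is bumped into the next row. The box lost at the end of
  row \<open>r\<close> of \<open>f\<close> has a letter of code \<open>c\<close> right below it
  exactly if \<open>g (Suc r) = f r\<close>, and that letter slides up, also when an equal letter
  stands to the right.\<close>

fun push :: "nat \<Rightarrow> (nat \<Rightarrow> int) \<Rightarrow> (nat \<Rightarrow> int) \<Rightarrow> step \<Rightarrow> step" where
  "push c f g (New d) = (if d = c then Up 0 else New d)"
| "push c f g (Up r) = (if f r < g r then Up (Suc r) else Up r)"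
| "push c f g (Down r) = (if g (Suc r) = f r then Down (Suc r) else Down r)"
| "push c f g Hold = Hold"

text \<open>The skew shape between \<open>f\<close> and \<open>g\<close> is a horizontal strip, as
  the letters of one code in a semistandard tableau are.\<close>

definition interlaced :: "(nat \<Rightarrow> int) \<Rightarrow> (nat \<Rightarrow> int) \<Rightarrow> bool" where
  "interlaced f g \<longleftrightarrow> (\<forall>r. g (Suc r) \<le> f r \<and> f r \<le> g r)"

lemma interlacedD:
  assumes "interlaced f g" shows "g (Suc r) \<le> f r" "f r \<le> g r"
  using assms by (auto simp: interlaced_def)

lemma act_commute: "act s (act t f) = act t (act s f)"
  by (cases s; cases t) auto

lemma push_valid:
  assumes "interlaced f g" "legal s f"
  shows "legal (push c f g s) g" "interlaced (act s f) (act (push c f g s) g)"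
proof -
  note i = interlacedD[OF assms(1)]
  show "legal (push c f g s) g"
  proof (cases s)
    case (Up r) then show ?thesis using assms(2) i[of r] i[of "r-1"] by (cases r) auto
  next
    case (Down r) then show ?thesis using assms(2) i[of r] i[of "Suc r"] by auto
  qed auto
  show "interlaced (act s f) (act (push c f g s) g)"
    unfolding interlaced_def
  proof
    fix x show "act (push c f g s) g (Suc x) \<le> act s f x \<and> act s f x \<le> act (push c f g s) g x"
    proof (cases s)
      case (New d) then show ?thesis using i[of x] by auto
    next
      case (Up r)
      then show ?thesis using assms(2) i[of x] i[of "r"] i[of "r-1"] by (cases r) auto
    next
      case (Down r)
      then show ?thesis using assms(2) i[of x] i[of "r"] i[of "Suc r"] by auto
    qed (use i[of x] in auto)
  qed
qed

text \<open>The row bumping lemma in local form. \<open>push\<close> moves a step by at most one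
  row, so only equal or adjacent rows are critical, and there the first step has already changed the
  comparison on which the second one depends.\<close>

lemma push_bump:
  assumes "interlaced f g" "legal s f" "legal t (act s f)" "s \<noteq> Hold" "t \<noteq> Hold"
    "fresh c s"  "fresh c t"
  shows "below (push c f g s) (push c (act s f) (act (push c f g s) g) t) \<longleftrightarrow> below s t"
proof -
  note i = interlacedD[OF assms(1)]
  show ?thesis
    using assms(2-) i[of "case t of Up x \<Rightarrow> x | Down x \<Rightarrow> x | _ \<Rightarrow> 0"] i[of "case s of Up x \<Rightarrow> x | Down x \<Rightarrow> x | _ \<Rightarrow> 0"]
    by (cases s; cases t) (auto split: if_splits)
qed

definition push_commute where
  "push_commute c f g s t \<longleftrightarrow> push c (act s f) (act (push c f g s) g) t = push c f g t \<and>
    push c (act t f) (act (push c f g t) g) s = push c f g s"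

definition legal2 where
  "legal2 f s t \<longleftrightarrow> legal s f \<and> legal t f \<and> legal s (act t f) \<and> legal t (act s f)"

lemma push_UU:
  assumes "interlaced f g" "legal2 f (Up r) (Up q)" "r < q" "q = Suc r \<Longrightarrow> f r < g r \<Longrightarrow> f q < g q"
  shows "push_commute c f g (Up r) (Up q)"
  using assms unfolding push_commute_def legal2_def interlaced_def by auto

text \<open>The excluded case is where exchange pairs are born: \<open>Up r, Down r\<close> then
  stays in row \<open>r\<close>, while \<open>Down r, Up r\<close> is carried to row
  \<open>Suc r\<close> of the same length.\<close>

lemma push_UD:
  assumes "interlaced f g" "legal2 f (Up r) (Down j)" "\<not> (r = j \<and> f r = g r \<and> f r = g (Suc r))"
  shows "push_commute c f g (Up r) (Down j)"
proof -
  note i = interlacedD[OF assms(1)]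
  show ?thesis using assms(2-) i[of j] i[of r] i[of "Suc j"] unfolding push_commute_def legal2_def by (cases r) (auto split: if_splits)
qed

lemma push_DD:
  assumes "interlaced f g" "legal2 f (Down q) (Down r)" "r < q" "q = Suc r \<Longrightarrow> g (Suc r) = f r \<Longrightarrow> g (Suc q) = f q"
  shows "push_commute c f g (Down q) (Down r)"
  using assms(2-) spec[OF assms(1)[unfolded interlaced_def], of r] spec[OF assms(1)[unfolded interlaced_def], of q] unfolding push_commute_def legal2_def interlaced_def by auto

lemma push_ND:
  assumes "interlaced f g" "legal2 f (New d) (Down r)"
  shows "push_commute c f g (New d) (Down r)"
  using assms unfolding push_commute_def legal2_def interlaced_def by auto

lemma push_NN: "d \<noteq> e \<Longrightarrow> push_commute c f g (New d) (New e)"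
  unfolding push_commute_def by auto

lemma push_NU:
  assumes "interlaced f g" "r = 0 \<Longrightarrow> d = c \<Longrightarrow> f 0 < g 0"
  shows "push_commute c f g (New d) (Up r)"
  using assms unfolding push_commute_def by auto

text \<open>All rows of \<open>f\<close> from \<open>i\<close> to \<open>j\<close> are equal, so
  interlacing pins \<open>g (Suc i)\<close> and \<open>g j\<close> to that length. Whether or not
  the steps move down, they end in rows of \<open>g\<close> of this same length.\<close>

lemma push_exchange:
  assumes "interlaced f g" "i < j" "f i = f j" "legal (Up i) f" "legal (Down j) f" "\<forall>m. f (Suc m) \<le> f m"
  obtains I J where "push c f g (Up i) = Up I" "push c (act (Up i) f) (act (Up I) g) (Down i) = Down I"
   "push c f g (Down j) = Down J" "push c (act (Down j) f) (act (Down J) g) (Up j) = Up J"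
   "I \<le> J" "g I = g J"
proof -
  note b = interlacedD[OF assms(1)]
  have m: "f y \<le> f x" if "x \<le> y" for x y using assms(6) that by (simp add: lift_Suc_antimono_le)
  have "f (Suc i) = f i" "f (j-1) = f j" using m[of i "Suc i"] m[of "Suc i" j] m[of i "j-1"] m[of "j-1" j] assms(2,3) by auto
  then have e: "g (Suc i) = f i" "g j = f j"
    using b[of i] b[of "Suc i"] b[of j] b[of "j-1"] assms(2) by auto
  show ?thesis
    apply (rule that[of "if f i < g i then Suc i else i" "if g (Suc j) = f j then Suc j else j"])
    using e assms(2,3) b[of i] by auto
qed

text \<open>The condition under which two neighbouring steps \<open>b\<close>, \<open>d\<close> do not interfere when pushed to the next shape.\<close>

definition smooth where
  "smooth c f g b d \<longleftrightarrow>
    (\<forall>r. b = Up r \<longrightarrow> d = Up (Suc r) \<longrightarrow> f r < g r \<longrightarrow> f (Suc r) < g (Suc r)) \<and>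
    (\<forall>r. b = Down (Suc r) \<longrightarrow> d = Down r \<longrightarrow> g (Suc r) = f r \<longrightarrow> g (Suc (Suc r)) = f (Suc r)) \<and>
    (b = New c \<longrightarrow> d = Up 0 \<longrightarrow> f 0 < g 0)"

text \<open>In the order of steps, \<open>a\<close> lies weakly after \<open>b\<close> and strictly
  before \<open>d\<close>. The pairs constrained by \<open>smooth\<close> are consecutive there, so
  \<open>a = b\<close>, and pushing \<open>a\<close> has just established the inequality that
  \<open>smooth\<close> asks for.\<close>

lemma push_smooth:
  assumes "interlaced f g" "legal a f" "\<not> below a b" "below a d" "fresh c a"
  shows "smooth c (act a f) (act (push c f g a) g) b d"
proof -
  note i = interlacedD[OF assms(1)]
  show ?thesis using assms(2-) i[of "case d of Up x \<Rightarrow> x | Down x \<Rightarrow> x | _ \<Rightarrow> 0"] i[of "case b of Up x \<Rightarrow> x | Down x \<Rightarrow> x | _ \<Rightarrow> 0"]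
    unfolding smooth_def by (cases a) (auto simp: less_Suc_eq_le split: if_splits)
qed

definition swapped :: "(nat \<Rightarrow> int) \<Rightarrow> step \<times> step \<Rightarrow> step \<times> step \<Rightarrow> bool" where
  "swapped f p q \<longleftrightarrow> (\<exists>b d. p = (b, d) \<and> q = (d, b) \<and> below b d) \<or>
    (\<exists>i j. i < j \<and> f i = f j \<and> p = (Up i, Down i) \<and> q = (Down j, Up j))"

definition legal_pair where
  "legal_pair f p \<longleftrightarrow> legal (fst p) f \<and> legal (snd p) (act (fst p) f)"

definition push_pair where
  "push_pair c f g p = (push c f g (fst p), push c (act (fst p) f) (act (push c f g (fst p)) g) (snd p))"

definition act_pair where
  "act_pair p f = act (snd p) (act (fst p) f)"

lemma swapped_act: "swapped f p q \<Longrightarrow> act_pair p f = act_pair q f"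
  unfolding swapped_def act_pair_def by (auto simp: act_commute)

lemma push_commute_swapped:
  assumes "push_commute c f g b d" "below (push c f g b) (push c f g d)"
  shows "swapped g (push_pair c f g (b, d)) (push_pair c f g (d, b))"
  using assms unfolding push_commute_def push_pair_def swapped_def by auto

lemma push_swapped:
  assumes int: "interlaced f g" and swapped: "swapped f p q" and legal: "legal_pair f p" "legal_pair f q"
    and new: "fresh c (fst p)" "fresh c (fst q)"
    and smooth: "smooth c f g (fst p) (fst q)"
  shows "swapped g (push_pair c f g p) (push_pair c f g q)"
proof -
  note b = interlacedD[OF int]
  then have m: "\<forall>r. f (Suc r) \<le> f r" using order_trans by blast
  consider (a) x y where "p = (x, y)" "q = (y, x)" "below x y" |
     (b) i j where "i < j" "f i = f j" "p = (Up i, Down i)" "q = (Down j, Up j)"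
    using swapped by (auto simp: swapped_def)
  then show ?thesis
  proof cases
    case a
    have legal2: "legal2 f x y" using legal a by (auto simp: legal2_def legal_pair_def)
    have xy: "legal x f" "legal y (act x f)" "x \<noteq> Hold" "y \<noteq> Hold"
      using legal a by (auto simp: legal_pair_def)
    show ?thesis
    proof (cases "push_commute c f g x y")
      case True
      have "below (push c f g x) (push c (act x f) (act (push c f g x) g) y)"
        using push_bump[OF int xy, of c] new a by auto
      then show ?thesis using True a push_commute_swapped by (auto simp: push_commute_def)
    next
      case False
      have "\<exists>r. x = Up r \<and> y = Down r \<and> f r = g r \<and> f r = g (Suc r)"
      proof (cases x)
        case (New d)
        then show ?thesis using False a(3) smooth push_ND[OF int, of d _ c] push_NN push_NU[OF int, of _ d c] legal2
          unfolding a(1,2) smooth_def by (cases y) auto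
      next
        case (Up r)
        show ?thesis
        proof (cases y)
          case (Up q)
          then show ?thesis using False a(3) smooth legal2 push_UU[OF int, of r q c] \<open>x = Up r\<close> unfolding a(1,2) smooth_def by auto
        next
          case (Down q)
          then have "r = q \<and> f r = g r \<and> f r = g (Suc r)"
            using False legal2 push_UD[OF int, of r q c] \<open>x = Up r\<close> by blast
          then show ?thesis using Down \<open>x = Up r\<close> by auto
        qed (use a(3) Up in auto)
      next
        case (Down q)
        then show ?thesis using False a(3) smooth legal2 push_DD[OF int, of q _ c] unfolding a(1,2) smooth_def by (cases y) auto
      qed (use a(3) in auto)
      then obtain r where r: "x = Up r" "y = Down r" "f r = g r" "f r = g (Suc r)" by blast
      show ?thesis unfolding a r swapped_def push_pair_def using r(3,4) by auto
    qed
  next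
    case b
    show ?thesis
    proof (rule push_exchange[OF int b(1,2) _ _ m])
      show "legal (Up i) f" "legal (Down j) f" using legal b by (auto simp: legal_pair_def)
      fix I J assume "push c f g (Up i) = Up I" "push c (act (Up i) f) (act (Up I) g) (Down i) = Down I"
       "push c f g (Down j) = Down J" "push c (act (Down j) f) (act (Down J) g) (Up j) = Up J"
       "I \<le> J" "g I = g J"
      \<comment> \<open>For \<open>I = J\<close> the exchange has become the plain swap of
        \<open>Up I\<close> and \<open>Down I\<close>.\<close>
      then show ?thesis unfolding b swapped_def push_pair_def by (cases "I = J") (auto simp del: act.simps push.simps)
    qed
  qed
qed

definition push_triple where
  "push_triple c f g x y z = (push c f g x, push_pair c (act x f) (act (push c f g x) g) (y, z))"

text \<open>Steps that are not smooth are consecutive in the order, and \<open>z\<close> lies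
  strictly after \<open>x\<close> and weakly before \<open>y\<close>, so \<open>z = y\<close>. The
  collision sends \<open>x\<close> and \<open>y\<close> to the same first step, and the difference
  of the two words moves to their last two places.\<close>

lemma push_triple_swap:
  assumes int: "interlaced f g" and legal2: "legal2 f x y" and z: "legal z (act x (act y f))" and zz: "below x z" "\<not> below y z"
    and nn: "\<not> smooth c f g x y" and new: "fresh c x" "fresh c y" "fresh c z"
  and t: "push_triple c f g y x z = (b', d', e')"
  shows "push_triple c f g x y z = (b', e', d')"
proof -
  note b = interlacedD[OF int]
  consider (UU) r where "x = Up r" "y = Up (Suc r)" "f r < g r" "f (Suc r) = g (Suc r)"
  | (DD) r where "x = Down (Suc r)" "y = Down r" "g (Suc r) = f r" "g (Suc (Suc r)) \<noteq> f (Suc r)"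
  | (NU) "x = New c" "y = Up 0" "f 0 = g 0"
    using nn b unfolding smooth_def by (smt (verit, best))
  then show ?thesis
  proof cases
    case UU
    then have "z = Up (Suc r)" using zz by (cases z) auto
    then show ?thesis
      using t UU legal2 z b[of r] b[of "Suc r"] unfolding push_triple_def push_pair_def legal2_def by (auto split: if_splits)
  next
    case DD
    then have "z = Down r" using zz by (cases z) auto
    then show ?thesis
      using t DD legal2 z b[of r] b[of "Suc r"] unfolding push_triple_def push_pair_def legal2_def by (auto split: if_splits)
  next
    case NU
    then have "z = Up 0" using zz new by (cases z) auto
    then show ?thesis
      using t NU legal2 z b[of 0] b[of "Suc 0"] unfolding push_triple_def push_pair_def legal2_def by (auto split: if_splits)
  qed
qed

section \<open>The layer of a letter and its bar\<close>

text \<open>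
  With \<open>k = K + 1\<close>, the functions \<open>f\<close>, \<open>g\<close>, \<open>h\<close> are the shapes of the entries up to
  \<open>k - 1\<close>-bar, \<open>k\<close> and \<open>k\<close>-bar; the codes of \<open>k\<close> and \<open>k\<close>-bar are \<open>2*K+2\<close> and
  \<open>2*K+3\<close>. The exception is recognised by an attempt to add a box to row \<open>K\<close> of \<open>g\<close> while that row of
  \<open>h\<close> is longer, that is, while it contains a \<open>k\<close>-bar.
\<close>

definition plain_step where
  "plain_step K f g h s = (let q = push (2*K+2) f g s in if q = Up K \<and> g K < h K then Hold else q)"
definition barred_step where
  "barred_step K g h s = (if s = Hold then Down K else push (2*K+3) g h s)"

text \<open>The vanishing rows are the King condition: letters smaller than \<open>k\<close> occur
  only in rows of index below \<open>K\<close>, and \<open>k\<close> and its bar only in rows of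
  index at most \<open>K\<close>.\<close>

definition nested where
  "nested K f g h \<longleftrightarrow> interlaced f g \<and> interlaced g h \<and> (\<forall>r\<ge>K. f r = 0) \<and> (\<forall>r>K. g r = 0) \<and> (\<forall>r>K. h r = 0)"

definition out where
  "out K f g h s = barred_step K g h (plain_step K f g h s)"

lemma nestedD:
  assumes "nested K f g h"
  shows "g (Suc r) \<le> f r" "f r \<le> g r" "h (Suc r) \<le> g r" "g r \<le> h r"
  using assms by (auto simp: nested_def interlaced_def)

lemma nested_zero:
  assumes "nested K f g h" shows "h (Suc K) = 0" "g (Suc K) = 0" "f K = 0"
  using assms by (auto simp: nested_def)

abbreviation plain_after where
  "plain_after K f g h s \<equiv> plain_step K (act s f) (act (plain_step K f g h s) g) (act (out K f g h s) h)"

abbreviation out_after where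
  "out_after K f g h s \<equiv> out K (act s f) (act (plain_step K f g h s) g) (act (out K f g h s) h)"

text \<open>The bound on \<open>Up\<close> is the King condition for the new box: row
  \<open>K\<close> of \<open>f\<close> stays empty.\<close>

definition good where
  "good K s f \<longleftrightarrow> legal s f \<and> s \<noteq> Hold \<and> fresh (2*K+2) s \<and> (\<forall>r. s = Up r \<longrightarrow> r < K)"

lemma layer_valid:
  assumes c: "nested K f g h" and g: "good K s f"
  shows "nested K (act s f) (act (plain_step K f g h s) g) (act (out K f g h s) h)" (is ?A)
    and "good (Suc K) (out K f g h s) h" (is ?B)
proof -
  have z: "f r = 0" if "r \<ge> K" for r using c that by (auto simp: nested_def)
  have z2: "g r = 0" "h r = 0" if "r > K" for r using c that by (auto simp: nested_def)
  note b = nestedD[OF c]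
  have int: "interlaced f g" "interlaced g h" using c by (auto simp: nested_def)
  define q where "q = push (2*K+2) f g s"
  have q: "legal q g" "interlaced (act s f) (act q g)" "q \<noteq> Hold"
    using push_valid[OF int(1)] g unfolding q_def by (auto simp: good_def, cases s) (auto split: if_splits)
  have sb: "\<forall>r. s = Up r \<longrightarrow> r < K" "\<forall>r. s = Down r \<longrightarrow> r < K"
    using g z unfolding good_def by (auto, metis le_SucI less_irrefl not_le_imp_less)
  have qb: "(\<forall>r. q = Up r \<longrightarrow> r \<le> K) \<and> (\<forall>r. q = Down r \<longrightarrow> r \<le> K) \<and> fresh (2*K+3) q"
    using g sb unfolding q_def good_def by (cases s) (auto split: if_splits)
  have "?A \<and> ?B"
  proof (cases "plain_step K f g h s = Hold")
    case True
    then have h: "q = Up K" "g K < h K" using q(3) unfolding plain_step_def Let_def q_def by (auto split: if_splits)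
    have o: "out K f g h s = Down K" using True by (simp add: out_def barred_step_def)
    have g': "good (Suc K) (Down K) h" using h z2[of "Suc K"] b[of K] b[of "Suc K"] z[of "Suc K"] by (simp add: good_def)
    have "interlaced (act s f) g" unfolding interlaced_def
    proof
      fix r show "g (Suc r) \<le> act s f r \<and> act s f r \<le> g r"
        using b[of r] h q_def g by (cases s) (auto simp: good_def split: if_splits)
    qed
    moreover have "interlaced g (act (Down K) h)" unfolding interlaced_def
    proof
      fix r show "act (Down K) h (Suc r) \<le> g r \<and> g r \<le> act (Down K) h r"
        using b[of r] h by auto
    qed
    moreover have "\<forall>r\<ge>K. act s f r = 0" using z sb by (cases s) auto
    ultimately show ?thesis using g' o True z2 by (simp add: nested_def)
  next
    case False
    then have f: "plain_step K f g h s = q" unfolding plain_step_def Let_def q_def by (auto split: if_splits)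
    have nh: "\<not> (q = Up K \<and> g K < h K)" using False q(3) unfolding plain_step_def Let_def q_def by (auto split: if_splits)
    have o: "out K f g h s = push (2*K+3) g h q" using False f by (simp add: out_def barred_step_def)
    have v: "legal (push (2*K+3) g h q) h" "interlaced (act q g) (act (push (2*K+3) g h q) h)"
      using push_valid[OF int(2) q(1)] by auto
    have D: "g (Suc K) = 0" "h (Suc K) = 0" using z2 by auto
    \<comment> \<open>Here \<open>nh\<close> enters: if row \<open>K\<close> contained a
      \<open>k\<close>-bar, \<open>Up K\<close> would push it out of the rows allowed to it.\<close>
    have ob: "(\<forall>r. push (2*K+3) g h q = Up r \<longrightarrow> r \<le> K) \<and> (\<forall>r. push (2*K+3) g h q = Down r \<longrightarrow> r \<le> K) \<and>
      (\<forall>d. push (2*K+3) g h q = New d \<longrightarrow> 2*K+4 \<le> d) \<and> push (2*K+3) g h q \<noteq> Hold"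
      using qb nh D q(1,3) by (cases q) (auto simp: le_less Suc_le_eq not_less split: if_splits)
    have a0: "\<forall>r\<ge>K. act s f r = 0" using z sb by (cases s) auto
    have a1: "\<forall>r>K. act q g r = 0" using z2 qb by (cases q) auto
    have a2: "\<forall>r>K. act (push (2*K+3) g h q) h r = 0" using z2 ob by (cases "push (2*K+3) g h q") auto
    show ?thesis unfolding f o nested_def good_def using a0 a1 a2 v q ob by (auto simp: less_Suc_eq_le)
  qed
  then show ?A ?B by auto
qed

section \<open>Exceptions inside a layer\<close>

lemma hold_Up:
  assumes c: "nested (Suc m) f g h" and b': "s = Up r \<and> r < m \<or> s = New d"
  and n1: "smooth (2*Suc m+2) f g s (Up m)"
  and h: "f m < g m" "g (Suc m) < h (Suc m)"
  shows "plain_step (Suc m) f g h (Up m) = Hold"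
   "plain_after (Suc m) f g h s (Up m) = Hold"
   "plain_step (Suc m) (act (Up m) f) g (act (Down (Suc m)) h) s = plain_step (Suc m) f g h s"
   "out (Suc m) (act (Up m) f) g (act (Down (Suc m)) h) s = out (Suc m) f g h s"
  using h b' n1 by (auto simp: plain_step_def out_def barred_step_def Let_def smooth_def split: if_splits)

text \<open>An exception leaves \<open>g\<close> alone and takes a box from row \<open>Suc m\<close>
  of \<open>h\<close>; under \<open>n1\<close> the other step does not notice this. Like
  \<open>hold_Up\<close>, the lemma supplies the hypotheses of \<open>hold_commute\<close>.\<close>

lemma hold_Up_Down:
  assumes c: "nested (Suc m) f g h" and legal: "legal2 f (Up m) (Down j)" "j \<le> m"
  and n1: "j = m \<Longrightarrow> g (Suc m) < f m \<and> h (Suc m) < g m" "m = Suc j \<Longrightarrow> g m = f j \<Longrightarrow> h (Suc m) < g m"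
  and h: "f m < g m" "g (Suc m) < h (Suc m)"
  shows
   "plain_after (Suc m) f g h (Down j) (Up m) = Hold" (is ?A)
   "plain_step (Suc m) (act (Up m) f) g (act (Down (Suc m)) h) (Down j) = plain_step (Suc m) f g h (Down j)" (is ?B)
   "out (Suc m) (act (Up m) f) g (act (Down (Suc m)) h) (Down j) = out (Suc m) f g h (Down j)" (is ?C)
proof -
  note b = nestedD[OF c]
  note z = nested_zero[OF c]
  consider "j = m" | "m = Suc j" | "Suc j < m" using legal(2) by linarith
  then have "?A \<and> ?B \<and> ?C"
  proof cases
    case 1
    then show ?thesis using h n1(1) by (auto simp: plain_step_def out_def barred_step_def)
  next
    case 2
    then show ?thesis using h n1(2) b[of m] b[of j] legal z by (auto simp: plain_step_def out_def barred_step_def legal2_def)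
  next
    case 3
    then show ?thesis using h b[of m] b[of j] by (auto simp: plain_step_def out_def barred_step_def)
  qed
  then show ?A ?B ?C by auto
qed

text \<open>\<open>Down j\<close> can create the exception: for \<open>j = m\<close> and
  \<open>g (Suc m) = f m\<close> it shortens row \<open>m\<close> of \<open>f\<close>, so that
  \<open>Up m\<close> afterwards bumps a \<open>k\<close> into row \<open>Suc m\<close>. This
  accounts for the second alternative.\<close>

lemma hold_Up_after_Down:
  assumes c: "nested (Suc m) f g h" and legal: "legal2 f (Up m) (Down j)" "j \<le> m"
  and h: "plain_step (Suc m) f g h (Up m) = Hold \<or> plain_after (Suc m) f g h (Down j) (Up m) = Hold"
  shows "g (Suc m) < h (Suc m) \<and> (f m < g m \<or> j = m \<and> g (Suc m) = f m)"
proof -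
  note b = nestedD[OF c]
  note z = nested_zero[OF c]
  consider "j = m" | "m = Suc j" | "Suc j < m" using legal(2) by linarith
  then show ?thesis
  proof cases
    case 1
    then show ?thesis using h z b[of m] legal by (auto simp: plain_step_def out_def barred_step_def legal2_def split: if_splits)
  next
    case 2
    then show ?thesis using h b[of m] b[of j] legal z by (auto simp: plain_step_def out_def barred_step_def legal2_def split: if_splits)
  next
    case 3
    then show ?thesis using h b[of m] b[of j] by (auto simp: plain_step_def out_def barred_step_def split: if_splits)
  qed
qed

fun after where
  "after K (f, g, h) s = (act s f, act (plain_step K f g h s) g, act (out K f g h s) h)"
fun emit where
  "emit K (f, g, h) s = out K f g h s"

text \<open>The outputs are \<open>(A, C, B)\<close> for \<open>x, y, z\<close> and
  \<open>(A, B, C)\<close> for \<open>y, x, z\<close>: a transposition of the first two steps has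
  become one of the last two.\<close>

definition layer_braid where
  "layer_braid K \<sigma> x y z \<longleftrightarrow> emit K \<sigma> x = emit K \<sigma> y \<and> emit K (after K \<sigma> x) y = emit K (after K (after K \<sigma> y) x) z \<and>
    emit K (after K (after K \<sigma> x) y) z = emit K (after K \<sigma> y) x \<and>
    after K (after K (after K \<sigma> x) y) z = after K (after K (after K \<sigma> y) x) z"

definition layer_commute where
  "layer_commute K \<sigma> x y \<longleftrightarrow> emit K (after K \<sigma> x) y = emit K \<sigma> y \<and> emit K (after K \<sigma> y) x = emit K \<sigma> x \<and>
    after K (after K \<sigma> x) y = after K (after K \<sigma> y) x"

text \<open>The braid lemmas cover the colliding pairs for which an exception cannot be excluded.
  Everything happens in a few rows next to \<open>K\<close>, so each is a finite check on
  comparisons of neighbouring rows.\<close>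

lemma braid_Up_Down:
  assumes c: "nested (Suc m) f g h" and legal: "legal2 f (Up m) (Down m)" "legal (Down m) (act (Up m) (act (Down m) f))"
  and h: "\<not> (g (Suc m) < f m \<and> h (Suc m) < g m)" "g (Suc m) < h (Suc m)" "f m < g m \<or> g (Suc m) = f m"
  shows "layer_braid (Suc m) (f, g, h) (Up m) (Down m) (Down m)"
proof -
  note b = nestedD[OF c]
  note z = nested_zero[OF c]
  show ?thesis
    unfolding layer_braid_def
    apply (cases "f m < g m"; cases "g (Suc m) = f m"; cases "h (Suc m) = g m")
    using legal h z b[of m] b[of "Suc m"]
    by (simp_all add: plain_step_def out_def barred_step_def legal2_def fun_eq_iff)
qed

lemma braid_Up_Down2:
  assumes c: "nested (Suc m) f g h" and j: "m = Suc j" and legal: "legal2 f (Up m) (Down j)" "legal z (act (Up m) (act (Down j) f))"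
  and h: "g (Suc m) < h (Suc m)" "f m < g m" "g m = f j" "h (Suc m) = g m" and z': "z = Down m \<or> z = Down j"
  shows "layer_braid (Suc m) (f, g, h) (Up m) (Down j) z"
proof -
  note b = nestedD[OF c]
  note z = nested_zero[OF c]
  show ?thesis
    unfolding layer_braid_def
    using z' legal h z b[of m] b[of "Suc m"] b[of j] j
    apply (elim disjE)
    by (auto simp add: plain_step_def out_def barred_step_def legal2_def fun_eq_iff)
qed

lemma braid_Up_Up:
  assumes c: "nested (Suc (Suc m)) f g h"
   and h: "f m < g m \<and> f (Suc m) = g (Suc m) \<or> (f m < g m \<and> f (Suc m) < g (Suc m) \<and> g (Suc m) < h (Suc m) \<and> g (Suc (Suc m)) = h (Suc (Suc m))) \<or>
     (f m = g m \<and> f (Suc m) = g (Suc m) \<and> g m < h m \<and> g (Suc m) = h (Suc m))"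
  shows "layer_braid (Suc (Suc m)) (f, g, h) (Up m) (Up (Suc m)) (Up (Suc m))"
proof -
  note b = nestedD[OF c]
  show ?thesis
    unfolding layer_braid_def
    using h b[of m] b[of "Suc m"] b[of "Suc (Suc m)"]
    by (elim disjE; cases "g (Suc m) < h (Suc m)"; cases "g (Suc (Suc m)) < h (Suc (Suc m))")
      (simp_all add: plain_step_def out_def barred_step_def fun_eq_iff)
qed

text \<open>The codes 4 and 5 are the plain and the barred letter of layer 1. A letter of larger
  code passes the layer without touching it and therefore commutes.\<close>

lemma braid_New_Up:
  assumes c: "nested (Suc 0) f g h" and d: "d \<ge> 4" and legal: "legal2 f (New d) (Up 0)" and z: "z = Up 0 \<or> z = New 4 \<and> 4 < d"
  shows "layer_braid (Suc 0) (f, g, h) (New d) (Up 0) z \<or> layer_commute (Suc 0) (f, g, h) (New d) (Up 0)"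
proof -
  note b = nestedD[OF c]
  have h: "h (Suc (Suc 0)) = 0" "g (Suc (Suc 0)) = 0" "f (Suc 0) = 0" using c by (auto simp: nested_def)
  consider "d = 4" | "d = 5" | "d > 5" using d by linarith
  then show ?thesis
    unfolding layer_braid_def layer_commute_def
    using legal z h b[of 0] b[of "Suc 0"]
    by cases ((elim disjE; cases "f 0 < g 0"; cases "f (Suc 0) < g (Suc 0)"; cases "g 0 < h 0"; cases "g (Suc 0) < h (Suc 0)";
      simp add: plain_step_def out_def barred_step_def legal2_def fun_eq_iff)+)
qed

lemma braid_New_New:
  assumes c: "nested 0 f g h" and d: "d \<ge> 2" "e \<ge> 2" "e < d" "e1 < d" "e \<le> e1"
  shows "layer_braid 0 (f, g, h) (New d) (New e) (New e1) \<or> layer_commute 0 (f, g, h) (New d) (New e)"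
proof -
  note b = nestedD[OF c]
  have z: "h (Suc 0) = 0" "g (Suc 0) = 0" "f 0 = 0" using c by (auto simp: nested_def)
  consider "d = 3" "e = 2" "e1 = 2" | "d > 3" using d by linarith
  then show ?thesis
    unfolding layer_braid_def layer_commute_def
    using d z b[of 0]
    apply cases
    apply (cases "g 0 < h 0")
    by (simp_all add: plain_step_def out_def barred_step_def legal2_def fun_eq_iff)
qed

text \<open>An exception turns the attempted \<open>Up K\<close> into \<open>Down K\<close>. Since
  rows beyond \<open>K\<close> are empty, these two are neighbours in the order, so the replacement
  does not disturb the comparison with the other step; without exceptions this is
  \<open>push_bump\<close> applied twice.\<close>

lemma layer_bump:
  assumes c: "nested K f g h" and g: "good K s f" "good K t (act s f)"
  shows "below (emit K (f,g,h) s) (emit K (after K (f,g,h) s) t) \<longleftrightarrow> below s t"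
proof -
  note b = nestedD[OF c]
  have z: "h (Suc K) = 0" "g (Suc K) = 0" "f K = 0" using c by (auto simp: nested_def)
  have z2: "f r = 0" if "r \<ge> K" for r using c that by (auto simp: nested_def)
  have int: "interlaced f g" "interlaced g h" using c by (auto simp: nested_def)
  have sh: "s \<noteq> Hold" "t \<noteq> Hold" using g by (auto simp: good_def)
  define s1 where "s1 = push (2*K+2) f g s"
  define hh1 where "hh1 = (s1 = Up K \<and> g K < h K)"
  have s1h: "s1 \<noteq> Hold" using sh unfolding s1_def by (cases s) auto
  have f1: "plain_step K f g h s = (if hh1 then Hold else s1)" unfolding plain_step_def hh1_def s1_def Let_def by simp
  show ?thesis
  proof (cases hh1)
    case True
    then have s: "s = New (2*K+2) \<and> K = 0 \<or> s = Up (K - 1) \<and> 0 < K \<and> f (K-1) < g (K-1)"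
      using g(1) unfolding hh1_def s1_def good_def by (cases s) (auto split: if_splits)
    have sK: "g K < h K" using True by (simp add: hh1_def)
    have e: "after K (f,g,h) s = (act s f, g, act (Down K) h)" "emit K (f,g,h) s = Down K"
      using f1 True by (auto simp: out_def barred_step_def)
    show ?thesis
    proof (cases K)
      case 0
      then show ?thesis using s e g by (cases t) (auto simp: good_def plain_step_def out_def barred_step_def z2 split: if_splits)
    next
      case (Suc m)
      have tD: "x \<le> m" if "t = Down x" for x
        using g(2) s Suc z2[of x] z2[of "Suc x"] that by (cases "x \<le> m") (auto simp: good_def)
      show ?thesis using Suc tD s e g sK z b[of m] b[of "m-1"] b[of "K"]
       by (cases t) (auto simp: good_def plain_step_def out_def barred_step_def z2 split: if_splits)
    qed
  next
    case False
    define s2 where "s2 = push (2*K+3) g h s1"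
    have e: "after K (f,g,h) s = (act s f, act s1 g, act s2 h)" "emit K (f,g,h) s = s2"
      using f1 False s1h by (auto simp: out_def barred_step_def s2_def)
    define t1 where "t1 = push (2*K+2) (act s f) (act s1 g) t"
    define hh2 where "hh2 = (t1 = Up K \<and> act s1 g K < act s2 h K)"
    have t1h: "t1 \<noteq> Hold" using sh unfolding t1_def by (cases t) auto
    have f2: "plain_step K (act s f) (act s1 g) (act s2 h) t = (if hh2 then Hold else t1)" unfolding plain_step_def hh2_def t1_def Let_def by simp
    have new: "fresh (2*K+2) s" "fresh (2*K+2) t" using g by (auto simp: good_def)
    have okk: "legal s f" "legal t (act s f)" using g by (auto simp: good_def)
    have b1: "below s1 t1 \<longleftrightarrow> below s t" using push_bump[OF int(1) okk sh new] unfolding s1_def t1_def by blast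
    have v1: "legal s1 g" "legal t1 (act s1 g)"
      using push_valid[OF int(1) okk(1), of "2*K+2"] push_valid[OF _ okk(2)] unfolding s1_def t1_def by auto
    have new1: "fresh (2*K+3) s1" "fresh (2*K+3) t1"
      using new unfolding s1_def t1_def by (cases s; auto split: if_splits) (use new in \<open>cases t; auto split: if_splits\<close>)
    show ?thesis
    proof (cases hh2)
      case True
      have o: "emit K (after K (f,g,h) s) t = Down K" using True f2 e by (auto simp: out_def barred_step_def)
      have sD: "r < K" if "s = Down r" for r
        using g(1) that z2[of r] z2[of "Suc r"] by (cases "r < K") (auto simp: good_def)
      have sb: "(\<forall>r. s1 = Up r \<longrightarrow> r \<le> K) \<and> (\<forall>r. s1 = Down r \<longrightarrow> r \<le> K)"
        using g(1) sD unfolding s1_def good_def by (cases s) (auto split: if_splits)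
      have t1: "t1 = Up K" using True by (auto simp: hh2_def)
      have "below s2 (Down K) \<longleftrightarrow> below s1 t1"
        using True False s1h sb z t1 v1 unfolding hh2_def hh1_def s2_def by (cases s1) (auto split: if_splits)
      then show ?thesis using o e b1 by simp
    next
      case False
      have o: "emit K (after K (f,g,h) s) t = push (2*K+3) (act s1 g) (act s2 h) t1" using False f2 e t1h by (auto simp: out_def barred_step_def)
      show ?thesis unfolding o e(2) using push_bump[OF int(2) v1 s1h t1h new1] b1 unfolding s2_def by blast
    qed
  qed
qed

text \<open>A layer pushes twice, so \<open>Up m\<close> can descend two rows and collide with a
  step that is not adjacent to it at first. This leaves two possible rows for
  \<open>z\<close>.\<close>

lemma braid_Up_Up2:
  assumes c: "nested (Suc (Suc (Suc m))) f g h" and h: "f m < g m" "f (Suc (Suc m)) = g (Suc (Suc m))" "g (Suc m) < h (Suc m)" "g (Suc (Suc m)) = h (Suc (Suc m))"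
   and z: "z = Up (Suc m) \<or> z = Up (Suc (Suc m))"
  shows "layer_braid (Suc (Suc (Suc m))) (f, g, h) (Up m) (Up (Suc (Suc m))) z"
proof -
  note b = nestedD[OF c]
  show ?thesis
    unfolding layer_braid_def
    using z h b[of m] b[of "Suc m"] b[of "Suc (Suc m)"]
    by (elim disjE) (simp_all add: plain_step_def out_def barred_step_def fun_eq_iff)
qed

text \<open>The code 6 is the plain letter of layer 2: it enters row 0 at the first push and is
  carried to row 1 at the second, where it meets \<open>Up (Suc 0)\<close>.\<close>

lemma braid_New_Up2:
  assumes c: "nested (Suc (Suc 0)) f g h" and h: "f (Suc 0) = g (Suc 0)" "g 0 < h 0" "g (Suc 0) = h (Suc 0)"
   and z: "z = Up 0 \<or> z = Up (Suc 0)"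
  shows "layer_braid (Suc (Suc 0)) (f, g, h) (New 6) (Up (Suc 0)) z"
proof -
  note b = nestedD[OF c]
  show ?thesis
    unfolding layer_braid_def
    using z h b[of 0] b[of "Suc 0"]
    by (elim disjE) (simp_all add: plain_step_def out_def barred_step_def fun_eq_iff)
qed

lemma commute_New_New:
  assumes c: "nested 0 f g h" and d: "d \<ge> 2" "e \<ge> 2" "e < d" and n: "smooth (2*0+3) g h (push (2*0+2) f g (New d)) (push (2*0+2) f g (New e))"
  shows "layer_commute 0 (f, g, h) (New d) (New e)"
proof -
  consider "d = 3" "e = 2" | "d > 3" using d by linarith
  then show ?thesis
    unfolding layer_commute_def
    using d n
    apply cases
    by (auto simp add: plain_step_def out_def barred_step_def smooth_def fun_eq_iff numeral_2_eq_2 numeral_3_eq_3 split: if_splits)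
qed

definition no_hold where
  "no_hold K f g h p \<longleftrightarrow> plain_step K f g h (fst p) \<noteq> Hold \<and>
    plain_after K f g h (fst p) (snd p) \<noteq> Hold"

definition good_pair where
  "good_pair K p f \<longleftrightarrow> good K (fst p) f \<and> good K (snd p) (act (fst p) f)"

definition emit_pair where
  "emit_pair K \<sigma> p = (emit K \<sigma> (fst p), emit K (after K \<sigma> (fst p)) (snd p))"
definition after_pair where
  "after_pair K \<sigma> p = after K (after K \<sigma> (fst p)) (snd p)"

abbreviation swapped_after where
  "swapped_after K f g h p q \<equiv> after_pair K (f,g,h) p = after_pair K (f,g,h) q \<and> swapped h (emit_pair K (f,g,h) p) (emit_pair K (f,g,h) q)"

lemma push_fresh: "fresh c s \<Longrightarrow> fresh (Suc c) (push c f g s)"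
  by (cases s) (auto split: if_splits)

lemma push_not_Hold: "s \<noteq> Hold \<Longrightarrow> push c f g s \<noteq> Hold"
  by (cases s) auto

lemma plain_step_no_hold: "plain_step K f g h s \<noteq> Hold \<Longrightarrow> plain_step K f g h s = push (2*K+2) f g s"
  "plain_step K f g h s \<noteq> Hold \<Longrightarrow> out K f g h s = push (2*K+3) g h (push (2*K+2) f g s)"
  by (auto simp: plain_step_def out_def barred_step_def Let_def split: if_splits)

lemma no_hold_pair:
  assumes "no_hold K f g h p"
  shows "emit_pair K (f,g,h) p = push_pair (2*K+3) g h (push_pair (2*K+2) f g p)" (is ?A)
    "after_pair K (f,g,h) p = (act_pair p f, act_pair (push_pair (2*K+2) f g p) g, act_pair (push_pair (2*K+3) g h (push_pair (2*K+2) f g p)) h)" (is ?B)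
proof -
  have h: "plain_step K f g h (fst p) \<noteq> Hold"
    "plain_after K f g h (fst p) (snd p) \<noteq> Hold"
    using assms by (auto simp: no_hold_def)
  note e1 = plain_step_no_hold[OF h(1)] and e2 = plain_step_no_hold[OF h(2)]
  show ?A
    by (simp only: emit_pair_def after.simps emit.simps e2) (simp only: e1 push_pair_def fst_conv snd_conv)
  show ?B
    by (simp only: after_pair_def after.simps emit.simps e2) (simp only: e1 push_pair_def act_pair_def fst_conv snd_conv)
qed

lemma legal_push_pair:
  assumes int: "interlaced f g" and legal: "legal_pair f p"
  shows "legal_pair g (push_pair c f g p)"
  using push_valid[OF int, of "fst p"] push_valid(1)[of "act (fst p) f" _ "snd p"] legal unfolding legal_pair_def push_pair_def by auto

lemma layer_pair_no_hold:
  assumes c: "nested K f g h" and swapped: "swapped f p q" and g: "good_pair K p f" "good_pair K q f"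
    and n1: "smooth (2*K+2) f g (fst p) (fst q)" and n2: "smooth (2*K+3) g h (push (2*K+2) f g (fst p)) (push (2*K+2) f g (fst q))"
    and nh: "no_hold K f g h p" "no_hold K f g h q"
  shows "swapped_after K f g h p q"
proof -
  have int: "interlaced f g" "interlaced g h" using c by (auto simp: nested_def)
  have legal: "legal_pair f p" "legal_pair f q" using g by (auto simp: legal_pair_def good_pair_def good_def)
  have new: "fresh (2*K+2) (fst p)" "fresh (2*K+2) (fst q)"
    using g by (auto simp: good_pair_def good_def)
  have s1: "swapped g (push_pair (2*K+2) f g p) (push_pair (2*K+2) f g q)"
    by (rule push_swapped[OF int(1) swapped legal new n1])
  have new2: "fresh (2*K+3) (fst (push_pair (2*K+2) f g p))" "fresh (2*K+3) (fst (push_pair (2*K+2) f g q))"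
    using push_fresh[OF new(1)] push_fresh[OF new(2)] by (simp_all add: push_pair_def numeral_3_eq_3)
  have s2: "swapped h (push_pair (2*K+3) g h (push_pair (2*K+2) f g p)) (push_pair (2*K+3) g h (push_pair (2*K+2) f g q))"
    by (rule push_swapped[OF int(2) s1 legal_push_pair[OF int(1) legal(1)] legal_push_pair[OF int(1) legal(2)] new2]) (use n2 in \<open>simp add: push_pair_def\<close>)
  show ?thesis using s2 swapped_act[OF swapped] swapped_act[OF s1] swapped_act[OF s2] by (simp add: no_hold_pair[OF nh(1)] no_hold_pair[OF nh(2)])
qed

lemma hold_step:
  assumes "plain_step K f g h s = Hold" "good K s f'"
  shows "s = New 2 \<and> K = 0 \<or> (\<exists>m. K = Suc m \<and> s = Up m)"
  using assms by (cases s) (auto simp: plain_step_def good_def Let_def split: if_splits)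

lemma commute_pair:
  assumes c: "nested K f g h" and g: "good_pair K (x,y) f" "good_pair K (y,x) f" and b: "below x y" and layer_commute: "layer_commute K (f,g,h) x y"
  shows "swapped_after K f g h (x,y) (y,x)"
proof -
  have "below (emit K (f,g,h) x) (emit K (after K (f,g,h) x) y)"
    using layer_bump[OF c, of x y] g b by (auto simp: good_pair_def)
  then show ?thesis using layer_commute by (auto simp: layer_commute_def after_pair_def emit_pair_def swapped_def simp del: after.simps emit.simps)
qed

text \<open>
  A swapped pair crosses a tame layer as a swapped pair. If tameness fails, the exit steps of the pair need not be related, but
  then a third step satisfying the Knuth condition restores the relation.
\<close>

definition tame where
  "tame K f g h x y \<longleftrightarrow> smooth (2*K+2) f g x y \<and> smooth (2*K+3) g h (push (2*K+2) f g x) (push (2*K+2) f g y) \<and>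
    (\<forall>m j. K = Suc m \<longrightarrow> x = Up m \<longrightarrow> y = Down j \<longrightarrow>
      ((j = m \<longrightarrow> g (Suc m) < f m \<and> h (Suc m) < g m) \<and> (m = Suc j \<longrightarrow> g m = f j \<longrightarrow> h (Suc m) < g m)) \<or>
      no_hold K f g h (x,y) \<and> no_hold K f g h (y,x))"

lemma Down_less:
  assumes "nested K f g h" "good K (Down j) f" shows "j < K"
  using assms by (cases "j < K") (auto simp: nested_def good_def)

lemma Hold_same: "plain_step K f g h s = Hold \<Longrightarrow> act (plain_step K f g h s) g = g"
   "plain_step K f g h s = Hold \<Longrightarrow> out K f g h s = Down K" by (simp_all add: out_def barred_step_def)

lemma hold_commute:
  assumes h1: "plain_step K f g h y = Hold" and h2: "plain_after K f g h x y = Hold"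
   and e: "plain_step K (act y f) g (act (Down K) h) x = plain_step K f g h x" "out K (act y f) g (act (Down K) h) x = out K f g h x"
  shows "layer_commute K (f,g,h) x y"
proof -
  have o: "out K f g h y = Down K" using h1 by (rule Hold_same)
  have o2: "out_after K f g h x y = Down K" using h2 by (rule Hold_same)
  have hh: "act Hold g = g" by simp
  show ?thesis unfolding layer_commute_def
    by (simp only: after.simps emit.simps o o2 h1 h2 hh e act.simps(4) act_commute[of y x] act_commute[of "Down K"] simp_thms)
qed

text \<open>Either no exception occurs in the two orders and the layer amounts to two pushes, or the
  exception occurs in both and commutes with the other step. The last clause of \<open>tame\<close>
  excludes that \<open>Down j\<close> decides whether \<open>Up m\<close> is exceptional.\<close>

lemma layer_pair:
  assumes c: "nested K f g h" and swapped: "swapped f p q" and g: "good_pair K p f" "good_pair K q f"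
    and tame: "tame K f g h (fst p) (fst q)"
  shows "swapped_after K f g h p q"
proof (cases "no_hold K f g h p \<and> no_hold K f g h q")
  case True
  then show ?thesis using layer_pair_no_hold[OF c swapped g] tame by (auto simp: tame_def)
next
  case False
  note nhf = False
  note bb = nestedD[OF c]
  consider (a) x y where "p = (x, y)" "q = (y, x)" "below x y" |
     (b) i j where "i < j" "f i = f j" "p = (Up i, Down i)" "q = (Down j, Up j)"
    using swapped by (auto simp: swapped_def)
  then show ?thesis
  proof cases
    case a
    have gs: "good K x f" "good K y (act x f)" "good K y f" "good K x (act y f)"
      using g a by (auto simp: good_pair_def)
    have legal2: "legal2 f x y" using gs by (auto simp: legal2_def good_def)
    have n1: "smooth (2*K+2) f g x y" and n2: "smooth (2*K+3) g h (push (2*K+2) f g x) (push (2*K+2) f g y)" using tame a by (auto simp: tame_def)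
    have "layer_commute K (f,g,h) x y"
    proof (cases K)
      case 0
      then obtain d e where de: "x = New d" "y = New e" using gs(1,3) Down_less[OF c] a(3) by (cases x; cases y) (auto simp: good_def)
      then show ?thesis using commute_New_New[of f g h d e] c 0 n2 a(3) gs by (auto simp: good_def)
    next
      case (Suc m)
      have h: "x = Up m \<or> y = Up m"
        using False hold_step[OF _ gs(1)] hold_step[OF _ gs(2)] hold_step[OF _ gs(3)] hold_step[OF _ gs(4)] Suc
        unfolding a no_hold_def by fastforce
      show ?thesis
      proof (cases "x = Up m")
        case True
        then obtain j where j: "y = Down j" using a(3) gs(3) Suc by (cases y) (auto simp: good_def)
        have jm: "j \<le> m" using Down_less[OF c, of j] gs(3) j Suc by (simp add: less_Suc_eq_le)
        have cc: "(j = m \<longrightarrow> g (Suc m) < f m \<and> h (Suc m) < g m) \<and> (m = Suc j \<longrightarrow> g m = f j \<longrightarrow> h (Suc m) < g m)"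
          using tame False Suc True j unfolding tame_def a by auto
        have yh: "plain_step K f' g' h' y \<noteq> Hold" for f' g' h' using j by (simp add: plain_step_def)
        have hh: "f m < g m" "g (Suc m) < h (Suc m)"
        proof -
          have "plain_step K f g h x = Hold \<or> plain_after K f g h y x = Hold"
            using nhf yh unfolding a no_hold_def by auto
          then have "g (Suc m) < h (Suc m) \<and> (f m < g m \<or> j = m \<and> g (Suc m) = f m)"
            using hold_Up_after_Down[of m f g h j] c legal2 jm unfolding True Suc j by blast
          then show "f m < g m" "g (Suc m) < h (Suc m)" using cc by auto
        qed
        have xh: "plain_step K f g h x = Hold" using hh True Suc by (auto simp: plain_step_def)
        have cc': "j = m \<Longrightarrow> g (Suc m) < f m \<and> h (Suc m) < g m" "m = Suc j \<Longrightarrow> g m = f j \<Longrightarrow> h (Suc m) < g m"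
          using cc by auto
        have cK: "nested (Suc m) f g h" and okj: "legal2 f (Up m) (Down j)" using c legal2 True j Suc by auto
        note HD = hold_Up_Down[of m f g h j, OF cK okj jm cc' hh]
        have xh': "plain_step (Suc m) f g h (Up m) = Hold" using xh True Suc by simp
        have "layer_commute K (f,g,h) y x"
          unfolding True j Suc by (rule hold_commute[OF xh' HD])
        then show ?thesis unfolding layer_commute_def by auto
      next
        case False
        then have y: "y = Up m" using h by auto
        then have x: "(\<exists>r. x = Up r \<and> r < m) \<or> (\<exists>d. x = New d)" using a(3) by (cases x) auto
        have hh: "f m < g m" "g (Suc m) < h (Suc m)"
        proof -
          have xh: "plain_step K f' g' h' x \<noteq> Hold" for f' g' h' using x Suc by (auto simp: plain_step_def Let_def split: if_splits)
          have "plain_step K f g h y = Hold \<or> plain_after K f g h x y = Hold"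
            using nhf xh unfolding a no_hold_def by auto
          then have "f m < g m \<and> g (Suc m) < h (Suc m)"
          proof
            assume "plain_step K f g h y = Hold"
            then show ?thesis using y Suc by (auto simp: plain_step_def split: if_splits)
          next
            assume "plain_after K f g h x y = Hold"
            then have "act x f m < act (push (2*K+2) f g x) g m \<and>
                act (push (2*K+2) f g x) g K < act (push (2*K+3) g h (push (2*K+2) f g x)) h K"
              unfolding plain_step_no_hold[OF xh] y by (auto simp: plain_step_def Suc simp del: act.simps split: if_splits)
            then show ?thesis using x n1 n2 unfolding y Suc smooth_def
              by (elim disjE exE conjE; hypsubst) (auto split: if_splits)
          qed
          then show "f m < g m" "g (Suc m) < h (Suc m)" by auto
        qed
        obtain r d where rd: "x = Up r \<and> r < m \<or> x = New d" using x by auto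
        note HU = hold_Up[of m f g h, OF _ rd _ hh]
        show ?thesis
          unfolding y Suc
          by (rule hold_commute; rule HU; (use c n1 y Suc in simp)?)
      qed
    qed
    then show ?thesis using commute_pair[OF c _ _ a(3)] g a by auto
  next
    case b
    \<comment> \<open>An exchange pair meets no exception: \<open>Up i\<close> stays above row
      \<open>K\<close>, and after \<open>Down j\<close> the step \<open>Up j\<close> reaches row
      \<open>K\<close> only if rows \<open>j\<close> and \<open>K\<close> of \<open>g\<close> had
      equal length, which leaves no room for a \<open>k\<close>-bar in row \<open>K\<close>.\<close>
    have j: "j < K" using Down_less[OF c, of j] g(2) b by (auto simp: good_pair_def)
    have m: "f y \<le> f x" if "x \<le> y" for x y using lift_Suc_antimono_le[of f, OF _ that] bb order_trans by blast
    have e: "f (j-1) = f j" using m[of i "j-1"] m[of "j-1" j] b(1,2) by auto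
    have p: "no_hold K f g h p" using b j by (auto simp: no_hold_def plain_step_def)
    have "plain_after K f g h (Down j) (Up j) \<noteq> Hold"
    proof (cases "K = Suc j")
      case True
      have "f (Suc j) = 0" "h (Suc (Suc j)) = 0" using c True by (auto simp: nested_def)
      moreover have "f (Suc j) < f j" using g(2) b by (auto simp: good_pair_def good_def)
      ultimately show ?thesis using True e b(1) bb[of j] bb[of "j-1"] bb[of "Suc j"] by (auto simp: plain_step_def out_def barred_step_def split: if_splits)
    next
      case False
      then show ?thesis using j by (auto simp: plain_step_def split: if_splits)
    qed
    then have "no_hold K f g h q" using b j by (auto simp: no_hold_def plain_step_def[of _ f g h "Down j"])
    then show ?thesis using p nhf by blast
  qed
qed

section \<open>Knuth relations between triples of steps\<close>

definition good_triple where
  "good_triple K f s \<longleftrightarrow> good K (fst s) f \<and> good_pair K (snd s) (act (fst s) f)"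

text \<open>The two Knuth relations, with the exchange of two letters generalised to \<open>swapped\<close>.\<close>

definition related where
  "related f s t \<longleftrightarrow>
    (\<exists>a p q. swapped (act a f) p q \<and> \<not> below a (fst p) \<and> below a (fst q) \<and> s = (a, q) \<and> t = (a, p)) \<or>
    (\<exists>a p q. swapped f p q \<and> below (snd q) a \<and> \<not> below (snd p) a \<and> s = (fst p, snd p, a) \<and> t = (fst q, snd q, a))"

lemma relatedI1: "swapped (act a f) p q \<Longrightarrow> \<not> below a (fst p) \<Longrightarrow> below a (fst q) \<Longrightarrow> related f (a, q) (a, p)"
  unfolding related_def by blast

definition emit_triple where "emit_triple K \<sigma> s = (emit K \<sigma> (fst s), emit_pair K (after K \<sigma> (fst s)) (snd s))"
definition after_triple where "after_triple K \<sigma> s = after_pair K (after K \<sigma> (fst s)) (snd s)"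

abbreviation related_after where
  "related_after K f g h s t \<equiv> after_triple K (f,g,h) s = after_triple K (f,g,h) t \<and> related h (emit_triple K (f,g,h) s) (emit_triple K (f,g,h) t)"

text \<open>The common first step \<open>a\<close> lies between \<open>fst p\<close> and
  \<open>fst q\<close> in the order, and this makes the pair tame, so the relation keeps its kind.
  An ordinary \<open>a\<close> acts through \<open>push_smooth\<close>; an exceptional one lengthens
  row \<open>m\<close> of \<open>f\<close> and shortens row \<open>Suc m\<close> of
  \<open>h\<close>.\<close>

lemma layer_related1:
  assumes c: "nested K f g h" and good_triple: "good_triple K f (a, q)" "good_triple K f (a, p)"
    and swapped: "swapped (act a f) p q" and bl: "\<not> below a (fst p)" "below a (fst q)"
  shows "related_after K f g h (a, q) (a, p)"
proof -
  define f1 where "f1 = act a f"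
  define g1 where "g1 = act (plain_step K f g h a) g"
  define h1 where "h1 = act (out K f g h a) h"
  note b = nestedD[OF c]
  have int: "interlaced f g" "interlaced g h" using c by (auto simp: nested_def)
  have ga: "good K a f" and g: "good_pair K p f1" "good_pair K q f1" using good_triple by (auto simp: good_triple_def f1_def)
  have g1: "good K (fst p) f1" "good K (fst q) f1" using g by (auto simp: good_pair_def)
  have c1: "nested K f1 g1 h1" using layer_valid(1)[OF c ga] by (simp add: f1_def g1_def h1_def)
  have st: "after K (f,g,h) a = (f1,g1,h1)" by (simp add: f1_def g1_def h1_def)
  have "tame K f1 g1 h1 (fst p) (fst q)"
  proof (cases "plain_step K f g h a = Hold")
    case True
    have K0: "K \<noteq> 0"
    proof
      assume K: "K = 0"
      then have "a = New 2" using hold_step[OF True ga] by auto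
      then show False using bl(2) g1(2) Down_less[OF c1] K by (cases "fst q") (auto simp: good_def)
    qed
    then obtain m where m: "K = Suc m" "a = Up m" using hold_step[OF True ga] by auto
    have e: "g1 = g" "h1 = act (Down K) h" using True by (simp_all add: g1_def h1_def Hold_same)
    obtain j where j: "fst q = Down j" using bl(2) g1(2) m by (cases "fst q") (auto simp: good_def)
    have pp: "(\<exists>r. fst p = Up r) \<or> (\<exists>d. fst p = New d)" using bl(1) g1(1) m by (cases "fst p") (auto simp: good_def)
    have "g1 (Suc m) < f1 m" "h1 (Suc m) < g1 m" using b[of m] e m by (auto simp: f1_def)
    moreover have "smooth (2*K+2) f1 g1 (fst p) (fst q)" using pp j by (auto simp: smooth_def)
    moreover have "smooth (2*K+3) g1 h1 (push (2*K+2) f1 g1 (fst p)) (push (2*K+2) f1 g1 (fst q))" using pp j by (auto simp: smooth_def split: if_splits)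
    ultimately show ?thesis using m by (auto simp: tame_def)
  next
    case False
    define a1 where "a1 = push (2*K+2) f g a"
    define a2 where "a2 = push (2*K+3) g h a1"
    have e: "g1 = act a1 g" "h1 = act a2 h" "f1 = act a f" using plain_step_no_hold[OF False] by (simp_all add: g1_def h1_def f1_def a1_def a2_def)
    have oka: "legal a f" "a \<noteq> Hold" "fresh (2*K+2) a" using ga by (auto simp: good_def)
    have okp: "legal (fst p) (act a f)" "legal (fst q) (act a f)" "fst p \<noteq> Hold" "fst q \<noteq> Hold" "fresh (2*K+2) (fst p)" "fresh (2*K+2) (fst q)"
      using g1 by (auto simp: good_def f1_def)
    have n1: "smooth (2*K+2) f1 g1 (fst p) (fst q)"
      using push_smooth[OF int(1) oka(1) bl oka(3)] by (simp add: e a1_def)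
    have ok1: "legal a1 g" using push_valid(1)[OF int(1) oka(1)] by (simp add: a1_def)
    have new1: "fresh (2*K+3) a1" using push_fresh[OF oka(3)] by (simp add: a1_def numeral_3_eq_3)
    have bl1: "\<not> below a1 (push (2*K+2) f1 g1 (fst p))" "below a1 (push (2*K+2) f1 g1 (fst q))"
      using push_bump[OF int(1) oka(1) okp(1) oka(2) okp(3) oka(3) okp(5)] push_bump[OF int(1) oka(1) okp(2) oka(2) okp(4) oka(3) okp(6)] bl
      by (auto simp: e a1_def)
    have n2: "smooth (2*K+3) g1 h1 (push (2*K+2) f1 g1 (fst p)) (push (2*K+2) f1 g1 (fst q))"
      using push_smooth[OF int(2) ok1 bl1 new1] by (simp add: e a2_def)
    have ud: "((j = m \<longrightarrow> g1 (Suc m) < f1 m \<and> h1 (Suc m) < g1 m) \<and> (m = Suc j \<longrightarrow> g1 m = f1 j \<longrightarrow> h1 (Suc m) < g1 m)) \<or>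
      no_hold K f1 g1 h1 (Up m, Down j) \<and> no_hold K f1 g1 h1 (Down j, Up m)" if K: "K = Suc m" and p: "fst p = Up m" and q: "fst q = Down j" for m j
    proof -
      have z: "f (Suc m) = 0" "h (Suc (Suc m)) = 0" "g (Suc (Suc m)) = 0" using c K by (auto simp: nested_def)
      have cK: "nested (Suc m) f1 g1 h1" using c1 K by simp
      have jm: "j \<le> m" using Down_less[OF c1, of j] g1(2) q K by (simp add: less_Suc_eq_le)
      \<comment> \<open>In the order, \<open>a\<close> lies weakly after \<open>Up m\<close> and
        strictly before \<open>Down j\<close>, and no row beyond \<open>m\<close> is
        available.\<close>
      have "a = Up m \<or> (\<exists>i. a = Down i \<and> j < i \<and> i \<le> m)"
        using bl p q ga K Down_less[OF c, of] by (cases a) (force simp: good_def less_Suc_eq_le)+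
      then show ?thesis
      proof
        assume a: "a = Up m"
        have nh: "\<not> (g1 (Suc m) < h1 (Suc m) \<and> (f1 m < g1 m \<or> j = m \<and> g1 (Suc m) = f1 m))"
          using False b[of m] b[of "Suc m"] K a unfolding e a2_def a1_def
          by (auto simp: plain_step_def split: if_splits)
        have legal2: "legal2 f1 (Up m) (Down j)"
        proof -
          have "p = (Up m, Down j) \<and> q = (Down j, Up m) \<or> (\<exists>i j. i < j \<and> p = (Up i, Down i) \<and> q = (Down j, Up j))"
            using swapped p q unfolding swapped_def by auto
          then show ?thesis
          proof
            assume "p = (Up m, Down j) \<and> q = (Down j, Up m)"
            then show ?thesis using g by (auto simp: legal2_def good_pair_def good_def)
          next
            assume "\<exists>i j. i < j \<and> p = (Up i, Down i) \<and> q = (Down j, Up j)"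
            then show ?thesis using p q jm by auto
          qed
        qed
        have "plain_step (Suc m) f' g' h' (Down j) \<noteq> Hold" for f' g' h' by (auto simp: plain_step_def)
        then show ?thesis using nh hold_Up_after_Down[OF cK legal2 jm] unfolding no_hold_def K fst_conv snd_conv by blast
      next
        assume "\<exists>i. a = Down i \<and> j < i \<and> i \<le> m"
        then obtain i where i: "a = Down i" "j < i" "i \<le> m" by blast
        have "h1 (Suc m) < g1 m" if "m = Suc j" "g1 m = f1 j"
        proof -
          have im: "i = Suc j" "m = Suc j" using i that by auto
          show ?thesis
          proof (cases "g (Suc i) = f i")
            case True
            then have a1: "a1 = Down (Suc m)" using i(1) im by (simp add: a1_def)
            have "f (Suc m) < f m" using oka(1) i(1) im by simp
            then have "a2 = Down (Suc m)" using True z im unfolding a2_def a1 by simp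
            then show ?thesis using e a1 b[of m] by simp
          next
            case False
            then have "a1 = Down m" using i(1) im by (simp add: a1_def)
            then show ?thesis using that(2) e i(1) im b[of j] by simp
          qed
        qed
        then show ?thesis using i by auto
      qed
    qed
    show ?thesis unfolding tame_def
    proof (intro conjI allI impI n1 n2)
      fix m j assume "K = Suc m" "fst p = Up m" "fst q = Down j"
      from ud[OF this] this show "(j = m \<longrightarrow> g1 (Suc m) < f1 m \<and> h1 (Suc m) < g1 m) \<and> (m = Suc j \<longrightarrow> g1 m = f1 j \<longrightarrow> h1 (Suc m) < g1 m) \<or>
        no_hold K f1 g1 h1 (fst p, fst q) \<and> no_hold K f1 g1 h1 (fst q, fst p)" by simp
    qed
  qed
  from layer_pair[OF c1 swapped[folded f1_def] g this]
  have "after_pair K (f1,g1,h1) p = after_pair K (f1,g1,h1) q" "swapped h1 (emit_pair K (f1,g1,h1) p) (emit_pair K (f1,g1,h1) q)" by auto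
  moreover have "\<not> below (emit K (f,g,h) a) (fst (emit_pair K (f1,g1,h1) p))" "below (emit K (f,g,h) a) (fst (emit_pair K (f1,g1,h1) q))"
    using layer_bump[OF c ga, of "fst p"] layer_bump[OF c ga, of "fst q"] g1 bl unfolding st f1_def[symmetric] by (simp_all add: emit_pair_def del: emit.simps)
  moreover have "h1 = act (emit K (f,g,h) a) h" by (simp add: h1_def)
  ultimately show ?thesis unfolding after_triple_def emit_triple_def fst_conv snd_conv st using relatedI1 by metis
qed

fun holds where "holds K (f,g,h) s \<longleftrightarrow> plain_step K f g h s = Hold"

lemma holds_step:
  assumes "holds K \<sigma> s" "good K s f"
  shows "s = New 2 \<and> K = 0 \<or> (\<exists>m. K = Suc m \<and> s = Up m)"
  using assms hold_step by (cases \<sigma>) auto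

lemma braid_related:
  assumes c: "nested K f g h" and g: "good_triple K f (x, y, z)" "good_triple K f (y, x, z)" and b: "below x y" "below x z"
   and layer_braid: "layer_braid K (f,g,h) x y z"
  shows "related_after K f g h (x, y, z) (y, x, z)"
proof -
  let ?s = "(f,g,h)"
  have gs: "good K x f" "good K y (act x f)" "good K y f" "good K x (act y f)" "good K z (act x (act y f))"
    using g by (auto simp: good_triple_def good_pair_def)
  have nb: "\<not> below y x" using b(1) by (cases x; cases y) auto
  obtain f1 g1 h1 where s1: "after K ?s y = (f1,g1,h1)" by (cases "after K ?s y")
  have n1: "f1 = act y f" using s1 by auto
  have c1: "nested K f1 g1 h1" using layer_valid(1)[OF c gs(3)] s1 by auto
  have 1: "below (emit K ?s x) (emit K (after K ?s x) y)" using layer_bump[OF c gs(1,2)] b by simp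
  have 2: "\<not> below (emit K ?s y) (emit K (after K ?s y) x)" using layer_bump[OF c gs(3,4)] nb by simp
  have 3: "below (emit K (after K ?s y) x) (emit K (after K (after K ?s y) x) z)"
    unfolding s1 using layer_bump[OF c1, of x z] gs(4,5) b n1 by simp
  define A where "A = emit K ?s x"
  define B where "B = emit K (after K ?s y) x"
  define C where "C = emit K (after K ?s x) y"
  have o: "emit_triple K ?s (x, y, z) = (A, C, B)" "emit_triple K ?s (y, x, z) = (A, B, C)"
    using layer_braid by (simp_all add: emit_triple_def emit_pair_def A_def B_def C_def layer_braid_def del: after.simps emit.simps)
  have "swapped (act A h) (B, C) (C, B)" using 3 layer_braid by (auto simp: swapped_def B_def C_def layer_braid_def simp del: after.simps emit.simps)
  moreover have "\<not> below A B" using 2 layer_braid by (auto simp: A_def B_def C_def layer_braid_def simp del: after.simps emit.simps)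
  moreover have "below A C" using 1 by (simp add: A_def C_def)
  ultimately have "related h (A, C, B) (A, B, C)" unfolding related_def by force
  then show ?thesis using layer_braid o by (auto simp: after_triple_def after_pair_def layer_braid_def simp del: after.simps emit.simps)
qed

lemma pair_related:
  assumes c: "nested K f g h" and g: "good_triple K f (fst p, snd p, z)" "good_triple K f (fst q, snd q, z)" and b: "below (snd q) z" "\<not> below (snd p) z"
   and st: "after_pair K (f,g,h) p = after_pair K (f,g,h) q" and swapped: "swapped h (emit_pair K (f,g,h) p) (emit_pair K (f,g,h) q)"
  shows "related_after K f g h (fst p, snd p, z) (fst q, snd q, z)"
proof -
  let ?s = "(f,g,h)"
  have *: "below (snd (emit_pair K ?s r)) (emit K (after_pair K ?s r) z) \<longleftrightarrow> below (snd r) z" if g: "good_triple K f (fst r, snd r, z)" for r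
  proof -
    have gs: "good K (fst r) f" "good K (snd r) (act (fst r) f)" "good K z (act (snd r) (act (fst r) f))"
      using g by (auto simp: good_triple_def good_pair_def)
    obtain f1 g1 h1 where s1: "after K ?s (fst r) = (f1,g1,h1)" by (cases "after K ?s (fst r)")
    have n1: "f1 = act (fst r) f" using s1 by auto
    have c1: "nested K f1 g1 h1" using layer_valid(1)[OF c gs(1)] s1 by auto
    show ?thesis unfolding emit_pair_def after_pair_def s1 snd_conv using layer_bump[OF c1, of "snd r" z] gs(2,3) n1 by simp
  qed
  have o: "emit_triple K ?s (fst r, snd r, z) = (fst (emit_pair K ?s r), snd (emit_pair K ?s r), emit K (after_pair K ?s r) z)"
     "after_triple K ?s (fst r, snd r, z) = after K (after_pair K ?s r) z" for r
    by (simp_all add: emit_triple_def emit_pair_def after_pair_def after_triple_def)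
  have "related h (emit_triple K ?s (fst p, snd p, z)) (emit_triple K ?s (fst q, snd q, z))"
    unfolding o related_def using swapped st *[OF g(1)] *[OF g(2)] b by force
  then show ?thesis using o st by auto
qed

definition act_triple where "act_triple s f = act (snd (snd s)) (act (fst (snd s)) (act (fst s) f))"

lemma no_hold_triple:
  assumes "\<not> holds K (f,g,h) x" "\<not> holds K (after K (f,g,h) x) y" "\<not> holds K (after K (after K (f,g,h) x) y) z"
    and t: "push_triple (2*K+2) f g x y z = (x', y', z')"
  shows "emit_triple K (f,g,h) (x,y,z) = push_triple (2*K+3) g h x' y' z'"
    "after_triple K (f,g,h) (x,y,z) = (act_triple (x,y,z) f, act_triple (x',y',z') g, act_triple (push_triple (2*K+3) g h x' y' z') h)"
proof -
  have x: "plain_step K f g h x \<noteq> Hold" using assms(1) by simp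
  have st: "after K (f,g,h) x = (act x f, act x' g, act (push (2*K+3) g h x') h)"
    using plain_step_no_hold[OF x] t by (simp add: push_triple_def)
  have nh: "no_hold K (act x f) (act x' g) (act (push (2*K+3) g h x') h) (y, z)"
    using assms(2,3) unfolding st by (simp add: no_hold_def)
  have p: "push_pair (2*K+2) (act x f) (act x' g) (y, z) = (y', z')" using t by (auto simp: push_triple_def)
  have x': "x' = push (2*K+2) f g x" using t by (auto simp: push_triple_def)
  show "emit_triple K (f,g,h) (x,y,z) = push_triple (2*K+3) g h x' y' z'"
    unfolding emit_triple_def fst_conv snd_conv st no_hold_pair(1)[OF nh] p using plain_step_no_hold(2)[OF x] x'
    by (simp add: push_triple_def)
  show "after_triple K (f,g,h) (x,y,z) = (act_triple (x,y,z) f, act_triple (x',y',z') g, act_triple (push_triple (2*K+3) g h x' y' z') h)"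
    unfolding after_triple_def fst_conv snd_conv st no_hold_pair(2)[OF nh] p
    by (simp add: push_triple_def act_triple_def act_pair_def)
qed

lemma act_triple_swap: "act_triple (x, y, z) = act_triple (y, x, z)" "act_triple (x, y, z) = act_triple (x, z, y)"
  by (auto simp: act_triple_def act_commute fun_eq_iff)

text \<open>Without exceptions the layer is two pushes. If the first collides, it turns the relation
  into the kind with a common first step, which the second push preserves; otherwise the second push
  does the turning.\<close>

lemma layer_related2_no_hold:
  assumes c: "nested K f g h" and g: "good_triple K f (x, y, z)" "good_triple K f (y, x, z)" and b: "below x y" "below x z" "\<not> below y z"
    and nh: "\<not> holds K (f,g,h) x" "\<not> holds K (after K (f,g,h) x) y" "\<not> holds K (after K (after K (f,g,h) x) y) z"
      "\<not> holds K (f,g,h) y" "\<not> holds K (after K (f,g,h) y) x" "\<not> holds K (after K (after K (f,g,h) y) x) z"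
    and nn: "\<not> (smooth (2*K+2) f g x y \<and> smooth (2*K+3) g h (push (2*K+2) f g x) (push (2*K+2) f g y))"
  shows "related_after K f g h (x, y, z) (y, x, z)"
proof -
  have int: "interlaced f g" "interlaced g h" using c by (auto simp: nested_def)
  have gs: "good K x f" "good K y (act x f)" "good K y f" "good K x (act y f)" "good K z (act x (act y f))"
    using g by (auto simp: good_triple_def good_pair_def)
  have nb: "\<not> below y x" using b(1) by (cases x; cases y) auto
  have oks: "legal x f" "legal y (act x f)" "legal y f" "legal x (act y f)" "legal z (act x (act y f))" using gs by (auto simp: good_def)
  have hs: "x \<noteq> Hold" "y \<noteq> Hold" "z \<noteq> Hold" using gs by (auto simp: good_def)
  have news: "fresh (2*K+2) x" "fresh (2*K+2) y" "fresh (2*K+2) z" using gs by (auto simp: good_def)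
  have legal2: "legal2 f x y" using oks by (simp add: legal2_def)
  let ?c = "2*K+2" and ?d = "2*K+3"
  define x1 where "x1 = push ?c f g x"
  define y1 where "y1 = push ?c f g y"
  have okx1: "legal x1 g" "legal y1 g" using push_valid(1)[OF int(1) oks(1)] push_valid(1)[OF int(1) oks(3)] by (auto simp: x1_def y1_def)
  have ix: "interlaced (act x f) (act x1 g)" "interlaced (act y f) (act y1 g)"
    using push_valid(2)[OF int(1) oks(1)] push_valid(2)[OF int(1) oks(3)] by (auto simp: x1_def y1_def)
  have hs1: "x1 \<noteq> Hold" "y1 \<noteq> Hold" using hs push_not_Hold by (auto simp: x1_def y1_def)
  have newx1: "fresh ?d x1" "fresh ?d y1"
    using push_fresh[OF news(1)] push_fresh[OF news(2)] by (auto simp: x1_def y1_def numeral_3_eq_3)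
  define x2 where "x2 = push ?c (act y f) (act y1 g) x"
  define y2 where "y2 = push ?c (act x f) (act x1 g) y"
  have okx2: "legal x2 (act y1 g)" "legal y2 (act x1 g)" using push_valid(1)[OF ix(2) oks(4)] push_valid(1)[OF ix(1) oks(2)] by (auto simp: x2_def y2_def)
  have hs2: "x2 \<noteq> Hold" "y2 \<noteq> Hold" using hs push_not_Hold by (auto simp: x2_def y2_def)
  have newx2: "fresh ?d x2" "fresh ?d y2"
    using push_fresh[OF news(1)] push_fresh[OF news(2)] by (auto simp: x2_def y2_def numeral_3_eq_3)
  have bx1: "below x1 y2" "\<not> below y1 x2"
    using push_bump[OF int(1) oks(1,2) hs(1,2) news(1,2)] push_bump[OF int(1) oks(3,4) hs(2,1) news(2,1)] b nb by (auto simp: x1_def y1_def x2_def y2_def)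
  have ixx: "interlaced (act x (act y f)) (act x2 (act y1 g))" "interlaced (act y (act x f)) (act y2 (act x1 g))"
     using push_valid(2)[OF ix(2) oks(4)] push_valid(2)[OF ix(1) oks(2)] by (auto simp: x2_def y2_def)
  define zx where "zx = push ?c (act x (act y f)) (act x2 (act y1 g)) z"
  define zy where "zy = push ?c (act y (act x f)) (act y2 (act x1 g)) z"
  have okz: "legal zx (act x2 (act y1 g))" "legal zy (act y2 (act x1 g))"
    using push_valid(1)[OF ixx(1) oks(5)] push_valid(1)[OF ixx(2)] oks(5) by (auto simp: zx_def zy_def act_commute[of y x])
  have newz: "fresh ?d zx" "fresh ?d zy"
    using push_fresh[OF news(3)] by (auto simp: zx_def zy_def numeral_3_eq_3)
  have bz: "below x2 zx" "\<not> below y2 zy"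
    using push_bump[OF ix(2) oks(4,5) hs(1,3) news(1,3)] push_bump[OF ix(1) oks(2) _ hs(2,3) news(2,3)] oks(5) b
    by (auto simp: x2_def y2_def zx_def zy_def act_commute[of y x])
  have tx: "push_triple ?c f g x y z = (x1, y2, zy)" and ty: "push_triple ?c f g y x z = (y1, x2, zx)"
    by (simp_all add: push_triple_def push_pair_def x1_def y1_def x2_def y2_def zx_def zy_def)
  note nx = no_hold_triple[OF nh(1,2,3) tx] and ny = no_hold_triple[OF nh(4,5,6) ty]
  show ?thesis
  proof (cases "smooth ?c f g x y")
    case False
    from push_triple_swap[OF int(1) legal2 oks(5) b(2,3) False news ty]
    have e: "x1 = y1" "y2 = zx" "zy = x2" unfolding tx by auto
    define g1 where "g1 = act y1 g"
    define h1 where "h1 = act (push ?d g h y1) h"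
    have i1: "interlaced g1 h1" using push_valid(2)[OF int(2) okx1(2)] by (simp add: g1_def h1_def)
    have sw: "swapped g1 (x2, zx) (zx, x2)" using bz by (auto simp: swapped_def)
    have ni: "smooth ?d g1 h1 x2 zx" unfolding g1_def h1_def
      by (rule push_smooth[OF int(2) okx1(2) bx1(2) _ newx1(2)]) (use bx1(1) e in simp)
    have okp: "legal_pair g1 (x2, zx)" "legal_pair g1 (zx, x2)" using okx2 okz e by (auto simp: legal_pair_def g1_def)
    have sw2: "swapped h1 (push_pair ?d g1 h1 (x2, zx)) (push_pair ?d g1 h1 (zx, x2))"
      by (rule push_swapped[OF i1 sw okp]) (use newx2 newz ni in auto)
    have o: "push_triple ?d g h x1 y2 zy = (push ?d g h y1, push_pair ?d g1 h1 (zx, x2))" "push_triple ?d g h y1 x2 zx = (push ?d g h y1, push_pair ?d g1 h1 (x2, zx))"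
      unfolding e push_triple_def g1_def h1_def by auto
    have bb: "\<not> below (push ?d g h y1) (fst (push_pair ?d g1 h1 (x2, zx)))" "below (push ?d g h y1) (fst (push_pair ?d g1 h1 (zx, x2)))"
      using push_bump[OF int(2) okx1(2) okx2(1) hs1(2) hs2(1) newx1(2) newx2(1)] bx1(2)
        push_bump[OF int(2) okx1(1) okx2(2) hs1(1) hs2(2) newx1(1) newx2(2)] bx1(1)
      unfolding e by (auto simp: push_pair_def g1_def h1_def)
    have r: "related h (emit_triple K (f,g,h) (x, y, z)) (emit_triple K (f,g,h) (y, x, z))"
      unfolding nx(1) ny(1) o by (rule relatedI1[OF _ bb]) (use sw2 in \<open>simp add: h1_def\<close>)
    have "act_triple (x1, y2, zy) g = act_triple (y1, x2, zx) g" unfolding e by (simp add: act_triple_swap(2))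
    moreover have "act_triple (push_triple ?d g h x1 y2 zy) h = act_triple (push_triple ?d g h y1 x2 zx) h"
      unfolding o using swapped_act[OF sw2] by (simp add: act_triple_def act_pair_def h1_def)
    ultimately have "after_triple K (f,g,h) (x, y, z) = after_triple K (f,g,h) (y, x, z)" unfolding nx(2) ny(2) by (simp add: act_triple_swap(1)[of x])
    then show ?thesis using r by blast
  next
    case True
    then have n2: "\<not> smooth ?d g h x1 y1" using nn by (simp add: x1_def y1_def)
    have sw0: "swapped f (x, y) (y, x)" using b by (auto simp: swapped_def)
    have okp: "legal_pair f (x, y)" "legal_pair f (y, x)" using oks by (auto simp: legal_pair_def)
    have "swapped g (push_pair ?c f g (x, y)) (push_pair ?c f g (y, x))"
      by (rule push_swapped[OF int(1) sw0 okp]) (use news True in auto)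
    then have "swapped g (x1, y2) (y1, x2)" by (simp add: push_pair_def x1_def y1_def x2_def y2_def)
    \<comment> \<open>An exchange pair is always smooth, so the pair has crossed the first push by
      commuting.\<close>
    then have e: "y2 = y1" "x2 = x1" using n2 unfolding swapped_def smooth_def by auto
    have zz: "zx = zy" unfolding zx_def zy_def e by (simp add: act_commute)
    have ok21: "legal2 g x1 y1" using okx1 okx2 e by (auto simp: legal2_def)
    have bz': "below x1 zx" "\<not> below y1 zx" using bz e zz by auto
    have okz': "legal zx (act x1 (act y1 g))" using okz e by auto
    obtain A B C where o1: "push_triple ?d g h y1 x1 zx = (A, B, C)" by (metis prod_cases3)
    have o2: "push_triple ?d g h x1 y1 zx = (A, C, B)"
      by (rule push_triple_swap[OF int(2) ok21 okz' bz' n2 newx1 newz(1) o1])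
    have bb: "below A C" "\<not> below A B" "below B C"
    proof -
      show "below A C" using push_bump[OF int(2) okx1(1) okx2(2) hs1(1) hs2(2) newx1(1) newx2(2)] bx1(1) o2 e
        by (auto simp: push_triple_def push_pair_def)
      show "\<not> below A B" using push_bump[OF int(2) okx1(2) okx2(1) hs1(2) hs2(1) newx1(2) newx2(1)] bx1(2) o1 e
        by (auto simp: push_triple_def push_pair_def)
      have i1: "interlaced (act y1 g) (act A h)" using push_valid(2)[OF int(2) okx1(2)] o1 by (auto simp: push_triple_def)
      have hz: "zx \<noteq> Hold" using hs push_not_Hold by (auto simp: zx_def)
      show "below B C" using push_bump[OF i1 okx2(1) _ hs2(1) hz newx2(1) newz(1)] okz(1) bz(1) o1 e
        by (auto simp: push_triple_def push_pair_def)
    qed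
    have o: "emit_triple K (f,g,h) (x, y, z) = (A, C, B)" "emit_triple K (f,g,h) (y, x, z) = (A, B, C)"
      unfolding nx(1) ny(1) using o1 o2 e zz by auto
    have r: "related h (emit_triple K (f,g,h) (x, y, z)) (emit_triple K (f,g,h) (y, x, z))"
      unfolding o by (rule relatedI1) (use bb in \<open>auto simp: swapped_def\<close>)
    have "act_triple (x1, y2, zy) g = act_triple (y1, x2, zx) g" unfolding e zz by (simp add: act_triple_swap(1)[of x1])
    moreover have "act_triple (push_triple ?d g h x1 y2 zy) h = act_triple (push_triple ?d g h y1 x2 zx) h"
      unfolding e zz[symmetric] o1 o2 by (simp add: act_triple_swap(2)[of A])
    ultimately have "after_triple K (f,g,h) (x, y, z) = after_triple K (f,g,h) (y, x, z)" unfolding nx(2) ny(2) by (simp add: act_triple_swap(1)[of x])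
    then show ?thesis using r by blast
  qed
qed

text \<open>A tame pair crosses on its own. For the others, \<open>z\<close> lies strictly after
  \<open>x\<close> and weakly before \<open>y\<close>; if an exception is possible, \<open>x\<close>
  or \<open>y\<close> is \<open>Up m\<close> or the layer is the innermost one, and only the
  configurations of the braid lemmas remain.\<close>

lemma layer_related2:
  assumes c: "nested K f g h" and g: "good_triple K f (fst p, snd p, z)" "good_triple K f (fst q, snd q, z)"
    and swapped: "swapped f p q" and bl: "below (snd q) z" "\<not> below (snd p) z"
  shows "related_after K f g h (fst p, snd p, z) (fst q, snd q, z)"
proof (cases "tame K f g h (fst p) (fst q)")
  case True
  have gp: "good_pair K p f" "good_pair K q f" using g by (auto simp: good_triple_def good_pair_def)
  show ?thesis using pair_related[OF c g bl] layer_pair[OF c swapped gp True] by blast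
next
  case False
  note b = nestedD[OF c]
  let ?s = "(f,g,h)"
  consider (a) x y where "p = (x, y)" "q = (y, x)" "below x y" |
     (b) i j where "i < j" "p = (Up i, Down i)" "q = (Down j, Up j)"
    using swapped by (auto simp: swapped_def)
  then show ?thesis
  proof cases
    case b
    have "j < K" using g(2) b Down_less[OF c, of j] by (auto simp: good_triple_def)
    then have "tame K f g h (fst p) (fst q)" using b by (auto simp: tame_def smooth_def split: if_splits)
    then show ?thesis using False by blast
  next
    case a
    have zz: "below x z" "\<not> below y z" using bl a by auto
    have g': "good_triple K f (x, y, z)" "good_triple K f (y, x, z)" using g a by auto
    have gs: "good K x f" "good K y (act x f)" "good K y f" "good K x (act y f)" "good K z (act x (act y f))" "good K z (act y (act x f))"
      using g' by (auto simp: good_triple_def good_pair_def)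
    have legal2: "legal2 f x y" using gs by (auto simp: legal2_def good_def)
    have gp: "good_pair K (x,y) f" "good_pair K (y,x) f" using gs by (auto simp: good_pair_def)
    have nccm: ?thesis if "layer_commute K ?s x y"
      using pair_related[OF c g bl] commute_pair[OF c gp a(3) that] a by auto
    have ncyc: ?thesis if "layer_braid K ?s x y z"
      using braid_related[OF c g' a(3) zz(1) that] a by auto
    have ncnd: "\<not> tame K f g h x y" using False a by auto
    show ?thesis
    proof (cases "\<not> holds K ?s x \<and> \<not> holds K (after K ?s x) y \<and> \<not> holds K (after K (after K ?s x) y) z \<and>
      \<not> holds K ?s y \<and> \<not> holds K (after K ?s y) x \<and> \<not> holds K (after K (after K ?s y) x) z")
      case True
      have "no_hold K f g h (x,y)" "no_hold K f g h (y,x)" using True by (auto simp: no_hold_def)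
      then have "\<not> (smooth (2*K+2) f g x y \<and> smooth (2*K+3) g h (push (2*K+2) f g x) (push (2*K+2) f g y))"
        using ncnd by (auto simp: tame_def)
      then show ?thesis using layer_related2_no_hold[OF c g' a(3) zz] True a by simp
    next
      case hold: False
      have h: "(K = 0 \<and> (x = New 2 \<or> y = New 2 \<or> z = New 2)) \<or> (\<exists>m. K = Suc m \<and> (x = Up m \<or> y = Up m \<or> z = Up m))"
        using hold holds_step[of K _ x f] holds_step[of K _ y f] holds_step[of K _ z "act x (act y f)"] gs by metis
      show ?thesis
      proof (cases K)
        case 0
        have "\<exists>d. x = New d \<and> 2 \<le> d" using gs(1) 0 Down_less[OF c] by (cases x) (auto simp: good_def)
        moreover have "\<exists>d. y = New d \<and> 2 \<le> d" using gs(3) 0 Down_less[OF c] by (cases y) (auto simp: good_def)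
        moreover have "\<exists>d. z = New d \<and> 2 \<le> d" using gs(5) 0 Down_less[OF layer_valid(1)[OF layer_valid(1)[OF c gs(3)]], of x] gs(4)
          Down_less[OF layer_valid(1)[OF layer_valid(1)[OF c gs(3)] gs(4)]] by (cases z) (auto simp: good_def)
        ultimately obtain d e e1 where "x = New d" "y = New e" "z = New e1" "2 \<le> d" "2 \<le> e" "2 \<le> e1" by auto
        then show ?thesis using braid_New_New[of f g h d e e1] c 0 a(3) zz ncyc nccm by auto
      next
        case (Suc m)
        have c': "nested (Suc m) f g h" using c Suc by simp
        have yD: "x = Up m \<or> (\<exists>i. x = Down i)" if "y = Down j" for j
          using ncnd that a(3) Suc by (cases x) (auto simp: tame_def smooth_def split: if_splits)
        have xyz: "x = Up m \<or> y = Up m" using h Suc zz a(3) gs(3) yD by (cases y) (auto simp: good_def)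
        show ?thesis
        proof (cases "x = Up m")
          case True
          then obtain j where j: "y = Down j" using a(3) gs(3) Suc by (cases y) (auto simp: good_def)
          have jm: "j \<le> m" using Down_less[OF c, of j] gs(3) j Suc by (simp add: less_Suc_eq_le)
          have nc: "\<not> ((j = m \<longrightarrow> g (Suc m) < f m \<and> h (Suc m) < g m) \<and> (m = Suc j \<longrightarrow> g m = f j \<longrightarrow> h (Suc m) < g m))"
            and nnh: "\<not> (no_hold K f g h (x,y) \<and> no_hold K f g h (y,x))"
            using ncnd True j Suc by (auto simp: tame_def smooth_def split: if_splits)
          obtain i where i: "z = Down i" "j \<le> i" using zz True j gs(5) Suc by (cases z) (auto simp: good_def)
          have im: "i \<le> m"
            using gs(5) i Suc Down_less[OF layer_valid(1)[OF layer_valid(1)[OF c gs(3)] gs(4)], of i] by (auto simp: less_Suc_eq_le)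
          have ok2': "legal2 f (Up m) (Down j)" using legal2 True j by simp
          have hh: "g (Suc m) < h (Suc m) \<and> (f m < g m \<or> j = m \<and> g (Suc m) = f m)"
          proof -
            have yh: "plain_step K f' g' h' y \<noteq> Hold" for f' g' h' using j by (simp add: plain_step_def)
            have "plain_step K f g h x = Hold \<or> plain_after K f g h y x = Hold"
              using nnh yh unfolding no_hold_def by auto
            then show ?thesis using hold_Up_after_Down[OF c' ok2' jm] unfolding True Suc j by blast
          qed
          have "layer_braid K ?s x y z"
          proof (cases "j = m")
            case jm': True
            have "i = m" using i im jm' by simp
            then have zo: "legal (Down m) (act (Up m) (act (Down m) f))" using gs(5) True j jm' i by (auto simp: good_def simp del: legal.simps act.simps)
            show ?thesis using braid_Up_Down[OF c' _ zo] nc hh ok2' unfolding Suc True j i(1) \<open>i = m\<close> jm' by auto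
          next
            case False
            then have mm: "m = Suc j" "g m = f j" "h (Suc m) = g m" "f m < g m" using nc hh b(3)[of m] by auto
            have zo: "legal z (act (Up m) (act (Down j) f))" using gs(5) True j by (auto simp: good_def simp del: legal.simps act.simps)
            have "i = m \<or> i = j" using i im mm(1) by auto
            then have "z = Down m \<or> z = Down j" using i by auto
            then show ?thesis using braid_Up_Down2[OF c' mm(1) ok2' zo _ mm(4,2,3)] hh unfolding Suc True j by blast
          qed
          then show ?thesis by (rule ncyc)
        next
          case False
          then have y: "y = Up m" using xyz by simp
          then have x: "(\<exists>r. x = Up r \<and> r < m) \<or> (\<exists>d. x = New d \<and> 2*K+2 \<le> d)" using a(3) gs(1) by (cases x) (auto simp: good_def)
          have nn: "\<not> (smooth (2*K+2) f g x y \<and> smooth (2*K+3) g h (push (2*K+2) f g x) (push (2*K+2) f g y))"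
            using ncnd y x by (auto simp: tame_def)
          show ?thesis using x
          proof (elim disjE exE conjE)
            fix r assume r: "x = Up r" "r < m"
            obtain t where t: "z = Up t" "r < t" "t \<le> m" using zz y r by (cases z) auto
            have "m = Suc r \<or> m = Suc (Suc r) \<and> f r < g r \<and> f m = g m \<and> g (Suc r) < h (Suc r) \<and> g m = h m"
              using nn b[of "Suc r"] b[of m] r unfolding smooth_def y r(1) by (auto split: if_splits)
            then have "layer_braid K ?s x y z \<or> layer_commute K ?s x y"
            proof
              assume m: "m = Suc r"
              then have t': "t = Suc r" using t by simp
              have c2: "nested (Suc (Suc r)) f g h" using c' m by simp
              have "f r < g r \<and> f (Suc r) = g (Suc r) \<or> (f r < g r \<and> f (Suc r) < g (Suc r) \<and> g (Suc r) < h (Suc r) \<and> g (Suc (Suc r)) = h (Suc (Suc r))) \<or>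
                 (f r = g r \<and> f (Suc r) = g (Suc r) \<and> g r < h r \<and> g (Suc r) = h (Suc r))"
                using nn b[of r] b[of "Suc r"] b[of "Suc (Suc r)"] unfolding smooth_def y r(1) m by (auto split: if_splits)
              then show ?thesis using braid_Up_Up[OF c2] unfolding Suc m y r(1) t(1) t' by auto
            next
              assume m: "m = Suc (Suc r) \<and> f r < g r \<and> f m = g m \<and> g (Suc r) < h (Suc r) \<and> g m = h m"
              then have "t = Suc r \<or> t = Suc (Suc r)" using t by auto
              then show ?thesis using braid_Up_Up2[of r f g h z] c' m t unfolding Suc y r(1) by auto
            qed
            then show ?thesis using ncyc nccm by blast
          next
            fix d assume d: "x = New d" "2*K+2 \<le> d"
            have zc: "(\<exists>t. z = Up t \<and> t \<le> m) \<or> (\<exists>e. z = New e \<and> e < d \<and> 2*K+2 \<le> e)" using zz y d gs(5) by (cases z) (auto simp: good_def)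
            have "m = 0 \<or> (m = Suc 0 \<and> d = 2*K+2 \<and> f (Suc 0) = g (Suc 0) \<and> g 0 < h 0 \<and> g (Suc 0) = h (Suc 0))"
              using nn b[of 0] b[of "Suc 0"] unfolding smooth_def y d(1) by (auto split: if_splits)
            then have "layer_braid K ?s x y z \<or> layer_commute K ?s x y"
            proof
              assume m: "m = 0"
              have c1: "nested (Suc 0) f g h" using c' m by simp
              have d4: "4 \<le> d" using d Suc m by simp
              from zc show ?thesis
              proof
                assume "\<exists>t. z = Up t \<and> t \<le> m"
                then have "z = Up 0" using m by auto
                then show ?thesis using braid_New_Up[OF c1 d4] legal2 unfolding Suc m y d(1) by auto
              next
                assume "\<exists>e. z = New e \<and> e < d \<and> 2*K+2 \<le> e"
                then obtain e where e: "z = New e" "e < d" "4 \<le> e" using Suc m by auto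
                show ?thesis
                proof (cases "d = 5")
                  case True
                  then have "z = New 4" using e by auto
                  then show ?thesis using braid_New_Up[OF c1 d4] legal2 True unfolding Suc m y d(1) by auto
                next
                  case False
                  then show ?thesis using nn b[of 0] d4 e Suc m unfolding smooth_def y d(1) by auto
                qed
              qed
            next
              assume m: "m = Suc 0 \<and> d = 2*K+2 \<and> f (Suc 0) = g (Suc 0) \<and> g 0 < h 0 \<and> g (Suc 0) = h (Suc 0)"
              then have d6: "d = 6" using Suc by simp
              then have "z = Up 0 \<or> z = Up (Suc 0)" using zc m Suc by auto
              then show ?thesis using braid_New_Up2[of f g h z] c' m d6 unfolding Suc y d(1) by auto
            qed
            then show ?thesis using ncyc nccm by blast
          qed
        qed
      qed
    qed
  qed
qed

lemma layer_related:
  assumes c: "nested K f g h" and g: "good_triple K f s" "good_triple K f t" and related: "related f s t"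
  shows "after_triple K (f,g,h) s = after_triple K (f,g,h) t \<and> related h (emit_triple K (f,g,h) s) (emit_triple K (f,g,h) t)"
  using related unfolding related_def[of f]
  apply (elim disjE exE conjE)
  subgoal using layer_related1[OF c] g by auto
  subgoal using layer_related2[OF c] g by auto
  done

section \<open>Berele insertion as a path of steps\<close>

definition count_le :: "nat \<Rightarrow> letter list \<Rightarrow> nat" where
  "count_le c xs = length (filter (\<lambda>x. letter_code x \<le> c) xs)"

text \<open>Integers make the removal of a box an honest subtraction, and rows beyond the last count
  as empty, so that steps need no side conditions on the number of rows.\<close>

definition shape :: "tableau \<Rightarrow> nat \<Rightarrow> nat \<Rightarrow> int" where
  "shape T c r = (if r < length T then int (count_le c (T ! r)) else 0)"

definition rows_ok :: "tableau \<Rightarrow> bool" where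
  "rows_ok T \<longleftrightarrow> (\<forall>R\<in>set T. sorted R \<and> R \<noteq> [])"

text \<open>Together with the condition at code \<open>0\<close>, columns increase strictly iff consecutive shapes interlace.\<close>

definition cols_ok :: "nat \<Rightarrow> tableau \<Rightarrow> bool" where
  "cols_ok i T \<longleftrightarrow> (\<forall>c r. i \<le> r \<longrightarrow> shape T 0 (Suc r) = 0 \<and> shape T (Suc c) (Suc r) \<le> shape T c r)"

lemma count_le_mono: "c \<le> d \<Longrightarrow> count_le c xs \<le> count_le d xs"
  unfolding count_le_def by (induction xs) auto

lemma shape_mono: "c \<le> d \<Longrightarrow> shape T c r \<le> shape T d r"
  unfolding shape_def using count_le_mono by auto

lemma count_le_length: "count_le c xs \<le> length xs" unfolding count_le_def by simp

lemma nth_code_le: "sorted xs \<Longrightarrow> j < length xs \<Longrightarrow> letter_code (xs ! j) \<le> c \<longleftrightarrow> j < count_le c xs"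
proof (induction xs arbitrary: j)
  case (Cons x xs)
  show ?case
  proof (cases "letter_code x \<le> c")
    case True
    then show ?thesis using Cons.IH[of "j - 1"] Cons.prems by (cases j) (simp_all add: count_le_def)
  next
    case False
    then have "\<forall>y\<in>set xs. \<not> letter_code y \<le> c" using Cons.prems(1) by (auto simp: less_eq_letter_def)
    then have "filter (\<lambda>x. letter_code x \<le> c) (x # xs) = []" using False by (auto simp: filter_empty_conv)
    moreover have "\<not> letter_code ((x # xs) ! j) \<le> c"
      using False \<open>\<forall>y\<in>set xs. \<not> letter_code y \<le> c\<close> nth_mem[OF Cons.prems(2)] by auto
    ultimately show ?thesis by (simp add: count_le_def)
  qed
qed simp

lemma shape_nth: "rows_ok T \<Longrightarrow> i < length T \<Longrightarrow> j < length (T ! i) \<Longrightarrow> letter_code (T ! i ! j) \<le> c \<longleftrightarrow> int j < shape T c i"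
  unfolding rows_ok_def shape_def using nth_code_le by auto

lemma count_le_simps: "count_le c [] = 0" "count_le c (x # xs) = (if letter_code x \<le> c then Suc (count_le c xs) else count_le c xs)"
  "count_le c (xs @ ys) = count_le c xs + count_le c ys"
  by (simp_all add: count_le_def)

lemma count_le_update:
  assumes "j < length xs"
  shows "int (count_le c (xs[j := a])) = int (count_le c xs) + (if letter_code a \<le> c then 1 else 0) - (if letter_code (xs ! j) \<le> c then 1 else 0)"
  using arg_cong[OF id_take_nth_drop[OF assms], of "count_le c"] arg_cong[OF upd_conv_take_nth_drop[OF assms, of a], of "count_le c"]
  unfolding count_le_simps by simp

lemma shape_set_entry:
  assumes "i < length T" "j < length (T ! i)"
  shows "shape (set_entry T i j a) c r = shape T c r + (if r = i then (if letter_code a \<le> c then 1 else 0) - (if letter_code (T ! i ! j) \<le> c then 1 else 0) else 0)"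
  using assms count_le_update[OF assms(2)] by (auto simp: shape_def set_entry_def)

lemma sorted_list_update:
  fixes xs :: "letter list"
  assumes "sorted xs" "j < length xs" "\<And>k. k < j \<Longrightarrow> xs ! k \<le> y" "Suc j < length xs \<Longrightarrow> y \<le> xs ! Suc j"
  shows "sorted (xs[j := y])"
  unfolding sorted_iff_nth_mono_less
proof (intro allI impI)
  fix k l assume kl: "k < l" "l < length (xs[j := y])"
  have "y \<le> xs ! l" if "j < l"
  proof -
    have "Suc j \<le> l" "l < length xs" using that kl by auto
    then have "y \<le> xs ! Suc j" "xs ! Suc j \<le> xs ! l" using assms(4) sorted_nth_mono[OF assms(1), of "Suc j" l] by auto
    then show ?thesis by (rule order_trans)
  qed
  then show "xs[j := y] ! k \<le> xs[j := y] ! l"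
    using kl assms(2,3) sorted_nth_mono[OF assms(1), of k l] by (auto simp: nth_list_update)
qed

lemma rows_ok_update: "rows_ok T \<Longrightarrow> sorted R \<Longrightarrow> R \<noteq> [] \<Longrightarrow> rows_ok (T[i := R])"
  using set_update_subset_insert[of T i R] unfolding rows_ok_def by blast

lemma rows_ok_set_entry:
  assumes "rows_ok T" "i < length T" "j < length (T ! i)" "\<And>k. k < j \<Longrightarrow> T ! i ! k \<le> y" "Suc j < length (T ! i) \<Longrightarrow> y \<le> T ! i ! Suc j"
  shows "rows_ok (set_entry T i j y)"
  unfolding set_entry_def
proof (rule rows_ok_update[OF assms(1)])
  show "sorted ((T ! i)[j := y])" by (rule sorted_list_update) (use assms in \<open>auto simp: rows_ok_def\<close>)
  show "(T ! i)[j := y] \<noteq> []" using assms(3) by auto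
qed

lemma less_code: "x < y \<longleftrightarrow> letter_code x < letter_code y" by (simp add: less_letter_def)
lemma le_code: "x \<le> y \<longleftrightarrow> letter_code x \<le> letter_code y" by (simp add: less_eq_letter_def)

lemma row_sorted_nth: "rows_ok T \<Longrightarrow> i < length T \<Longrightarrow> k \<le> l \<Longrightarrow> l < length (T ! i) \<Longrightarrow> T ! i ! k \<le> T ! i ! l"
  by (simp add: rows_ok_def sorted_nth_mono)

lemma below_strict:
  assumes "rows_ok T" "cols_ok i T" "Suc i < length T" "j < length (T ! Suc i)"
  shows "j < length (T ! i)" "T ! i ! j < T ! Suc i ! j"
proof -
  let ?b = "letter_code (T ! Suc i ! j)"
  have "int j < shape T ?b (Suc i)" by (rule iffD1[OF shape_nth[OF assms(1,3,4)] order_refl])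
  also have "shape T ?b (Suc i) \<le> shape T (Suc ?b) (Suc i)" by (rule shape_mono) simp
  also have "\<dots> \<le> shape T ?b i" using assms(2) by (simp add: cols_ok_def)
  finally have 1: "int j < shape T ?b i" .
  then show jl: "j < length (T ! i)" using assms(3) count_le_length[of ?b "T ! i"] by (simp add: shape_def)
  show "T ! i ! j < T ! Suc i ! j"
  proof (cases ?b)
    case 0
    have "shape T ?b (Suc i) = 0" using 0 assms(2) by (simp add: cols_ok_def)
    then show ?thesis using shape_nth[OF assms(1,3,4), of ?b] by simp
  next
    case (Suc c)
    have "int j < shape T (Suc c) (Suc i)" using shape_nth[OF assms(1,3,4), of "Suc c"] Suc by simp
    also have "\<dots> \<le> shape T c i" using assms(2) by (simp add: cols_ok_def)
    finally show ?thesis using shape_nth[OF assms(1) _ jl, of c] Suc assms(3) by (simp add: less_code)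
  qed
qed

lemma shape_le_col: "rows_ok T \<Longrightarrow> (\<And>x. entry T i j = Some x \<Longrightarrow> c < letter_code x) \<Longrightarrow> shape T c i \<le> int j"
proof (rule ccontr)
  assume r: "rows_ok T" and e: "\<And>x. entry T i j = Some x \<Longrightarrow> c < letter_code x" and n: "\<not> shape T c i \<le> int j"
  then have i: "i < length T" by (auto simp: shape_def split: if_splits)
  have j: "j < length (T ! i)" using n i count_le_length[of c "T ! i"] by (simp add: shape_def)
  have "c < letter_code (T ! i ! j)" using e[of "T ! i ! j"] i j by (simp add: entry_def)
  then show False using shape_nth[OF r i j, of c] n by simp
qed

lemma shape_gt_col: "rows_ok T \<Longrightarrow> entry T i j = Some x \<Longrightarrow> letter_code x \<le> c \<Longrightarrow> int j < shape T c i"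
  using shape_nth[of T i j c] by (auto simp: entry_def split: if_splits)

section \<open>Jeu de taquin as a path of steps\<close>

definition slide_path :: "tableau \<Rightarrow> tableau \<Rightarrow> nat \<Rightarrow> nat \<Rightarrow> (nat \<Rightarrow> step) \<Rightarrow> bool" where
  "slide_path T T' e i \<sigma> \<longleftrightarrow> \<sigma> e = Down i \<and> (\<forall>c\<ge>e. \<sigma> (Suc c) = push (Suc c) (shape T c) (shape T (Suc c)) (\<sigma> c)) \<and>
    (\<forall>c\<ge>e. shape T' c = act (\<sigma> c) (shape T c)) \<and> (\<forall>c<e. shape T' c = shape T c) \<and> (\<forall>c\<ge>e. \<exists>r\<ge>i. \<sigma> c = Down r)"

text \<open>Prepends one slide. The hole still stores a letter of code \<open>e\<close>, and the
  letter of code \<open>b\<close> moves in, so right now only the shapes at codes from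
  \<open>e\<close> to below \<open>b\<close> lose a box, all in row \<open>i\<close>.
  \<open>stay\<close> and \<open>turn\<close> say that the growth rule predicts the same
  rows.\<close>

lemma slide_path_extend:
  assumes p: "slide_path T1 T' b i1 \<sigma>1" and eb: "e \<le> b" "i \<le> i1" and ei: "e = b \<Longrightarrow> i1 = i"
    and M1: "\<And>c. shape T1 c = (if e \<le> c \<and> c < b then act (Down i) (shape T c) else shape T c)"
    and stay: "\<And>c. e \<le> c \<Longrightarrow> Suc c < b \<Longrightarrow> shape T (Suc c) (Suc i) \<noteq> shape T c i"
    and turn: "\<And>c. e \<le> c \<Longrightarrow> b = Suc c \<Longrightarrow> push b (shape T c) (shape T b) (Down i) = Down i1"
  shows "\<exists>\<sigma>. slide_path T T' e i \<sigma>"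
proof (intro exI)
  let ?s = "\<lambda>c. if c < b then Down i else \<sigma>1 c"
  have p1: "\<sigma>1 b = Down i1" "\<And>c. c \<ge> b \<Longrightarrow> \<sigma>1 (Suc c) = push (Suc c) (shape T1 c) (shape T1 (Suc c)) (\<sigma>1 c)"
    "\<And>c. c \<ge> b \<Longrightarrow> shape T' c = act (\<sigma>1 c) (shape T1 c)" "\<And>c. c < b \<Longrightarrow> shape T' c = shape T1 c" "\<And>c. c \<ge> b \<Longrightarrow> \<exists>r\<ge>i1. \<sigma>1 c = Down r"
    using p by (auto simp: slide_path_def)
  show "slide_path T T' e i ?s" unfolding slide_path_def
  proof (intro conjI allI impI)
    show "?s e = Down i" using eb ei p1(1) by auto
  next
    fix c assume c: "e \<le> c"
    show "?s (Suc c) = push (Suc c) (shape T c) (shape T (Suc c)) (?s c)"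
    proof (cases "b \<le> c")
      case True
      then show ?thesis using p1(2)[OF True] M1[of c] M1[of "Suc c"] by auto
    next
      case False
      show ?thesis
      proof (cases "b = Suc c")
        case True
        then show ?thesis using turn[OF c True] p1(1) by auto
      next
        case b: False
        then show ?thesis using stay[OF c] False by auto
      qed
    qed
  next
    fix c assume c: "e \<le> c"
    show "shape T' c = act (?s c) (shape T c)" using p1(3,4)[of c] M1[of c] c by auto
  next
    fix c assume c: "c < e"
    show "shape T' c = shape T c" using p1(4)[of c] M1[of c] c eb by auto
  next
    fix c assume c: "e \<le> c"
    show "\<exists>r\<ge>i. ?s c = Down r" using p1(5)[of c] eb by (cases "c < b") (auto intro: order_trans)
  qed
qed

text \<open>The branches collapse to three: the comparison of two neighbours becomes a condition on
  a neighbour that may be absent. The result of the remaining slides is kept abstract as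
  \<open>T'\<close>.\<close>

lemma jdt_induct [case_names corner down right]:
  assumes corner: "\<And>T i j. entry T (Suc i) j = None \<Longrightarrow> entry T i (Suc j) = None \<Longrightarrow> Q T i j (delete_corner T i j)"
    and down: "\<And>T i j b T'. entry T (Suc i) j = Some b \<Longrightarrow> (\<And>r. entry T i (Suc j) = Some r \<Longrightarrow> b \<le> r) \<Longrightarrow>
      Q (set_entry T i j b) (Suc i) j T' \<Longrightarrow> Q T i j T'"
    and right: "\<And>T i j r T'. entry T i (Suc j) = Some r \<Longrightarrow> (\<And>b. entry T (Suc i) j = Some b \<Longrightarrow> r < b) \<Longrightarrow>
      Q (set_entry T i j r) i (Suc j) T' \<Longrightarrow> Q T i j T'"
  shows "Q T i j (jeu_de_taquin T i j)"
proof (induction T i j rule: jeu_de_taquin.induct)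
  case (1 T i j)
  note IH = this
  show ?case
  proof (cases "entry T (Suc i) j")
    case None
    show ?thesis
    proof (cases "entry T i (Suc j)")
      case N: None
      then show ?thesis using None corner by (simp add: jeu_de_taquin.simps[of T i j])
    next
      case (Some r)
      then show ?thesis using None right[OF Some] IH by (simp add: jeu_de_taquin.simps[of T i j])
    qed
  next
    case b: (Some b)
    show ?thesis
    proof (cases "entry T i (Suc j)")
      case None
      then show ?thesis using b down[OF b] IH by (simp add: jeu_de_taquin.simps[of T i j])
    next
      case (Some r)
      then show ?thesis using b down[OF b] right[OF Some] IH by (simp add: jeu_de_taquin.simps[of T i j] not_le)
    qed
  qed
qed

lemma shape_delete_corner:
  assumes r: "rows_ok T" and i: "i < length T" and j: "j < length (T ! i)" and e: "entry T (Suc i) j = None" "entry T i (Suc j) = None"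
  shows "rows_ok (delete_corner T i j)" "shape (delete_corner T i j) c = (if letter_code (T ! i ! j) \<le> c then act (Down i) (shape T c) else shape T c)"
proof -
  have jl: "length (T ! i) = Suc j" using e(2) i j by (auto simp: entry_def split: if_splits)
  have row: "T ! i = take j (T ! i) @ [T ! i ! j]" using jl by (metis lessI take_Suc_conv_app_nth take_all_iff le_refl)
  have ti: "int (count_le c (take j (T ! i))) = int (count_le c (T ! i)) - (if letter_code (T ! i ! j) \<le> c then 1 else 0)"
    using arg_cong[OF row, of "count_le c"] unfolding count_le_simps by auto
  show "rows_ok (delete_corner T i j)"
  proof -
    have "sorted (take j (T ! i))" using r i by (simp add: rows_ok_def sorted_wrt_take)
    then show ?thesis using r set_update_subset_insert[of T i "take j (T ! i)"] unfolding rows_ok_def delete_corner_def by auto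
  qed
  show "shape (delete_corner T i j) c = (if letter_code (T ! i ! j) \<le> c then act (Down i) (shape T c) else shape T c)"
  proof (cases j)
    case 0
    have last: "Suc i = length T"
    proof (rule ccontr)
      assume "Suc i \<noteq> length T"
      then have "Suc i < length T" "T ! Suc i \<noteq> []" using i r by (auto simp: rows_ok_def)
      then show False using e(1) 0 by (auto simp: entry_def split: if_splits)
    qed
    then obtain T0 R where T: "T = T0 @ [R]" "i = length T0" by (metis append_butlast_last_id length_append_singleton length_greater_0_conv old.nat.inject zero_less_Suc)
    have "filter (\<lambda>row. row \<noteq> []) T0 = T0" using r unfolding T rows_ok_def by (simp add: filter_id_conv)
    then have "delete_corner T i j = T0" using 0 T by (simp add: delete_corner_def list_update_append)
    then show ?thesis using ti 0 T by (auto simp: shape_def nth_append fun_eq_iff count_le_simps less_Suc_eq)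
  next
    case (Suc k)
    have "filter (\<lambda>row. row \<noteq> []) (T[i := take j (T ! i)]) = T[i := take j (T ! i)]"
      using r set_update_subset_insert[of T i "take j (T ! i)"] j Suc unfolding rows_ok_def by (auto simp: filter_id_conv)
    then show ?thesis using ti i by (auto simp: delete_corner_def shape_def fun_eq_iff nth_list_update)
  qed
qed

text \<open>Column strictness is assumed only from row \<open>i\<close> on: after a slide upwards
  the same letter is stored in row \<open>i\<close> and in the hole below. The path starts at the
  code of the letter stored in the hole, since emptying the hole is invisible to smaller
  codes.\<close>

lemma jdt_path:
  assumes "rows_ok T" "cols_ok i T" "i < length T" "j < length (T ! i)"
  shows "rows_ok (jeu_de_taquin T i j) \<and> (\<exists>\<sigma>. slide_path T (jeu_de_taquin T i j) (letter_code (T ! i ! j)) i \<sigma>)"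
  using assms
proof (induction T i j rule: jdt_induct)
    case (corner T i j)
    note r = corner(3) and co = corner(4) and i = corner(5) and j = corner(6)
    let ?x = "T ! i ! j" and ?e = "letter_code (T ! i ! j)"
    have e: "entry T i j = Some ?x" using i j by (simp add: entry_def)
    have "slide_path T (delete_corner T i j) ?e i (\<lambda>_. Down i)"
      unfolding slide_path_def
    proof (intro conjI allI impI)
      fix c assume c: "?e \<le> c"
      have "int j < shape T c i" by (rule shape_gt_col[OF r e c])
      moreover have "shape T (Suc c) (Suc i) \<le> int j" by (rule shape_le_col[OF r]) (use corner(1) in auto)
      ultimately show "Down i = push (Suc c) (shape T c) (shape T (Suc c)) (Down i)" by simp
    qed (auto simp: shape_delete_corner(2)[OF r i j corner(1,2)])
    then show ?case using shape_delete_corner(1)[OF r i j corner(1,2)] by blast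
  next
    case (down T i j b T')
    note r = down(4) and co = down(5) and i = down(6) and j = down(7)
    let ?x = "T ! i ! j" and ?e = "letter_code (T ! i ! j)"
    have e: "entry T i j = Some ?x" using i j by (simp add: entry_def)
    have bb: "Suc i < length T" "j < length (T ! Suc i)" "b = T ! Suc i ! j" using down(1) by (auto simp: entry_def split: if_splits)
    have xb: "?x < b" using below_strict[OF r co bb(1,2)] bb(3) by simp
    let ?T = "set_entry T i j b" and ?b = "letter_code b"
    have M1: "shape ?T c = (if ?e \<le> c \<and> c < ?b then act (Down i) (shape T c) else shape T c)" for c
      using xb by (auto simp: shape_set_entry[OF i j] fun_eq_iff less_code)
    have rT: "rows_ok ?T"
    proof (rule rows_ok_set_entry[OF r i j])
      show "T ! i ! k \<le> b" if "k < j" for k using row_sorted_nth[OF r i, of k j] that j xb by auto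
      show "b \<le> T ! i ! Suc j" if "Suc j < length (T ! i)" using down(2)[of "T ! i ! Suc j"] that i by (simp add: entry_def)
    qed
    have cT: "cols_ok (Suc i) ?T" using co unfolding cols_ok_def by (auto simp: M1)
    have IH: "rows_ok (T') \<and> (\<exists>\<sigma>. slide_path ?T (T') (letter_code (?T ! Suc i ! j)) (Suc i) \<sigma>)"
      by (rule down(3)[OF rT cT]) (use bb in \<open>simp_all add: set_entry_def\<close>)
    have tb: "?T ! Suc i ! j = b" using bb by (simp add: set_entry_def)
    obtain \<sigma>1 where s1: "slide_path ?T (T') ?b (Suc i) \<sigma>1" using IH tb by auto
    have "\<exists>\<sigma>. slide_path T (T') ?e i \<sigma>"
    proof (rule slide_path_extend[OF s1 _ _ _ M1])
      show "?e \<le> ?b" using xb by (simp add: less_code)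
      show "i \<le> Suc i" by simp
      show "?e = ?b \<Longrightarrow> Suc i = i" using xb by (simp add: less_code)
      fix c assume c: "?e \<le> c"
      have g: "int j < shape T c i" by (rule shape_gt_col[OF r e c])
      show "shape T (Suc c) (Suc i) \<noteq> shape T c i" if "Suc c < ?b"
        using shape_le_col[OF r, of "Suc i" j "Suc c"] down(1) that g by auto
      show "push ?b (shape T c) (shape T ?b) (Down i) = Down (Suc i)" if "?b = Suc c"
      proof -
        have "shape T c i \<le> int (Suc j)" by (rule shape_le_col[OF r]) (use down(2) that in \<open>auto simp: le_code\<close>)
        moreover have "int j < shape T ?b (Suc i)" by (rule shape_gt_col[OF r down(1)]) simp
        moreover have "shape T ?b (Suc i) \<le> shape T c i" using co that by (simp add: cols_ok_def)
        ultimately show ?thesis by simp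
      qed
    qed
    then show ?case using IH by simp
  next
    case (right T i j r T')
    note ro = right(4) and co = right(5) and i = right(6) and j = right(7)
    let ?x = "T ! i ! j" and ?e = "letter_code (T ! i ! j)"
    have e: "entry T i j = Some ?x" using i j by (simp add: entry_def)
    have bb: "Suc j < length (T ! i)" "r = T ! i ! Suc j" using right(1) by (auto simp: entry_def split: if_splits)
    have xr: "?x \<le> r" using row_sorted_nth[OF ro i, of j "Suc j"] bb by simp
    let ?T = "set_entry T i j r" and ?r = "letter_code r"
    have M1: "shape ?T c = (if ?e \<le> c \<and> c < ?r then act (Down i) (shape T c) else shape T c)" for c
      using xr by (auto simp: shape_set_entry[OF i j] fun_eq_iff le_code)
    have rT: "rows_ok ?T"
    proof (rule rows_ok_set_entry[OF ro i j])
      show "T ! i ! k \<le> r" if "k < j" for k using row_sorted_nth[OF ro i, of k "Suc j"] that bb by auto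
      show "r \<le> T ! i ! Suc j" if "Suc j < length (T ! i)" using bb by simp
    qed
    have low: "shape T (Suc c) (Suc i) \<le> int j" if "c < ?r" for c
      by (rule shape_le_col[OF ro]) (use right(2) that in \<open>auto simp: less_code\<close>)
    have gt: "int j < shape T c i" if "?e \<le> c" for c by (rule shape_gt_col[OF ro e that])
    have cT: "cols_ok i ?T" unfolding cols_ok_def
    proof (intro allI impI conjI)
      fix c k assume k: "i \<le> k"
      show "shape ?T 0 (Suc k) = 0" using co k M1[of 0] by (auto simp: cols_ok_def)
      have "shape T (Suc c) (Suc k) \<le> shape T c k" using co k by (auto simp: cols_ok_def)
      then show "shape ?T (Suc c) (Suc k) \<le> shape ?T c k" using low[of c] gt[of c] k M1[of c] M1[of "Suc c"] by (cases "k = i") (auto split: if_splits)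
    qed
    have IH: "rows_ok (T') \<and> (\<exists>\<sigma>. slide_path ?T (T') (letter_code (?T ! i ! Suc j)) i \<sigma>)"
      by (rule right(3)[OF rT cT]) (use bb i in \<open>simp_all add: set_entry_def\<close>)
    have tb: "?T ! i ! Suc j = r" using bb i by (simp add: set_entry_def)
    obtain \<sigma>1 where s1: "slide_path ?T (T') ?r i \<sigma>1" using IH tb by auto
    have "\<exists>\<sigma>. slide_path T (T') ?e i \<sigma>"
    proof (rule slide_path_extend[OF s1 _ _ _ M1])
      show "?e \<le> ?r" using xr by (simp add: le_code)
      show "i \<le> i" by simp
      show "?e = ?r \<Longrightarrow> i = i" by simp
      fix c assume c: "?e \<le> c"
      show "shape T (Suc c) (Suc i) \<noteq> shape T c i" if "Suc c < ?r" using low[of c] gt[OF c] that by auto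
      show "push ?r (shape T c) (shape T ?r) (Down i) = Down i" if "?r = Suc c" using low[of c] gt[OF c] that by auto
    qed
    then show ?case using IH by simp
qed

section \<open>Insertion as a path of steps\<close>

lemma first_index:
  assumes "x \<in> set xs" "P x"
  shows "first_index P xs < length xs" "P (xs ! first_index P xs)" "\<And>k. k < first_index P xs \<Longrightarrow> \<not> P (xs ! k)"
proof -
  show l: "first_index P xs < length xs" using assms by (induction xs) (auto simp: first_index_def)
  show "P (xs ! first_index P xs)" using nth_length_takeWhile[of "\<lambda>x. \<not> P x" xs] l unfolding first_index_def by blast
  show "\<not> P (xs ! k)" if "k < first_index P xs" for k
    using that set_takeWhileD[of "xs ! k" "\<lambda>x. \<not> P x" xs] takeWhile_nth[of k "\<lambda>x. \<not> P x" xs] nth_mem[of k "takeWhile (\<lambda>x. \<not> P x) xs"] unfolding first_index_def by metis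
qed

text \<open>Passes from code \<open>c\<close> to \<open>Suc c\<close>. The code \<open>2*K+2\<close>
  is the plain letter of layer \<open>K\<close> and \<open>2*K+3\<close> its bar; the two quotients
  recover \<open>K\<close> from \<open>c\<close>.\<close>

definition next_step :: "(nat \<Rightarrow> nat \<Rightarrow> int) \<Rightarrow> nat \<Rightarrow> step \<Rightarrow> step" where
  "next_step m c s = (if even (Suc c) then plain_step ((c - 1) div 2) (m c) (m (Suc c)) (m (Suc (Suc c))) s
    else barred_step ((c - 2) div 2) (m c) (m (Suc c)) s)"

text \<open>The step at the code of the letter that is being inserted itself, on its arrival in row
  \<open>i\<close>.\<close>

definition start_step :: "(nat \<Rightarrow> nat \<Rightarrow> int) \<Rightarrow> nat \<Rightarrow> nat \<Rightarrow> step" where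
  "start_step m c i = (if c = 2 * i + 2 \<and> m c i < m (Suc c) i then Hold else Up i)"

lemma plain_step_cases: "plain_step K a b d s = (if push (2*K+2) a b s = Up K \<and> b K < d K then Hold else push (2*K+2) a b s)"
  by (simp add: plain_step_def Let_def)

lemma next_step_simps:
  assumes "1 \<le> c"
  shows "next_step m c (Down r) = push (Suc c) (m c) (m (Suc c)) (Down r)" (is ?A)
    "next_step m c (Up r) = start_step m (Suc c) (if m c r < m (Suc c) r then Suc r else r)" (is ?B)
    "next_step m c (New d) = (if d = Suc c then start_step m (Suc c) 0 else New d)" (is ?C)
proof -
  have "even (Suc c) \<or> odd (Suc c)" by blast
  then have "?A \<and> ?B \<and> ?C"
  proof
    assume e: "even (Suc c)"
    then obtain K where K: "c = 2 * K + 1" by (metis even_Suc oddE)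
    then have "(c - 1) div 2 = K" by simp
    then have "next_step m c s = plain_step K (m c) (m (Suc c)) (m (Suc (Suc c))) s" for s using e by (simp add: next_step_def)
    then show ?thesis using K by (auto simp: plain_step_cases start_step_def)
  next
    assume e: "odd (Suc c)"
    have "\<exists>K. c = 2 * K + 2" using e assms by presburger
    then obtain K where K: "c = 2 * K + 2" by blast
    then have "(c - 2) div 2 = K" by simp
    then have n: "next_step m c s = barred_step K (m c) (m (Suc c)) s" for s using e by (simp add: next_step_def)
    have ne: "Suc c \<noteq> 2 * r + 2" for r using K by presburger
    show ?thesis using K ne unfolding n by (auto simp: barred_step_def start_step_def numeral_3_eq_3)
  qed
  then show ?A ?B ?C by auto
qed

lemma next_step_Hold: "next_step m (2 * K + 2) Hold = Down K" by (simp add: next_step_def barred_step_def)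

definition insert_path :: "tableau \<Rightarrow> tableau \<Rightarrow> nat \<Rightarrow> nat \<Rightarrow> (nat \<Rightarrow> step) \<Rightarrow> bool" where
  "insert_path T T' e i \<sigma> \<longleftrightarrow> \<sigma> e = start_step (shape T) e i \<and> (\<forall>c\<ge>e. \<sigma> (Suc c) = next_step (shape T) c (\<sigma> c)) \<and>
    (\<forall>c\<ge>e. shape T' c = act (\<sigma> c) (shape T c)) \<and> (\<forall>c<e. shape T' c = shape T c)"

definition low_ok :: "nat \<Rightarrow> tableau \<Rightarrow> bool" where
  "low_ok i T \<longleftrightarrow> (\<forall>r c. i \<le> r \<longrightarrow> c < 2 * r + 2 \<longrightarrow> shape T c r = 0)"

text \<open>The bump case passes on the King condition. A letter that may stand in row
  \<open>i\<close> could drive out one that may not stand in the next row only if \<open>k\<close>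
  bumps \<open>k\<close>-bar, which is the exception.\<close>

lemma insert_from_induct [case_names new append bump exception]:
  assumes "\<And>i a T. length T \<le> i \<Longrightarrow> Q i a T (T @ [[a]])"
    and "\<And>i a T. i < length T \<Longrightarrow> \<forall>b\<in>set (T ! i). b \<le> a \<Longrightarrow> Q i a T (T[i := T ! i @ [a]])"
    and "\<And>i a T j T'. i < length T \<Longrightarrow> j < length (T ! i) \<Longrightarrow> a < T ! i ! j \<Longrightarrow> (\<And>k. k < j \<Longrightarrow> T ! i ! k \<le> a) \<Longrightarrow>
      (2 * i + 2 \<le> letter_code a \<Longrightarrow> 2 * Suc i + 2 \<le> letter_code (T ! i ! j)) \<Longrightarrow>
      Q (Suc i) (T ! i ! j) (set_entry T i j a) T' \<Longrightarrow> Q i a T T'"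
    and "\<And>i a T j. i < length T \<Longrightarrow> a = Plain (Suc i) \<Longrightarrow> j < length (T ! i) \<Longrightarrow> T ! i ! j = Barred (Suc i) \<Longrightarrow>
      (\<And>k. k < j \<Longrightarrow> T ! i ! k \<noteq> Barred (Suc i)) \<Longrightarrow>
      Q i a T (jeu_de_taquin (set_entry T i j a) i (first_index (\<lambda>b. b = Plain (Suc i)) (set_entry T i j a ! i)))"
  shows "Q i a T (insert_from i a T)"
proof (induction i a T rule: insert_from.induct)
  case (1 i a T)
  consider (new) "length T \<le> i" | (exception) "i < length T" "a = Plain (Suc i)" "Barred (Suc i) \<in> set (T ! i)"
    | (bump) "i < length T" "\<not> (a = Plain (Suc i) \<and> Barred (Suc i) \<in> set (T ! i))" "\<exists>b\<in>set (T ! i). a < b"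
    | (append) "i < length T" "\<not> (a = Plain (Suc i) \<and> Barred (Suc i) \<in> set (T ! i))" "\<not> (\<exists>b\<in>set (T ! i). a < b)"
    by (metis not_le)
  then show ?case
  proof cases
    case new
    then show ?thesis using assms(1) by (simp add: insert_from.simps)
  next
    case append
    have "insert_from i a T = T[i := T ! i @ [a]]" using append by (subst insert_from.simps) auto
    then show ?thesis using append assms(2)[of i T a] by (simp add: not_less)
  next
    case bump
    define j where "j = first_index (\<lambda>b. a < b) (T ! i)"
    have j: "j < length (T ! i)" "a < T ! i ! j" "\<And>k. k < j \<Longrightarrow> T ! i ! k \<le> a"
      using bump(3) first_index[of _ "T ! i" "\<lambda>b. a < b"] by (auto simp: j_def not_less)
    have b: "2 * Suc i + 2 \<le> letter_code (T ! i ! j)" if "2 * i + 2 \<le> letter_code a"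
    proof (rule ccontr)
      assume "\<not> ?thesis"
      then have c: "letter_code a = 2 * i + 2" "letter_code (T ! i ! j) = 2 * i + 3" using j(2) that by (auto simp: less_code)
      have "T ! i ! j = Barred (Suc i)" "a = Plain (Suc i)" using c by (auto intro: letter_code_inject)
      then show False using bump(2) nth_mem[OF j(1)] by simp
    qed
    have T': "insert_from i a T = insert_from (Suc i) (T ! i ! j) (set_entry T i j a)"
      using bump by (subst insert_from.simps) (auto simp: Let_def j_def)
    show ?thesis unfolding T'
      by (rule assms(3)[OF bump(1) j b]) (use 1[of j] bump in \<open>auto simp: j_def not_le\<close>)
  next
    case exception
    define j where "j = first_index (\<lambda>b. b = Barred (Suc i)) (T ! i)"
    have j: "j < length (T ! i)" "T ! i ! j = Barred (Suc i)" "\<And>k. k < j \<Longrightarrow> T ! i ! k \<noteq> Barred (Suc i)"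
      using first_index[OF exception(3), of "\<lambda>b. b = Barred (Suc i)"] by (auto simp: j_def)
    have "set_entry T i j a ! i = (T ! i)[j := Plain (Suc i)]" "set_entry T i j a = T[i := (T ! i)[j := Plain (Suc i)]]"
      using exception by (simp_all add: set_entry_def)
    then have "insert_from i a T = jeu_de_taquin (set_entry T i j a) i (first_index (\<lambda>b. b = Plain (Suc i)) (set_entry T i j a ! i))"
      using exception by (subst insert_from.simps) (auto simp: Let_def j_def)
    then show ?thesis using assms(4)[OF exception(1,2) j] by simp
  qed
qed

lemma before_barred:
  assumes "rows_ok T" "i < length T" "j < length (T ! i)" "T ! i ! j = Barred (Suc i)" "\<And>k. k < j \<Longrightarrow> T ! i ! k \<noteq> Barred (Suc i)" "k < j"
  shows "T ! i ! k \<le> Plain (Suc i)"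
proof -
  have "letter_code (T ! i ! k) \<le> 2 * i + 3" using row_sorted_nth[OF assms(1,2), of k j] assms(3,4,6) by (simp add: le_code)
  moreover have "letter_code (T ! i ! k) \<noteq> 2 * i + 3" using assms(5)[OF assms(6)] letter_code_inject[of "T ! i ! k" "Barred (Suc i)"] by auto
  ultimately show ?thesis by (simp add: le_code)
qed

lemma insert_from_path:
  assumes "rows_ok T" "cols_ok i T" "low_ok i T" "i \<le> length T" "2 * i + 2 \<le> letter_code a"
  shows "rows_ok (insert_from i a T) \<and> (\<exists>\<sigma>. insert_path T (insert_from i a T) (letter_code a) i \<sigma>)"
  using assms
proof (induction i a T rule: insert_from_induct)
  case (new i a T)
  note r = new(2) and il = new(5) and ca = new(6)
  let ?e = "letter_code a"
  have e1: "1 \<le> ?e" using ca by simp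
  have l: "length T = i" using new(1) il by simp
  have M': "shape (T @ [[a]]) c = (if ?e \<le> c then act (Up i) (shape T c) else shape T c)" for c
    by (auto simp: shape_def l nth_append fun_eq_iff count_le_simps)
  have z: "shape T c i = 0" for c using l by (simp add: shape_def)
  have s: "start_step (shape T) c i = Up i" for c using z by (simp add: start_step_def)
  have "insert_path T (T @ [[a]]) ?e i (\<lambda>_. Up i)" unfolding insert_path_def using z s next_step_simps(2)[of _ "shape T" i] e1 by (auto simp: M')
  moreover have "rows_ok (T @ [[a]])" using r by (auto simp: rows_ok_def)
  ultimately show ?case by auto
next
  case ap: (append i a T)
  note r = ap(3) and ca = ap(7)
  let ?e = "letter_code a"
  have e1: "1 \<le> ?e" using ca by simp
  have M': "shape (T[i := T ! i @ [a]]) c = (if ?e \<le> c then act (Up i) (shape T c) else shape T c)" for c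
    using ap(1) by (auto simp: shape_def nth_list_update fun_eq_iff count_le_simps)
  have le: "\<forall>b\<in>set (T ! i). letter_code b \<le> ?e" using ap(2) by (auto simp: le_code)
  have z: "shape T c i = int (length (T ! i))" if "?e \<le> c" for c
  proof -
    have "filter (\<lambda>x. letter_code x \<le> c) (T ! i) = T ! i" using le that by (auto simp: filter_id_conv)
    then show ?thesis using ap(1) by (simp add: shape_def count_le_def)
  qed
  have s: "start_step (shape T) c i = Up i" if "?e \<le> c" for c using z that by (simp add: start_step_def)
  have "insert_path T (T[i := T ! i @ [a]]) ?e i (\<lambda>_. Up i)" unfolding insert_path_def using z s next_step_simps(2)[of _ "shape T" i] e1 by (auto simp: M')
  moreover have "rows_ok (T[i := T ! i @ [a]])"
  proof (rule rows_ok_update[OF r])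
    show "sorted (T ! i @ [a])" using r ap(1) le by (auto simp: rows_ok_def sorted_append le_code)
  qed simp
  ultimately show ?case by auto
next
  case (bump i a T j T2)
  note r = bump(7) and co = bump(8) and lo = bump(9) and ca = bump(11)
  define b where "b = T ! i ! j"
  let ?e = "letter_code a" and ?b = "letter_code b" and ?T = "set_entry T i j a"
  have e1: "1 \<le> ?e" using ca by simp
  have j: "j < length (T ! i)" "a < b" "\<And>k. k < j \<Longrightarrow> T ! i ! k \<le> a" using bump(2-4) by (simp_all add: b_def)
  have ab: "?e < ?b" using j(2) by (simp add: less_code)
  have M1: "shape ?T c = (if ?e \<le> c \<and> c < ?b then act (Up i) (shape T c) else shape T c)" for c
    using ab by (auto simp: shape_set_entry[OF bump(1) j(1)] fun_eq_iff b_def)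
  have rT: "rows_ok ?T"
  proof (rule rows_ok_set_entry[OF r bump(1) j(1,3)])
    show "a \<le> T ! i ! Suc j" if "Suc j < length (T ! i)" using row_sorted_nth[OF r bump(1), of j "Suc j"] that j(2) by (simp add: b_def)
  qed
  have cT: "cols_ok (Suc i) ?T" using co unfolding cols_ok_def by (auto simp: M1)
  have lT: "low_ok (Suc i) ?T" using lo unfolding low_ok_def by (auto simp: M1)
  have b2: "2 * Suc i + 2 \<le> ?b" using bump(5)[OF ca] by (simp add: b_def)
  obtain \<sigma>1 where rr: "rows_ok T2" and s1: "insert_path ?T T2 ?b (Suc i) \<sigma>1"
    using bump(6)[OF rT cT lT] bump(1) b2 by (auto simp: b_def)
  have p1: "\<sigma>1 ?b = start_step (shape ?T) ?b (Suc i)" "\<And>c. c \<ge> ?b \<Longrightarrow> \<sigma>1 (Suc c) = next_step (shape ?T) c (\<sigma>1 c)"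
    "\<And>c. c \<ge> ?b \<Longrightarrow> shape T2 c = act (\<sigma>1 c) (shape ?T c)" "\<And>c. c < ?b \<Longrightarrow> shape T2 c = shape ?T c"
    using s1 unfolding insert_path_def by auto
  have eb: "entry T i j = Some b" using bump(1) j(1) by (simp add: entry_def b_def)
  \<comment> \<open>\<open>a\<close> takes over column \<open>j\<close> from \<open>b\<close>, so
    row \<open>i\<close> has no letters with codes above that of \<open>a\<close> and below that of
    \<open>b\<close>. Hence the path stays at \<open>Up i\<close> until the code of
    \<open>b\<close>.\<close>
  have const: "shape T c i = int j" if "?e \<le> c" "c < ?b" for c
  proof -
    have "shape T c i \<le> int j" by (rule shape_le_col[OF r]) (use eb that in auto)
    moreover have "int j \<le> shape T c i"
    proof (cases j)
      case (Suc k)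
      have "letter_code (T ! i ! k) \<le> ?e" using j(3)[of k] Suc by (simp add: le_code)
      then have "int k < shape T c i" by (intro shape_gt_col[OF r, of i k "T ! i ! k"]) (use Suc j(1) bump(1) that in \<open>auto simp: entry_def\<close>)
      then show ?thesis using Suc by simp
    qed (simp add: shape_def)
    ultimately show ?thesis by simp
  qed
  have jb: "int j < shape T ?b i" by (rule shape_gt_col[OF r eb]) simp
  have nh: "\<not> (?e = 2 * i + 2 \<and> shape T ?e i < shape T (Suc ?e) i)"
  proof
    assume h: "?e = 2 * i + 2 \<and> shape T ?e i < shape T (Suc ?e) i"
    then have "\<not> Suc ?e < ?b" using const[of ?e] const[of "Suc ?e"] ab by auto
    then show False using h b2 ab by simp
  qed
  let ?s = "\<lambda>c. if c < ?b then Up i else \<sigma>1 c"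
  have "insert_path T T2 ?e i ?s" unfolding insert_path_def
  proof (intro conjI allI impI)
    show "?s ?e = start_step (shape T) ?e i" using ab nh by (auto simp: start_step_def)
  next
    fix c assume c: "?e \<le> c"
    show "?s (Suc c) = next_step (shape T) c (?s c)"
    proof (cases "?b \<le> c")
      case True
      then show ?thesis using p1(2)[OF True] by (simp add: next_step_def M1)
    next
      case False
      show ?thesis
      proof (cases "?b = Suc c")
        case True
        have "shape T c i < shape T (Suc c) i" using const[of c] c jb True by simp
        then have "next_step (shape T) c (Up i) = start_step (shape T) (Suc c) (Suc i)" using next_step_simps(2)[of c "shape T" i] c e1 by simp
        also have "\<dots> = start_step (shape ?T) ?b (Suc i)" unfolding True[symmetric] by (simp add: start_step_def M1)
        finally show ?thesis using True p1(1) by simp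
      next
        case b: False
        then show ?thesis using const[OF c] const[of "Suc c"] False next_step_simps(2)[of c "shape T" i] c e1 ca by (auto simp: start_step_def)
      qed
    qed
  next
    fix c assume c: "?e \<le> c"
    show "shape T2 c = act (?s c) (shape T c)" using p1(3,4)[of c] M1[of c] c by auto
  next
    fix c assume c: "c < ?e"
    show "shape T2 c = shape T c" using p1(4)[of c] M1[of c] c ab by auto
  qed
  then show ?case using rr by auto
next
  case exc: (exception i a T j)
  note r = exc(6) and co = exc(7) and lo = exc(8) and ca = exc(10) and j = exc(3-5)
  let ?e = "letter_code a" and ?T = "set_entry T i j a"
  have e1: "1 \<le> ?e" using ca by simp
  define k where "k = first_index (\<lambda>b. b = Plain (Suc i)) (?T ! i)"
  have "a \<in> set (?T ! i)" using j(1) exc(1) by (simp add: set_entry_def set_update_memI)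
  then have k: "k < length (?T ! i)" "?T ! i ! k = a" using first_index[of a "?T ! i" "\<lambda>b. b = Plain (Suc i)"] exc(2) by (auto simp: k_def)
  have ce: "?e = 2 * i + 2" using exc(2) by simp
  have M1: "shape ?T c = (if c = ?e then act (Up i) (shape T c) else shape T c)" for c
    using ce by (auto simp: shape_set_entry[OF exc(1) j(1)] j(2) fun_eq_iff)
  have rT: "rows_ok ?T"
  proof (rule rows_ok_set_entry[OF r exc(1) j(1)])
    show "T ! i ! l \<le> a" if "l < j" for l using before_barred[OF r exc(1) j that] exc(2) by simp
    show "a \<le> T ! i ! Suc j" if "Suc j < length (T ! i)" using row_sorted_nth[OF r exc(1), of j "Suc j"] that j(2) ce by (simp add: le_code)
  qed
  have cT: "cols_ok i ?T" unfolding cols_ok_def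
  proof (intro allI impI conjI)
    fix c l assume l: "i \<le> l"
    show "shape ?T 0 (Suc l) = 0" using co l ce by (simp add: cols_ok_def M1)
    have "shape T (Suc c) (Suc l) \<le> shape T c l" using co l by (simp add: cols_ok_def)
    then show "shape ?T (Suc c) (Suc l) \<le> shape ?T c l" using l by (auto simp: M1)
  qed
  have iT: "i < length ?T" using exc(1) by simp
  obtain \<sigma>1 where rr: "rows_ok (jeu_de_taquin ?T i k)" and s1: "slide_path ?T (jeu_de_taquin ?T i k) ?e i \<sigma>1"
    using jdt_path[OF rT cT iT k(1)] k(2) by auto
  define T2 where "T2 = jeu_de_taquin ?T i k"
  have p1: "\<sigma>1 ?e = Down i" "\<And>c. c \<ge> ?e \<Longrightarrow> \<sigma>1 (Suc c) = push (Suc c) (shape ?T c) (shape ?T (Suc c)) (\<sigma>1 c)"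
    "\<And>c. c \<ge> ?e \<Longrightarrow> shape T2 c = act (\<sigma>1 c) (shape ?T c)" "\<And>c. c < ?e \<Longrightarrow> shape T2 c = shape ?T c" "\<And>c. c \<ge> ?e \<Longrightarrow> \<exists>r\<ge>i. \<sigma>1 c = Down r"
    using s1 unfolding slide_path_def T2_def by auto
  have hold: "shape T ?e i < shape T (Suc ?e) i"
  proof -
    have eb: "entry T i j = Some (Barred (Suc i))" using exc(1) j by (simp add: entry_def)
    have "int j < shape T (Suc ?e) i" by (rule shape_gt_col[OF r eb]) (simp add: ce)
    moreover have "shape T ?e i \<le> int j" by (rule shape_le_col[OF r]) (use eb ce in auto)
    ultimately show ?thesis by simp
  qed
  \<comment> \<open>By the King condition the next row has no letter up to \<open>k\<close>-bar, so
    at that code the hole is still in row \<open>i\<close>.\<close>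
  have z: "shape T (Suc ?e) (Suc i) = 0" using lo ce by (simp add: low_ok_def)
  have pos: "0 \<le> shape T ?e i" by (simp add: shape_def)
  have s2: "\<sigma>1 (Suc ?e) = Down i" using p1(2)[of ?e] p1(1) z pos by (simp add: M1)
  \<comment> \<open>At the code of \<open>a\<close> the replacement of \<open>k\<close>-bar adds a
    box to row \<open>i\<close> and the hole removes one; they cancel to
    \<open>Hold\<close>.\<close>
  let ?s = "\<lambda>c. if c = ?e then Hold else \<sigma>1 c"
  have "insert_path T T2 ?e i ?s" unfolding insert_path_def
  proof (intro conjI allI impI)
    show "?s ?e = start_step (shape T) ?e i" using ce hold by (simp add: start_step_def)
  next
    fix c assume c: "?e \<le> c"
    show "?s (Suc c) = next_step (shape T) c (?s c)"
    proof (cases "c = ?e")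
      case True
      then show ?thesis using s2 next_step_Hold[of "shape T" i] unfolding ce by simp
    next
      case False
      obtain q where q: "\<sigma>1 c = Down q" using p1(5)[OF c] by blast
      show ?thesis using False c p1(2)[OF c] q next_step_simps(1)[of c "shape T" q] e1 by (simp add: M1)
    qed
  next
    fix c assume c: "?e \<le> c"
    show "shape T2 c = act (?s c) (shape T c)" using p1(3)[OF c] p1(1) M1[of c] by (auto simp: fun_eq_iff)
  next
    fix c assume c: "c < ?e"
    show "shape T2 c = shape T c" using p1(4)[OF c] M1[of c] c by auto
  qed
  then show ?case using rr unfolding T2_def k_def by auto
qed

section \<open>King tableaux and invariance under Knuth moves\<close>

definition king :: "tableau \<Rightarrow> bool" where
  "king T \<longleftrightarrow> rows_ok T \<and> cols_ok 0 T \<and> low_ok 0 T"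

lemma berele_path:
  assumes "king T" "2 \<le> letter_code x"
  shows "rows_ok (berele_insert T x) \<and> (\<exists>\<sigma>. \<sigma> 1 = New (letter_code x) \<and> (\<forall>c\<ge>1. \<sigma> (Suc c) = next_step (shape T) c (\<sigma> c)) \<and>
    (\<forall>c\<ge>1. shape (berele_insert T x) c = act (\<sigma> c) (shape T c)) \<and> shape (berele_insert T x) 0 = shape T 0)"
proof -
  let ?e = "letter_code x"
  obtain \<sigma> where r: "rows_ok (berele_insert T x)" and s: "insert_path T (berele_insert T x) ?e 0 \<sigma>"
    using insert_from_path[of T 0 x] assms unfolding king_def berele_insert_def by auto
  let ?s = "\<lambda>c. if c < ?e then New ?e else \<sigma> c"
  have p: "\<sigma> ?e = start_step (shape T) ?e 0" "\<And>c. c \<ge> ?e \<Longrightarrow> \<sigma> (Suc c) = next_step (shape T) c (\<sigma> c)"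
    "\<And>c. c \<ge> ?e \<Longrightarrow> shape (berele_insert T x) c = act (\<sigma> c) (shape T c)" "\<And>c. c < ?e \<Longrightarrow> shape (berele_insert T x) c = shape T c"
    using s unfolding insert_path_def by auto
  have "?s (Suc c) = next_step (shape T) c (?s c)" if "1 \<le> c" for c
  proof (cases "?e \<le> c")
    case True
    then show ?thesis using p(2) by simp
  next
    case False
    show ?thesis
    proof (cases "?e = Suc c")
      case True
      have "?s (Suc c) = start_step (shape T) (Suc c) 0" using p(1) True by simp
      also have "\<dots> = next_step (shape T) c (?s c)" using next_step_simps(3)[OF that, of "shape T" "Suc c"] True by simp
      finally show ?thesis .
    next
      case neq: False
      then show ?thesis using False next_step_simps(3)[OF that, of "shape T" ?e] by simp
    qed
  qed
  moreover have "shape (berele_insert T x) c = act (?s c) (shape T c)" for c using p(3,4)[of c] by (cases "c < ?e") simp_all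
  moreover have "shape (berele_insert T x) 0 = shape T 0" using p(4) assms(2) by simp
  moreover have "?s 1 = New ?e" using assms(2) by simp
  ultimately show ?thesis using r by (intro conjI exI[of _ ?s]) auto
qed

definition layer :: "tableau \<Rightarrow> nat \<Rightarrow> (nat \<Rightarrow> int) \<times> (nat \<Rightarrow> int) \<times> (nat \<Rightarrow> int)" where
  "layer T K = (shape T (2*K+1), shape T (2*K+2), shape T (2*K+3))"

lemma code_cases:
  fixes c :: nat
  obtains "c = 0" | K where "c = 2*K+1" | K where "c = 2*K+2"
proof -
  have "c = 0 \<or> (\<exists>K. c = 2*K+1) \<or> (\<exists>K. c = 2*K+2)" by presburger
  then show ?thesis using that by blast
qed

lemma king_interlaced: "king T \<Longrightarrow> interlaced (shape T c) (shape T (Suc c))"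
  unfolding king_def cols_ok_def interlaced_def using shape_mono[of c "Suc c" T] by auto

lemma king_nested: "king T \<Longrightarrow> nested K (shape T (2*K+1)) (shape T (2*K+2)) (shape T (2*K+3))"
  unfolding nested_def using king_interlaced[of T "2*K+1"] king_interlaced[of T "2*K+2"] by (auto simp: king_def low_ok_def numeral_3_eq_3)

text \<open>The path is read at the odd codes \<open>2*K+1\<close>, between the layers; codes 0 and
  1 belong to no letter, so it starts from an empty shape. That the result is again a King tableau
  is not traced through the algorithm: it follows from \<open>layer_valid\<close> in every
  layer.\<close>

lemma berele_layers:
  assumes k: "king T" and x: "2 \<le> letter_code x"
  shows "king (berele_insert T x) \<and> (\<exists>\<tau>. \<tau> 0 = New (letter_code x) \<and> (\<forall>K. good K (\<tau> K) (shape T (2*K+1)) \<and>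
    layer (berele_insert T x) K = after K (layer T K) (\<tau> K) \<and> \<tau> (Suc K) = emit K (layer T K) (\<tau> K)))"
proof -
  let ?T = "berele_insert T x"
  obtain \<sigma> where r: "rows_ok ?T" and s: "\<sigma> 1 = New (letter_code x)" "\<And>c. c\<ge>1 \<Longrightarrow> \<sigma> (Suc c) = next_step (shape T) c (\<sigma> c)"
    "\<And>c. c\<ge>1 \<Longrightarrow> shape ?T c = act (\<sigma> c) (shape T c)" "shape ?T 0 = shape T 0"
    using berele_path[OF k x] by auto
  define \<tau> where "\<tau> K = \<sigma> (2*K+1)" for K
  have f: "\<sigma> (2*K+2) = plain_step K (shape T (2*K+1)) (shape T (2*K+2)) (shape T (2*K+3)) (\<tau> K)" for K
    using s(2)[of "2*K+1"] by (simp add: next_step_def \<tau>_def numeral_3_eq_3)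
  have o: "\<tau> (Suc K) = out K (shape T (2*K+1)) (shape T (2*K+2)) (shape T (2*K+3)) (\<tau> K)" for K
    using s(2)[of "2*K+2"] f[of K] by (simp add: next_step_def \<tau>_def numeral_3_eq_3 out_def)
  have M3: "shape ?T (2*K+3) = act (\<tau> (Suc K)) (shape T (2*K+3))" for K
    using s(3)[of "2*K+3"] by (simp add: \<tau>_def numeral_3_eq_3)
  have lay: "layer ?T K = after K (layer T K) (\<tau> K)" for K
    using s(3)[of "2*K+1"] s(3)[of "2*K+2"] f[of K] o[of K] M3[of K] by (simp add: layer_def \<tau>_def)
  have o': "\<tau> (Suc K) = emit K (layer T K) (\<tau> K)" for K using o by (simp add: layer_def)
  have g: "good K (\<tau> K) (shape T (2*K+1))" for K
  proof (induction K)
    case 0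
    then show ?case using s(1) x by (simp add: good_def \<tau>_def)
  next
    case (Suc K)
    then show ?case using layer_valid(2)[OF king_nested[OF k] Suc] o[of K] by (simp add: numeral_3_eq_3)
  qed
  have ci: "nested K (shape ?T (2*K+1)) (shape ?T (2*K+2)) (shape ?T (2*K+3))" for K
    using layer_valid(1)[OF king_nested[OF k] g, of K] lay[of K] by (simp add: layer_def)
  have z: "shape ?T c r = 0" if "c < 2*r+2" for c r
  proof (cases c rule: code_cases)
    case 1
    then show ?thesis using s(4) k by (simp add: king_def low_ok_def)
  next
    case (2 K)
    then show ?thesis using ci[of K] that by (simp add: nested_def)
  next
    case (3 K)
    then show ?thesis using ci[of K] that by (simp add: nested_def)
  qed
  have int: "shape ?T (Suc c) (Suc r) \<le> shape ?T c r" for c r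
  proof (cases c rule: code_cases)
    case 1
    then show ?thesis using z[of 1 "Suc r"] z[of 0 r] by simp
  next
    case (2 K)
    then show ?thesis using ci[of K] by (simp add: nested_def interlaced_def)
  next
    case (3 K)
    then show ?thesis using ci[of K] by (simp add: nested_def interlaced_def numeral_3_eq_3)
  qed
  have "king ?T" unfolding king_def cols_ok_def low_ok_def using r z int by auto
  then show ?thesis using s(1) g lay o' by (intro conjI exI[of _ \<tau>]) (auto simp: \<tau>_def)
qed

abbreviation new3 where
  "new3 x y z \<equiv> (New (letter_code x), New (letter_code y), New (letter_code z))"

lemma berele_triple:
  assumes k: "king T" and x: "2 \<le> letter_code x" "2 \<le> letter_code y" "2 \<le> letter_code z"
  shows "king (foldl berele_insert T [x, y, z]) \<and> (\<exists>\<tau>. \<tau> 0 = new3 x y z \<and>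
    (\<forall>K. good_triple K (shape T (2*K+1)) (\<tau> K) \<and>
    layer (foldl berele_insert T [x, y, z]) K = after_triple K (layer T K) (\<tau> K) \<and> \<tau> (Suc K) = emit_triple K (layer T K) (\<tau> K)))"
proof -
  let ?T1 = "berele_insert T x" let ?T2 = "berele_insert ?T1 y" let ?T3 = "berele_insert ?T2 z"
  obtain a where a: "king ?T1" "a 0 = New (letter_code x)" "\<And>K. good K (a K) (shape T (2*K+1))" "\<And>K. layer ?T1 K = after K (layer T K) (a K)" "\<And>K. a (Suc K) = emit K (layer T K) (a K)"
    using berele_layers[OF k x(1)] by auto
  obtain b where b: "king ?T2" "b 0 = New (letter_code y)" "\<And>K. good K (b K) (shape ?T1 (2*K+1))" "\<And>K. layer ?T2 K = after K (layer ?T1 K) (b K)" "\<And>K. b (Suc K) = emit K (layer ?T1 K) (b K)"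
    using berele_layers[OF a(1) x(2)] by auto
  obtain c where c: "king ?T3" "c 0 = New (letter_code z)" "\<And>K. good K (c K) (shape ?T2 (2*K+1))" "\<And>K. layer ?T3 K = after K (layer ?T2 K) (c K)" "\<And>K. c (Suc K) = emit K (layer ?T2 K) (c K)"
    using berele_layers[OF b(1) x(3)] by auto
  have 1: "shape ?T1 (2*K+1) = act (a K) (shape T (2*K+1))" for K using a(4)[of K] by (simp add: layer_def)
  have 2: "shape ?T2 (2*K+1) = act (b K) (shape ?T1 (2*K+1))" for K using b(4)[of K] by (simp add: layer_def)
  have "good_triple K (shape T (2*K+1)) (a K, b K, c K)" for K
    using a(3)[of K] b(3)[of K] c(3)[of K] unfolding 2 1 by (simp add: good_triple_def good_pair_def)
  then show ?thesis
    using a b c by (intro conjI exI[of _ "\<lambda>K. (a K, b K, c K)"]) (simp_all add: after_triple_def emit_triple_def after_pair_def emit_pair_def del: after.simps emit.simps)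
qed

lemma rows_ok_shape_inject:
  assumes "rows_ok T" "rows_ok T'" "shape T = shape T'"
  shows "T = T'"
proof -
  have *: "r < length S \<and> j < length (S ! r) \<longleftrightarrow> (\<exists>c. int j < shape S c r)" if "rows_ok S" for S r j
  proof
    assume "r < length S \<and> j < length (S ! r)"
    then show "\<exists>c. int j < shape S c r" using shape_nth[OF that, of r j] by blast
  next
    assume "\<exists>c. int j < shape S c r"
    then obtain c where c: "int j < shape S c r" by blast
    then have r: "r < length S" by (auto simp: shape_def split: if_splits)
    then show "r < length S \<and> j < length (S ! r)" using c count_le_length[of c "S ! r"] by (simp add: shape_def)
  qed
  have cell: "r < length T \<and> j < length (T ! r) \<longleftrightarrow> r < length T' \<and> j < length (T' ! r)" for r j
    using *[OF assms(1)] *[OF assms(2)] assms(3) by simp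
  have ne: "r < length S \<longleftrightarrow> r < length S \<and> 0 < length (S ! r)" if "rows_ok S" for S r using that by (auto simp: rows_ok_def)
  have rl: "r < length T \<longleftrightarrow> r < length T'" for r using cell[of r 0] ne[OF assms(1)] ne[OF assms(2)] by blast
  have len: "length T = length T'" using rl by (meson linorder_neqE_nat less_irrefl)
  show ?thesis
  proof (rule nth_equalityI[OF len])
    fix r assume r: "r < length T"
    have l: "j < length (T ! r) \<longleftrightarrow> j < length (T' ! r)" for j using cell[of r j] r len by simp
    then have len': "length (T ! r) = length (T' ! r)" by (meson linorder_neqE_nat less_irrefl)
    show "T ! r = T' ! r"
    proof (rule nth_equalityI[OF len'])
      fix j assume j: "j < length (T ! r)"
      have "letter_code (T ! r ! j) \<le> c \<longleftrightarrow> letter_code (T' ! r ! j) \<le> c" for c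
        using shape_nth[OF assms(1) r j, of c] shape_nth[OF assms(2), of r j c] assms(3) r j len len' by simp
      then show "T ! r ! j = T' ! r ! j" by (intro letter_code_inject antisym) auto
    qed
  qed
qed

text \<open>The relation between the innermost steps propagates to all layers by
  \<open>layer_related\<close>. Equal layers are equal shapes at every code, and these determine the
  tableau.\<close>

lemma triple_eq:
  assumes k: "king T" and x: "2 \<le> letter_code x" "2 \<le> letter_code y" "2 \<le> letter_code z" and x': "2 \<le> letter_code x'" "2 \<le> letter_code y'" "2 \<le> letter_code z'"
    and related: "related (shape T 1) (new3 x y z) (new3 x' y' z')"
  shows "foldl berele_insert T [x, y, z] = foldl berele_insert T [x', y', z']"
proof -
  let ?A = "foldl berele_insert T [x, y, z]" and ?B = "foldl berele_insert T [x', y', z']"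
  obtain s where s: "king ?A" "s 0 = new3 x y z" "\<And>K. good_triple K (shape T (2*K+1)) (s K)"
    "\<And>K. layer ?A K = after_triple K (layer T K) (s K)" "\<And>K. s (Suc K) = emit_triple K (layer T K) (s K)"
    using berele_triple[OF k x] by blast
  obtain t where t: "king ?B" "t 0 = new3 x' y' z'" "\<And>K. good_triple K (shape T (2*K+1)) (t K)"
    "\<And>K. layer ?B K = after_triple K (layer T K) (t K)" "\<And>K. t (Suc K) = emit_triple K (layer T K) (t K)"
    using berele_triple[OF k x'] by blast
  have r: "related (shape T (2*K+1)) (s K) (t K)" for K
  proof (induction K)
    case 0
    then show ?case using related s(2) t(2) by simp
  next
    case (Suc K)
    then show ?case using layer_related[OF king_nested[OF k] s(3) t(3) Suc] s(5)[of K] t(5)[of K] by (simp add: layer_def numeral_3_eq_3)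
  qed
  have lay: "layer ?A K = layer ?B K" for K
    using layer_related[OF king_nested[OF k] s(3) t(3) r[of K]] s(4)[of K] t(4)[of K] by (simp add: layer_def)
  have "shape ?A c = shape ?B c" for c
  proof (cases c rule: code_cases)
    case 1
    then show ?thesis using s(1) t(1) by (simp add: king_def low_ok_def fun_eq_iff)
  next
    case (2 K)
    then show ?thesis using lay[of K] by (simp add: layer_def)
  next
    case (3 K)
    then show ?thesis using lay[of K] by (simp add: layer_def)
  qed
  then show ?thesis using rows_ok_shape_inject[of ?A ?B] s(1) t(1) by (simp add: king_def fun_eq_iff)
qed

lemma knuth_move_berele:
  assumes "knuth_move w w'" "\<forall>x\<in>set w. 2 \<le> letter_code x"
  shows "P\<^sub>C w = P\<^sub>C w'"
proof -
  have kg: "king (foldl berele_insert T u)" if "king T" "\<forall>x\<in>set u. 2 \<le> letter_code x" for T u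
    using that by (induction u arbitrary: T) (auto simp: berele_layers)
  have k0: "king []" by (simp add: king_def rows_ok_def cols_ok_def low_ok_def shape_def)
  show ?thesis using assms
  proof (induction rule: knuth_move.induct)
    case (1 x y z u v)
    have "foldl berele_insert (foldl berele_insert [] u) [y, x, z] = foldl berele_insert (foldl berele_insert [] u) [y, z, x]"
    proof (rule triple_eq[OF kg[OF k0]])
      show "related (shape (foldl berele_insert [] u) 1) (new3 y x z) (new3 y z x)"
        by (rule relatedI1) (use 1 in \<open>auto simp: swapped_def less_code le_code\<close>)
    qed (use 1 in auto)
    then show ?case by (simp add: P\<^sub>C_def)
  next
    case (2 x y z u v)
    have "foldl berele_insert (foldl berele_insert [] u) [z, x, y] = foldl berele_insert (foldl berele_insert [] u) [x, z, y]"
    proof (rule triple_eq[OF kg[OF k0]])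
      show "related (shape (foldl berele_insert [] u) 1) (new3 z x y) (new3 x z y)"
        unfolding related_def by (rule disjI2, intro exI[of _ "New (letter_code y)"] exI[of _ "(New (letter_code z), New (letter_code x))"] exI[of _ "(New (letter_code x), New (letter_code z))"])
          (use 2 in \<open>auto simp: swapped_def less_code le_code\<close>)
    qed (use 2 in auto)
    then show ?case by (simp add: P\<^sub>C_def)
  qed
qed

section \<open>Column words\<close>

abbreviation knuth (infix "\<approx>" 50) where "u \<approx> v \<equiv> knuth_equiv u v"

lemma knuth_refl [simp]: "u \<approx> u" by (simp add: knuth_equiv_def)
lemma knuth_sym: "u \<approx> v \<Longrightarrow> v \<approx> u" unfolding knuth_equiv_def by (rule equivclp_sym)
lemma knuth_trans [trans]: "u \<approx> v \<Longrightarrow> v \<approx> w \<Longrightarrow> u \<approx> w" unfolding knuth_equiv_def by (rule equivclp_trans)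

lemma knuth_move_context: "knuth_move u v \<Longrightarrow> knuth_move (a @ u @ b) (a @ v @ b)"
proof (induction rule: knuth_move.induct)
  case (1 x y z u v)
  then show ?case using knuth_move.intros(1)[of x y z "a @ u" "v @ b"] by simp
next
  case (2 x y z u v)
  then show ?case using knuth_move.intros(2)[of x y z "a @ u" "v @ b"] by simp
qed

lemma knuth_context: "u \<approx> v \<Longrightarrow> a @ u @ b \<approx> a @ v @ b"
  unfolding knuth_equiv_def
proof (induction rule: equivclp_induct)
  case (step y z)
  have "equivclp knuth_move (a @ y @ b) (a @ z @ b)"
    using step(2) knuth_move_context by blast
  then show ?case using step(3) by (meson equivclp_trans)
qed simp

lemma knuth_set: "u \<approx> v \<Longrightarrow> set u = set v"
  unfolding knuth_equiv_def
proof (induction rule: equivclp_induct)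
  case (step y z)
  have "set a = set b" if "knuth_move a b" for a b using that by (induction rule: knuth_move.induct) auto
  then show ?case using step by blast
qed simp

lemma knuth_yxz: "x < y \<Longrightarrow> y \<le> z \<Longrightarrow> [y, x, z] \<approx> [y, z, x]"
  using knuth_move.intros(1)[of x y z "[]" "[]"] unfolding knuth_equiv_def by auto
lemma knuth_xzy: "x \<le> y \<Longrightarrow> y < z \<Longrightarrow> [x, z, y] \<approx> [z, x, y]"
  using knuth_move.intros(2)[of x y z "[]" "[]"] unfolding knuth_equiv_def by auto

lemma row_right: "sorted (b # q) \<Longrightarrow> a < b \<Longrightarrow> b # q @ [a] \<approx> b # a # q"
proof (induction q arbitrary: b)
  case (Cons z q)
  have "z # q @ [a] \<approx> z # a # q" using Cons by auto
  then have "b # z # q @ [a] \<approx> b # z # a # q" using knuth_context[of _ _ "[b]" "[]"] by simp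
  also have "\<dots> \<approx> b # a # z # q"
    using knuth_context[OF knuth_sym[OF knuth_yxz[of a b z]], of "[]" q] Cons.prems by simp
  finally show ?case by simp
qed simp

lemma row_left: "sorted (p @ [a]) \<Longrightarrow> a < b \<Longrightarrow> p @ [b, a] \<approx> b # p @ [a]"
proof (induction p)
  case (Cons x p)
  have IH: "p @ [b, a] \<approx> b # p @ [a]" using Cons by auto
  then have "x # p @ [b, a] \<approx> x # b # p @ [a]" using knuth_context[of _ _ "[x]" "[]"] by simp
  also have "\<dots> \<approx> b # x # p @ [a]"
  proof -
    obtain y r where y: "p @ [a] = y # r" by (cases "p @ [a]") auto
    have "y \<le> a" "x \<le> y" using Cons.prems(1) y by (cases p; force simp: sorted_append)+
    then show ?thesis using knuth_context[OF knuth_xzy[of x y b], of "[]" r] Cons.prems(2) by (simp add: y)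
  qed
  finally show ?case by simp
qed simp

text \<open>Schensted's insertion into one row: \<open>a\<close> travels left over the larger
  letters until it is next to \<open>b\<close>, then \<open>b\<close> travels left over the
  remaining ones and leaves the row.\<close>

lemma row_insert:
  assumes "sorted (p @ b # q)" "\<forall>x\<in>set p. x \<le> a" "a < b"
  shows "p @ b # q @ [a] \<approx> b # p @ a # q"
proof -
  have "b # q @ [a] \<approx> b # a # q" using assms by (intro row_right) (auto simp: sorted_append)
  then have "p @ b # q @ [a] \<approx> p @ b # a # q" using knuth_context[of _ _ p "[]"] by simp
  also have "\<dots> \<approx> b # p @ a # q"
    using knuth_context[OF row_left[of p a b], of "[]" q] assms by (simp add: sorted_append)
  finally show ?thesis .
qed

definition word :: "tableau \<Rightarrow> letter list" where "word T = concat (rev T)"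

lemma word_simps [simp]: "word [] = []" "word (R # T) = word T @ R" "word (T @ T') = word T' @ word T"
  by (simp_all add: word_def)

text \<open>The column is listed from top to bottom, while column words read upwards; hence the
  reversals in the lemmas on words.\<close>

fun add_col :: "tableau \<Rightarrow> letter list \<Rightarrow> tableau" where
  "add_col T [] = T"
| "add_col [] (c # C) = [c] # add_col [] C"
| "add_col (R # T) (c # C) = (R @ [c]) # add_col T C"

fun fits :: "tableau \<Rightarrow> letter list \<Rightarrow> bool" where
  "fits T [] = True"
| "fits [] (c # C) = True"
| "fits (R # T) (c # C) = (sorted (R @ [c]) \<and> fits T C)"

lemma row_column:
  "sorted (R @ [c]) \<Longrightarrow> sorted_wrt (<) (c # C) \<Longrightarrow> R @ rev C @ [c] \<approx> rev C @ R @ [c]"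
proof (induction C arbitrary: c)
  case (Cons d C)
  have Rd: "sorted (R @ [d])" using Cons.prems by (auto simp: sorted_append intro: order_trans less_imp_le)
  have IH: "R @ rev C @ [d] \<approx> rev C @ R @ [d]" using Cons.IH[OF Rd] Cons.prems by simp
  have "R @ rev C @ [d, c] \<approx> rev C @ R @ [d, c]" using knuth_context[OF IH, of "[]" "[c]"] by simp
  also have "\<dots> \<approx> rev C @ d # R @ [c]" using knuth_context[OF row_left[of R c d], of "rev C" "[]"] Cons.prems by simp
  finally show ?case by simp
qed simp

lemma word_add_col_Nil: "word (add_col [] C) = rev C" by (induction C) auto

lemma word_add_col: "sorted_wrt (<) C \<Longrightarrow> fits T C \<Longrightarrow> word T @ rev C \<approx> word (add_col T C)"
proof (induction T C rule: fits.induct)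
  case (3 R T c C)
  have "R @ rev C @ [c] \<approx> rev C @ R @ [c]" using 3 by (intro row_column) auto
  then have "word T @ R @ rev C @ [c] \<approx> word T @ rev C @ R @ [c]" using knuth_context[of _ _ "word T" "[]"] by simp
  also have "\<dots> \<approx> word (add_col T C) @ R @ [c]" using knuth_context[OF 3(1), of "[]" "R @ [c]"] 3(2,3) by simp
  finally show ?case by simp
qed (auto simp: word_add_col_Nil)

text \<open>Schensted insertion of a letter smaller than all others: it bumps the first letter of
  each row in turn and moves the first column down by one.\<close>

fun shift_col :: "letter \<Rightarrow> tableau \<Rightarrow> tableau" where
  "shift_col q [] = [[q]]"
| "shift_col q (R # T) = (q # tl R) # shift_col (hd R) T"

lemma word_shift_col:
  assumes "\<forall>R\<in>set T. sorted R \<and> R \<noteq> []" "sorted_wrt (<) (q # map hd T)"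
  shows "word T @ [q] \<approx> word (shift_col q T)"
  using assms
proof (induction T arbitrary: q)
  case (Cons R T)
  obtain d v where R: "R = d # v" using Cons.prems(1) by (cases R) auto
  have "d # v @ [q] \<approx> d # q # v" using Cons.prems R by (intro row_right) auto
  then have "word T @ d # v @ [q] \<approx> word T @ d # q # v" using knuth_context[of _ _ "word T" "[]"] by simp
  also have "\<dots> \<approx> word (shift_col d T) @ q # v"
    using knuth_context[OF Cons.IH[of d], of "[]" "q # v"] Cons.prems R by simp
  finally show ?case by (simp add: R)
qed simp

lemma word_singles [simp]: "word (map (\<lambda>x. [x]) C) = rev C" by (induction C) auto

lemma fits_singles: "(\<And>m. m < length P \<Longrightarrow> m < length C \<Longrightarrow> P ! m \<le> C ! m) \<Longrightarrow> fits (map (\<lambda>x. [x]) P) C"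
proof (induction P arbitrary: C)
  case Nil
  then show ?case by (cases C) auto
next
  case (Cons x P)
  note IH = this
  show ?case
  proof (cases C)
    case (Cons c D)
    have "x \<le> c" using IH(2)[of 0] Cons by simp
    moreover have "fits (map (\<lambda>x. [x]) P) D" using IH(2)[of "Suc _"] Cons by (intro IH(1)) auto
    ultimately show ?thesis using Cons by simp
  qed simp
qed

lemma shift_add_col: "length q \<le> length Q \<Longrightarrow> shift_col r (add_col (map (\<lambda>x. [x]) Q) q) = add_col (map (\<lambda>x. [x]) (r # Q)) q"
proof (induction Q arbitrary: q r)
  case (Cons d Q)
  note IH = this
  show ?case
  proof (cases q)
    case Nil
    have "shift_col r (map (\<lambda>x. [x]) Q') = map (\<lambda>x. [x]) (r # Q')" for r Q' by (induction Q' arbitrary: r) auto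
    then show ?thesis using Nil by simp
  next
    case (Cons c q')
    then show ?thesis using IH by simp
  qed
qed simp

text \<open>Both words read the tableau with columns \<open>r # Q\<close> and \<open>q\<close>. On
  the left, \<open>r\<close> is inserted into the tableau with columns \<open>Q\<close> and
  \<open>q\<close> and shifts its first column; on the right, \<open>q\<close> is added to the
  column \<open>r # Q\<close>.\<close>

lemma two_columns_insert:
  assumes "sorted_wrt (<) (r # Q)" "sorted_wrt (<) q" "length q \<le> length Q" "\<And>m. m < length q \<Longrightarrow> Q ! m \<le> q ! m"
  shows "rev Q @ rev q @ [r] \<approx> rev Q @ r # rev q"
proof -
  let ?s = "map (\<lambda>x. [x])"
  have f: "fits (?s Q) q" by (rule fits_singles) (use assms(4) in auto)
  have f2: "fits (?s (r # Q)) q"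
  proof (rule fits_singles)
    fix m assume m: "m < length (r # Q)" "m < length q"
    show "(r # Q) ! m \<le> q ! m"
    proof (cases m)
      case 0
      have "r < Q ! 0" using assms(1,3) m 0 by (cases Q) auto
      then show ?thesis using assms(4)[of 0] m 0 by auto
    next
      case (Suc l)
      have "q ! l < q ! m" using sorted_wrt_nth_less[OF assms(2), of l m] m Suc by simp
      then show ?thesis using assms(4)[of l] m Suc by (auto intro: order_trans less_imp_le)
    qed
  qed
  have "rev Q @ rev q @ [r] \<approx> word (add_col (?s Q) q) @ [r]"
    using knuth_context[OF word_add_col[OF assms(2) f], of "[]" "[r]"] by simp
  also have "\<dots> \<approx> word (shift_col r (add_col (?s Q) q))"
  proof (rule word_shift_col)
    have h: "map hd (add_col (?s Q) q) = Q" using assms(3)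
    proof (induction Q arbitrary: q)
      case (Cons d Q)
      then show ?case by (cases q) (auto simp: comp_def)
    qed simp
    show "sorted_wrt (<) (r # map hd (add_col (?s Q) q))" unfolding h by (rule assms(1))
    have "fits (?s Q) q \<Longrightarrow> length q \<le> length Q \<Longrightarrow> \<forall>R\<in>set (add_col (?s Q) q). sorted R \<and> R \<noteq> []" for Q q
    proof (induction Q arbitrary: q)
      case (Cons d Q)
      then show ?case by (cases q) auto
    qed simp
    then show "\<forall>R\<in>set (add_col (?s Q) q). sorted R \<and> R \<noteq> []" using f assms(3) by blast
  qed
  also have "shift_col r (add_col (?s Q) q) = add_col (?s (r # Q)) q" by (rule shift_add_col[OF assms(3)])
  also have "word \<dots> \<approx> word (?s (r # Q)) @ rev q" by (rule knuth_sym[OF word_add_col[OF assms(2) f2]])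
  also have "\<dots> = rev Q @ r # rev q" by simp
  finally show ?thesis .
qed

text \<open>One slide of \<open>r\<close> to the left, with \<open>P\<close>, \<open>p\<close> above
  and \<open>Q\<close>, \<open>q\<close> below the row of the hole. Reading the upper parts together
  by rows as \<open>W\<close> brings both words to \<open>rev Q @ r # rev q @ W\<close>; the lower
  parts are handled by \<open>two_columns_insert\<close>.\<close>

lemma two_columns_slide:
  assumes "length P = length p" "sorted_wrt (<) (p @ r # q)" "sorted_wrt (<) (P @ r # Q)" "length q \<le> length Q"
    and "\<And>m. m < length P \<Longrightarrow> P ! m \<le> p ! m" "\<And>m. m < length q \<Longrightarrow> Q ! m \<le> q ! m"
  shows "rev (P @ Q) @ rev (p @ r # q) \<approx> rev (P @ r # Q) @ rev (p @ q)"
proof -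
  let ?s = "map (\<lambda>x. [x])"
  have split: "add_col (?s (P @ X)) (p @ Y) = add_col (?s P) p @ add_col (?s X) Y" if "length P = length p" for P p X Y
    using that by (induction P p rule: list_induct2) auto
  define W where "W = word (add_col (?s P) p)"
  have "rev P @ rev (p @ r # q) \<approx> word (add_col (?s P) (p @ r # q))"
    using word_add_col[OF assms(2), of "?s P"] fits_singles[of P "p @ r # q"] assms(1,5) by (simp add: nth_append)
  also have "word (add_col (?s P) (p @ r # q)) = rev q @ r # W"
    using split[OF assms(1), of "[]" "r # q"] word_add_col_Nil[of "r # q"] by (simp add: W_def)
  finally have "rev Q @ rev P @ rev (p @ r # q) \<approx> rev Q @ rev q @ r # W" using knuth_context[of _ _ "rev Q" "[]"] by simp
  also have "\<dots> \<approx> rev Q @ r # rev q @ W"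
    using knuth_context[OF two_columns_insert[of r Q q], of "[]" W] assms(2-4,6) by (simp add: sorted_wrt_append)
  finally have 1: "rev (P @ Q) @ rev (p @ r # q) \<approx> rev Q @ r # rev q @ W" by simp
  have pq: "sorted_wrt (<) (p @ q)" using assms(2) by (auto simp: sorted_wrt_append)
  have "fits (?s (P @ [r])) (p @ q)"
  proof (rule fits_singles)
    fix m assume "m < length (P @ [r])" "m < length (p @ q)"
    then show "(P @ [r]) ! m \<le> (p @ q) ! m" using assms(1,2,5) by (cases "m < length P"; cases q) (auto simp: nth_append sorted_wrt_append less_Suc_eq)
  qed
  then have "word (?s (P @ [r])) @ rev (p @ q) \<approx> word (add_col (?s (P @ [r])) (p @ q))" using word_add_col[OF pq] by blast
  also have "\<dots> = word (add_col [[r]] q) @ W" using split[OF assms(1), of "[r]" q] by (simp add: W_def)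
  finally have "rev (P @ r # Q) @ rev (p @ q) \<approx> rev Q @ word (add_col [[r]] q) @ W" using knuth_context[of _ _ "rev Q" "[]"] by simp
  also have "\<dots> \<approx> rev Q @ r # rev q @ W"
  proof (cases q)
    case (Cons c q')
    have *: "rev Q @ rev q' @ [r] \<approx> rev Q @ r # rev q'"
    proof (rule two_columns_insert)
      show "sorted_wrt (<) (r # Q)" "sorted_wrt (<) q'" "length q' \<le> length Q" using assms(2-4) Cons by (auto simp: sorted_wrt_append)
      fix m assume m: "m < length q'"
      have "q ! m < q ! Suc m" using sorted_wrt_nth_less[of "(<)" q m "Suc m"] assms(2) m Cons by (auto simp: sorted_wrt_append)
      moreover have "Q ! m \<le> q ! m" using assms(6)[of m] m Cons by simp
      ultimately show "Q ! m \<le> q' ! m" using Cons by simp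
    qed
    have "word (add_col [[r]] q) = rev q' @ [r, c]" using Cons by (simp add: word_add_col_Nil)
    then show ?thesis using knuth_context[OF *, of "[]" "c # W"] Cons by simp
  qed simp
  finally show ?thesis using 1 knuth_sym knuth_trans by blast
qed

section \<open>Row words and column words of semistandard tableaux\<close>

definition above :: "letter list \<Rightarrow> letter list \<Rightarrow> bool" where
  "above R S \<longleftrightarrow> length S \<le> length R \<and> (\<forall>l<length S. R ! l < S ! l)"

definition ssyt :: "tableau \<Rightarrow> bool" where
  "ssyt T \<longleftrightarrow> (\<forall>R\<in>set T. sorted R \<and> R \<noteq> []) \<and> successively above T"

definition col :: "nat \<Rightarrow> tableau \<Rightarrow> letter list" where
  "col l T = map (\<lambda>R. R ! l) (filter (\<lambda>R. l < length R) T)"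

definition col_word :: "nat \<Rightarrow> tableau \<Rightarrow> letter list" where
  "col_word n T = concat (map (\<lambda>l. rev (col l T)) [0..<n])"

lemma col_simps: "col l [] = []" "col l (R # T) = (if l < length R then R ! l # col l T else col l T)" "col l (T @ T') = col l T @ col l T'"
  by (simp_all add: col_def)

lemma ssyt_Cons: "ssyt (R # T) \<longleftrightarrow> sorted R \<and> R \<noteq> [] \<and> ssyt T \<and> (T = [] \<or> above R (hd T))"
  by (cases T) (auto simp: ssyt_def)

lemma above_trans: "above R S \<Longrightarrow> above S U \<Longrightarrow> above R U"
  unfolding above_def by (meson less_le_trans order.trans less_trans)

lemma ssyt_above_all: "ssyt (R # T) \<Longrightarrow> S \<in> set T \<Longrightarrow> above R S"
proof (induction T arbitrary: R)
  case (Cons U T)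
  have "above R U" "ssyt (U # T)" using Cons.prems by (auto simp: ssyt_Cons)
  then show ?case using Cons above_trans by (cases "S = U") auto
qed simp

lemma ssyt_sorted_col: "ssyt T \<Longrightarrow> sorted_wrt (<) (col l T)"
proof (induction T)
  case (Cons R T)
  have "R ! l < S ! l" if "S \<in> set T" "l < length S" for S using ssyt_above_all[OF Cons.prems that(1)] that(2) by (simp add: above_def)
  then show ?case using Cons by (auto simp: col_simps ssyt_Cons) (auto simp: col_def)
qed (simp add: col_simps)

lemma col_empty: "ssyt (R # T) \<Longrightarrow> length R \<le> l \<Longrightarrow> col l T = []"
  using ssyt_above_all[of R T] by (fastforce simp: col_def above_def filter_empty_conv)

lemma take_add_col: "ssyt T \<Longrightarrow> map (take (Suc n)) T = add_col (map (take n) T) (col n T)"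
proof (induction T)
  case (Cons R T)
  show ?case
  proof (cases "n < length R")
    case True
    then show ?thesis using Cons by (simp add: col_simps take_Suc_conv_app_nth ssyt_Cons)
  next
    case False
    have "col n T = []" using col_empty[OF Cons.prems] False by simp
    moreover have "take n S = take (Suc n) S" if "S \<in> set T" for S
      using ssyt_above_all[OF Cons.prems that] False by (simp add: above_def)
    ultimately show ?thesis using False by (simp add: col_simps)
  qed
qed (simp add: col_simps)

lemma fits_col: "ssyt T \<Longrightarrow> fits (map (take n) T) (col n T)"
proof (induction T)
  case (Cons R T)
  show ?case
  proof (cases "n < length R")
    case True
    then have "take n R @ [R ! n] = take (Suc n) R" by (simp add: take_Suc_conv_app_nth)
    then show ?thesis using Cons True by (simp add: col_simps ssyt_Cons sorted_wrt_take)
  next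
    case False
    have "col n T = []" using col_empty[OF Cons.prems] False by simp
    then show ?thesis using False by (simp add: col_simps)
  qed
qed (simp add: col_simps)

text \<open>The tableau is built column by column: cutting all rows at \<open>Suc n\<close> instead
  of \<open>n\<close> adds column \<open>n\<close>, which is \<open>word_add_col\<close>.\<close>

lemma word_take_col_word: "ssyt T \<Longrightarrow> word (map (take n) T) \<approx> col_word n T"
proof (induction n)
  case 0
  have "word (map (take 0) T) = []" by (induction T) auto
  then show ?case by (simp add: col_word_def)
next
  case (Suc n)
  have "word (map (take (Suc n)) T) \<approx> word (map (take n) T) @ rev (col n T)"
    unfolding take_add_col[OF Suc.prems] using word_add_col[OF ssyt_sorted_col[OF Suc.prems] fits_col[OF Suc.prems]] knuth_sym by blast
  also have "\<dots> \<approx> col_word n T @ rev (col n T)" using knuth_context[OF Suc.IH[OF Suc.prems], of "[]"] by simp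
  also have "\<dots> = col_word (Suc n) T" by (simp add: col_word_def)
  finally show ?case .
qed

lemma word_col_word:
  assumes "ssyt T" "\<And>R. R \<in> set T \<Longrightarrow> length R \<le> n" shows "word T \<approx> col_word n T"
proof -
  have "map (take n) T = T" using assms(2) by (simp add: map_idI)
  then show ?thesis using word_take_col_word[OF assms(1), of n] by simp
qed

lemma ssyt_shift_col:
  assumes "ssyt T" "T = [] \<or> q < hd (hd T)"
  shows "ssyt (shift_col q T)"
  using assms
proof (induction T arbitrary: q)
  case (Cons R T)
  obtain d v where R: "R = d # v" using Cons.prems(1) by (cases R) (auto simp: ssyt_Cons)
  have dT: "T = [] \<or> d < hd (hd T)"
  proof (cases T)
    case (Cons S U)
    then have "above R S" "S \<noteq> []" using Cons.prems(1) by (auto simp: ssyt_Cons)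
    then show ?thesis using R Cons by (cases S) (auto simp: above_def)
  qed simp
  have "ssyt (shift_col d T)" using Cons.IH[OF _ dT] Cons.prems(1) by (simp add: ssyt_Cons)
  moreover have "sorted (q # v)" using Cons.prems R by (auto simp: ssyt_Cons intro: order_trans less_imp_le)
  moreover have "above (q # v) (hd (shift_col d T))"
  proof (cases T)
    case Nil
    then show ?thesis using Cons.prems(2) R by (simp add: above_def)
  next
    case (Cons S U)
    then have "above R S" "S \<noteq> []" using Cons.prems(1) by (auto simp: ssyt_Cons)
    then show ?thesis using Cons.prems(2) R Cons by (cases S) (auto simp: above_def nth_Cons less_Suc_eq_0_disj split: nat.splits)
  qed
  ultimately show ?case using R by (simp add: ssyt_Cons)
qed (simp add: ssyt_Cons ssyt_def)

lemma col_shift_col: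
  assumes "\<forall>R\<in>set T. R \<noteq> []"
  shows "col 0 (shift_col q T) = q # col 0 T" "0 < l \<Longrightarrow> col l (shift_col q T) = col l T"
proof -
  show "col 0 (shift_col q T) = q # col 0 T" using assms
    by (induction T arbitrary: q) (auto simp: col_simps hd_conv_nth)
  show "0 < l \<Longrightarrow> col l (shift_col q T) = col l T" using assms
  proof (induction T arbitrary: q)
    case (Cons R T)
    then show ?case by (cases R) (auto simp: col_simps nth_Cons split: nat.splits)
  qed (simp add: col_simps)
qed

lemma ssyt_append: "ssyt (T @ T') \<longleftrightarrow> ssyt T \<and> ssyt T' \<and> (T = [] \<or> T' = [] \<or> above (last T) (hd T'))"
  by (auto simp: ssyt_def successively_append_iff)

lemma ssyt_nth:
  assumes "ssyt T" "Suc m < length T" "l < length (T ! Suc m)"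
  shows "l < length (T ! m)" "T ! m ! l < T ! Suc m ! l"
  using assms unfolding ssyt_def successively_conv_nth above_def by fastforce+

lemma ssytI:
  assumes "\<forall>R\<in>set T. sorted R \<and> R \<noteq> []" "\<And>m l. Suc m < length T \<Longrightarrow> l < length (T ! Suc m) \<Longrightarrow> l < length (T ! m) \<and> T ! m ! l < T ! Suc m ! l"
  shows "ssyt T"
proof -
  have "above (T ! m) (T ! Suc m)" if "Suc m < length T" for m
  proof -
    have "length (T ! Suc m) \<le> length (T ! m)"
    proof (rule ccontr)
      assume "\<not> ?thesis"
      then show False using assms(2)[OF that, of "length (T ! m)"] by simp
    qed
    then show ?thesis using assms(2)[OF that] by (simp add: above_def)
  qed
  then show ?thesis using assms(1) by (simp add: ssyt_def successively_conv_nth)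
qed

lemma king_ssyt: "king T \<Longrightarrow> ssyt T"
  using below_strict[of T] by (intro ssytI) (auto simp: king_def rows_ok_def cols_ok_def)

section \<open>Column words under jeu de taquin\<close>

definition young :: "tableau \<Rightarrow> bool" where
  "young T \<longleftrightarrow> (\<forall>m l. Suc m < length T \<longrightarrow> l < length (T ! Suc m) \<longrightarrow> l < length (T ! m))"

definition height :: "nat \<Rightarrow> tableau \<Rightarrow> nat" where "height l T = length (col l T)"

lemma young_Cons: "young (R # T) \<longleftrightarrow> young T \<and> (T = [] \<or> length (hd T) \<le> length R)"
proof -
  have "(\<forall>l<length S. l < length R) \<longleftrightarrow> length S \<le> length R" for S R :: "letter list" by (meson leI less_le_trans linorder_not_less order_refl)
  then show ?thesis unfolding young_def by (cases T) (auto simp: nth_Cons split: nat.splits)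
qed

lemma young_all: "young (R # T) \<Longrightarrow> S \<in> set T \<Longrightarrow> length S \<le> length R"
proof (induction T arbitrary: R)
  case (Cons U T)
  then have "length U \<le> length R" "young (U # T)" by (auto simp: young_Cons)
  then show ?case using Cons by (cases "S = U") (auto intro: order_trans)
qed simp

lemma col_nth: "young T \<Longrightarrow> (m < height l T \<longleftrightarrow> m < length T \<and> l < length (T ! m)) \<and> (m < height l T \<longrightarrow> col l T ! m = T ! m ! l)"
proof (induction T arbitrary: m)
  case (Cons R T)
  have s: "young T" using Cons.prems by (simp add: young_Cons)
  show ?case
  proof (cases "l < length R")
    case True
    then show ?thesis using Cons.IH[OF s, of "m - 1"] by (cases m) (auto simp: height_def col_simps)
  next
    case False
    have "filter (\<lambda>R. l < length R) T = []" using young_all[OF Cons.prems] False by (fastforce simp: filter_empty_conv)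
    moreover have "\<not> (m < length (R # T) \<and> l < length ((R # T) ! m))"
      using young_all[OF Cons.prems nth_mem, of "m - 1"] False by (cases m) auto
    ultimately show ?thesis using False by (simp add: height_def col_def)
  qed
qed (simp add: height_def col_simps)

lemma length_set_entry_nth: "length (set_entry T i j a ! m) = length (T ! m)"
  by (cases "i < length T"; cases "m = i") (auto simp: set_entry_def list_update_beyond)

lemma young_set_entry: "young T \<Longrightarrow> young (set_entry T i j a)"
  unfolding young_def by (simp add: length_set_entry_nth)

lemma col_set_entry:
  assumes s: "young T" and i: "i < length T" "j < length (T ! i)"
  shows "col l (set_entry T i j a) = (if l = j then (col l T)[i := a] else col l T)"
proof -
  have s': "young (set_entry T i j a)" by (rule young_set_entry[OF s])
  note len = length_set_entry_nth[of T i j a]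
  have h: "height l (set_entry T i j a) = height l T"
  proof -
    have "m < height l (set_entry T i j a) \<longleftrightarrow> m < height l T" for m using col_nth[OF s, of m l] col_nth[OF s', of m l] len by simp
    then show ?thesis by (meson linorder_neqE_nat less_irrefl)
  qed
  show ?thesis
  proof (rule nth_equalityI)
    show "length (col l (set_entry T i j a)) = length (if l = j then (col l T)[i := a] else col l T)" using h by (simp add: height_def)
    fix m assume "m < length (col l (set_entry T i j a))"
    then have m: "m < height l T" "m < height l (set_entry T i j a)" using h by (simp_all add: height_def)
    have "col l (set_entry T i j a) ! m = set_entry T i j a ! m ! l" using col_nth[OF s', of m l] m by blast
    moreover have "col l T ! m = T ! m ! l" using col_nth[OF s, of m l] m by blast
    ultimately show "col l (set_entry T i j a) ! m = (if l = j then (col l T)[i := a] else col l T) ! m"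
      using m(1) i by (auto simp: set_entry_def nth_list_update height_def)
  qed
qed

text \<open>The entry at the hole \<open>(i, j)\<close> is irrelevant and is left out of the column word.\<close>

definition hole_col :: "nat \<Rightarrow> nat \<Rightarrow> nat \<Rightarrow> tableau \<Rightarrow> letter list" where
  "hole_col i j l T = (if l = j then take i (col l T) @ drop (Suc i) (col l T) else col l T)"

definition hole_word :: "nat \<Rightarrow> nat \<Rightarrow> nat \<Rightarrow> tableau \<Rightarrow> letter list" where
  "hole_word n i j T = concat (map (\<lambda>l. rev (hole_col i j l T)) [0..<n])"

lemma concat_upt_cong:
  assumes "\<And>l. l < n \<Longrightarrow> l \<noteq> j \<Longrightarrow> l \<noteq> Suc j \<Longrightarrow> f l = g l" "Suc j < n" "f j @ f (Suc j) \<approx> g j @ g (Suc j)"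
  shows "concat (map f [0..<n]) \<approx> concat (map g [0..<n])"
proof -
  have u: "[0..<n] = [0..<j] @ [j, Suc j] @ [Suc (Suc j)..<n]"
    using assms(2) by (metis append_Cons append_Nil le_add1 less_imp_add_positive plus_1_eq_Suc upt_add_eq_append upt_conv_Cons Suc_lessD zero_le add.commute)
  have 1: "map f [0..<j] = map g [0..<j]" "map f [Suc (Suc j)..<n] = map g [Suc (Suc j)..<n]" using assms(1,2) by auto
  show ?thesis unfolding u map_append concat_append 1 using knuth_context[OF assms(3), of "concat (map g [0..<j])" "concat (map g [Suc (Suc j)..<n])"] by simp
qed

text \<open>Equality with the entry above is allowed at the hole, because a letter that has just
  slid up is still stored in the box it came from.\<close>

definition hole_ok :: "tableau \<Rightarrow> nat \<Rightarrow> nat \<Rightarrow> bool" where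
  "hole_ok T i j \<longleftrightarrow> rows_ok T \<and> young T \<and> i < length T \<and> j < length (T ! i) \<and>
    (\<forall>m l. Suc m < length T \<longrightarrow> l < length (T ! Suc m) \<longrightarrow> T ! m ! l < T ! Suc m ! l \<or> Suc m = i \<and> l = j \<and> T ! m ! l \<le> T ! Suc m ! l)"

lemma hole_okD:
  assumes "hole_ok T i j" "Suc m < length T" "l < length (T ! Suc m)"
  shows "l < length (T ! m)" "T ! m ! l \<le> T ! Suc m ! l" "\<not> (Suc m = i \<and> l = j) \<Longrightarrow> T ! m ! l < T ! Suc m ! l"
proof -
  show "l < length (T ! m)" using assms unfolding hole_ok_def young_def by blast
  have *: "T ! m ! l < T ! Suc m ! l \<or> Suc m = i \<and> l = j \<and> T ! m ! l \<le> T ! Suc m ! l" using assms unfolding hole_ok_def by blast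
  show "T ! m ! l \<le> T ! Suc m ! l" using * by auto
  show "\<not> (Suc m = i \<and> l = j) \<Longrightarrow> T ! m ! l < T ! Suc m ! l" using * by blast
qed

lemma col_delete_corner:
  assumes s: "young T" and i: "i < length T" "j < length (T ! i)" and e: "entry T (Suc i) j = None" "entry T i (Suc j) = None"
  shows "col l (delete_corner T i j) = hole_col i j l T"
proof -
  let ?T = "T[i := take j (T ! i)]"
  have jl: "length (T ! i) = Suc j" using e(2) i by (auto simp: entry_def split: if_splits)
  have d: "length (T ! Suc i) \<le> j" if "Suc i < length T" using e(1) that by (auto simp: entry_def split: if_splits)
  have len: "length (?T ! m) = (if m = i then j else length (T ! m))" for m using jl i by (auto simp: nth_list_update)
  have s': "young ?T" using s d jl unfolding young_def len by (auto split: if_splits)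
  have f: "col l (delete_corner T i j) = col l ?T"
    unfolding delete_corner_def col_def filter_filter by (rule arg_cong[where f = "map _"], rule filter_cong) auto
  have hj: "height j T = Suc i"
    using col_nth[OF s, of i j] col_nth[OF s, of "Suc i" j] i d by (metis linorder_neqE_nat not_less not_less_eq)
  have h: "m < height l ?T \<longleftrightarrow> m < height l T \<and> \<not> (m = i \<and> l = j)" for m
    using col_nth[OF s, of m l] col_nth[OF s', of m l] jl by (auto simp: len split: if_splits)
  have v: "col l ?T ! m = col l T ! m" if "m < height l ?T" for m
  proof -
    have "col l ?T ! m = ?T ! m ! l" "col l T ! m = T ! m ! l" "m < length T" "l < length (?T ! m)"
      using col_nth[OF s, of m l] col_nth[OF s', of m l] that h[of m] by auto
    then show ?thesis by (cases "m = i") (auto simp: nth_list_update)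
  qed
  show ?thesis
  proof (cases "l = j")
    case True
    have h': "height l ?T = i"
    proof -
      have "m < height l ?T \<longleftrightarrow> m < i" for m using h[of m] hj True by auto
      then show ?thesis by (meson linorder_neqE_nat less_irrefl)
    qed
    have "col l ?T = take i (col l T)"
      using h' hj True v by (intro nth_equalityI) (auto simp: height_def)
    moreover have "drop (Suc i) (col l T) = []" using hj True by (simp add: height_def)
    ultimately show ?thesis using f True by (simp add: hole_col_def)
  next
    case False
    have "height l ?T = height l T"
    proof -
      have "m < height l ?T \<longleftrightarrow> m < height l T" for m using h[of m] False by auto
      then show ?thesis by (meson linorder_neqE_nat less_irrefl)
    qed
    then have "col l ?T = col l T" using v by (intro nth_equalityI) (auto simp: height_def)
    then show ?thesis using f False by (simp add: hole_col_def)
  qed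
qed

lemma sorted_wrt_successive: "(\<And>m. Suc m < length xs \<Longrightarrow> xs ! m < xs ! Suc m) \<Longrightarrow> sorted_wrt (<) (xs :: letter list)"
  by (subst successively_conv_sorted_wrt[symmetric]) (auto simp: transp_on_def successively_conv_nth)

text \<open>A slide upwards stays within its column and leaves the word literally unchanged, the
  hole being skipped. A slide to the left changes only the two columns involved, by
  \<open>two_columns_slide\<close>.\<close>

lemma hole_word_jdt:
  assumes "hole_ok T i j" "\<And>R. R \<in> set T \<Longrightarrow> length R \<le> n"
  shows "hole_word n i j T \<approx> col_word n (jeu_de_taquin T i j)"
  using assms
proof (induction T i j rule: jdt_induct)
  case (corner T i j)
  then have "young T" "i < length T" "j < length (T ! i)" by (auto simp: hole_ok_def)
  then show ?case using col_delete_corner[OF _ _ _ corner(1,2)] by (simp add: hole_word_def col_word_def)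
next
  case (down T i j b T')
  note h = down(4)
  have r: "rows_ok T" and s: "young T" and i: "i < length T" "j < length (T ! i)" using h by (auto simp: hole_ok_def)
  have b: "Suc i < length T" "j < length (T ! Suc i)" "b = T ! Suc i ! j" using down(1) by (auto simp: entry_def split: if_splits)
  have lt: "T ! i ! j < b" using hole_okD(3)[OF h b(1,2)] b(3) by simp
  let ?T = "set_entry T i j b"
  have hT: "hole_ok ?T (Suc i) j" unfolding hole_ok_def
  proof (intro conjI allI impI)
    show "rows_ok ?T"
    proof (rule rows_ok_set_entry[OF r i])
      show "T ! i ! k \<le> b" if "k < j" for k using row_sorted_nth[OF r i(1), of k j] that i lt by auto
      show "b \<le> T ! i ! Suc j" if "Suc j < length (T ! i)" using down(2) that i by (simp add: entry_def)
    qed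
    show "young ?T" by (rule young_set_entry[OF s])
    show "Suc i < length ?T" "j < length (?T ! Suc i)" using b by (simp_all add: length_set_entry_nth)
    fix m l assume "Suc m < length ?T" "l < length (?T ! Suc m)"
    then have m: "Suc m < length T" "l < length (T ! Suc m)" by (simp_all add: length_set_entry_nth)
    note hd = hole_okD[OF h m]
    have v: "?T ! k ! l = (if k = i \<and> l = j then b else T ! k ! l)" for k using i by (auto simp: set_entry_def nth_list_update)
    show "?T ! m ! l < ?T ! Suc m ! l \<or> Suc m = Suc i \<and> l = j \<and> ?T ! m ! l \<le> ?T ! Suc m ! l"
      using hd lt b(3) unfolding v by (cases "Suc m = i \<and> l = j"; cases "m = i \<and> l = j") auto
  qed
  have n: "R \<in> set ?T \<Longrightarrow> length R \<le> n" for R using down(5) by (metis in_set_conv_nth length_set_entry length_set_entry_nth nth_mem)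
  have "hole_col i j l T = hole_col (Suc i) j l ?T" for l
  proof (cases "l = j")
    case True
    have c: "Suc i < length (col j T)" "col j T ! Suc i = b" using col_nth[OF s, of "Suc i" j] b by (auto simp: height_def)
    have "take (Suc i) ((col j T)[i := b]) @ drop (Suc (Suc i)) ((col j T)[i := b]) = take i (col j T) @ drop (Suc i) (col j T)"
      using c by (simp add: take_Suc_conv_app_nth Cons_nth_drop_Suc[symmetric])
    then show ?thesis using True col_set_entry[OF s i, of j b] by (simp add: hole_col_def)
  next
    case False
    then show ?thesis using col_set_entry[OF s i, of l b] by (simp add: hole_col_def)
  qed
  then have "hole_word n i j T = hole_word n (Suc i) j ?T" by (simp add: hole_word_def)
  then show ?case using down(3)[OF hT n] by simp
next
  case (right T i j r T')
  note h = right(4)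
  have ro: "rows_ok T" and s: "young T" and i: "i < length T" "j < length (T ! i)" using h by (auto simp: hole_ok_def)
  have b: "Suc j < length (T ! i)" "r = T ! i ! Suc j" using right(1) by (auto simp: entry_def split: if_splits)
  let ?T = "set_entry T i j r"
  have up: "T ! m ! j < r" if "Suc m = i" for m
  proof -
    have m: "Suc m < length T" "Suc j < length (T ! Suc m)" using i b that by auto
    have "T ! m ! j \<le> T ! m ! Suc j" using row_sorted_nth[OF ro, of m j "Suc j"] hole_okD(1)[OF h m] m(1) by simp
    also have "\<dots> < r" using hole_okD(3)[OF h m] that b by simp
    finally show ?thesis .
  qed
  have dn: "r < T ! Suc i ! j" if "Suc i < length T" "j < length (T ! Suc i)" using right(2) that by (simp add: entry_def)
  have hT: "hole_ok ?T i (Suc j)" unfolding hole_ok_def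
  proof (intro conjI allI impI)
    show "rows_ok ?T"
    proof (rule rows_ok_set_entry[OF ro i])
      show "T ! i ! k \<le> r" if "k < j" for k using row_sorted_nth[OF ro i(1), of k "Suc j"] that b by auto
      show "r \<le> T ! i ! Suc j" if "Suc j < length (T ! i)" using b by simp
    qed
    show "young ?T" by (rule young_set_entry[OF s])
    show "i < length ?T" "Suc j < length (?T ! i)" using i b by (simp_all add: length_set_entry_nth)
    fix m l assume "Suc m < length ?T" "l < length (?T ! Suc m)"
    then have m: "Suc m < length T" "l < length (T ! Suc m)" by (simp_all add: length_set_entry_nth)
    note hd = hole_okD[OF h m]
    have v: "?T ! k ! l = (if k = i \<and> l = j then r else T ! k ! l)" for k using i by (auto simp: set_entry_def nth_list_update)
    show "?T ! m ! l < ?T ! Suc m ! l \<or> Suc m = i \<and> l = Suc j \<and> ?T ! m ! l \<le> ?T ! Suc m ! l"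
      using hd up dn m unfolding v by (cases "Suc m = i \<and> l = j"; cases "m = i \<and> l = j") auto
  qed
  have n: "R \<in> set ?T \<Longrightarrow> length R \<le> n" for R using right(5) by (metis in_set_conv_nth length_set_entry length_set_entry_nth nth_mem)
  define c where "c = col j T"
  define d where "d = col (Suc j) T"
  have cn: "m < length c \<longleftrightarrow> m < length T \<and> j < length (T ! m)" "m < length c \<Longrightarrow> c ! m = T ! m ! j" for m
    using col_nth[OF s, of m j] by (auto simp: c_def height_def)
  have dn': "m < length d \<longleftrightarrow> m < length T \<and> Suc j < length (T ! m)" "m < length d \<Longrightarrow> d ! m = T ! m ! Suc j" for m
    using col_nth[OF s, of m "Suc j"] by (auto simp: d_def height_def)
  have dc: "length d \<le> length c" using cn(1)[of "length c"] dn'(1)[of "length c"] by auto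
  have id: "i < length d" "d ! i = r" using dn'[of i] i b by auto
  have ic: "i < length c" using id dc by simp
  have cd: "c ! m \<le> d ! m" if "m < length d" for m
    using that dc cn(2)[of m] dn'[of m] row_sorted_nth[OF ro, of m j "Suc j"] by auto
  have sd: "sorted_wrt (<) d"
  proof (rule sorted_wrt_successive)
    fix m assume "Suc m < length d"
    then show "d ! m < d ! Suc m" using dn'[of m] dn'[of "Suc m"] hole_okD(3)[OF h, of m "Suc j"] by simp
  qed
  have sc: "sorted_wrt (<) (c[i := r])"
  proof (rule sorted_wrt_successive)
    fix m assume m: "Suc m < length (c[i := r])"
    then have "Suc m < length T" "j < length (T ! Suc m)" using cn(1)[of "Suc m"] by auto
    then show "c[i := r] ! m < c[i := r] ! Suc m" using m cn(2)[of m] cn(2)[of "Suc m"] hole_okD(3)[OF h, of m j] up[of m] dn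
      by (cases "Suc m = i"; cases "m = i") (simp_all add: nth_list_update)
  qed
  have split: "d = take i d @ r # drop (Suc i) d" "c[i := r] = take i c @ r # drop (Suc i) c"
    using id id_take_nth_drop[OF id(1)] upd_conv_take_nth_drop[OF ic, of r] by auto
  have "rev (take i c @ drop (Suc i) c) @ rev (take i d @ r # drop (Suc i) d) \<approx> rev (take i c @ r # drop (Suc i) c) @ rev (take i d @ drop (Suc i) d)"
  proof (rule two_columns_slide)
    show "sorted_wrt (<) (take i d @ r # drop (Suc i) d)" using sd split(1) by simp
    show "sorted_wrt (<) (take i c @ r # drop (Suc i) c)" using sc split(2) by simp
    show "take i c ! m \<le> take i d ! m" if "m < length (take i c)" for m using cd[of m] that id by simp
    show "drop (Suc i) c ! m \<le> drop (Suc i) d ! m" if "m < length (drop (Suc i) d)" for m using cd[of "Suc i + m"] that id dc by simp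
  qed (use id ic dc in auto)
  moreover have "hole_col i j j T = take i c @ drop (Suc i) c" by (simp add: hole_col_def c_def)
  moreover have "hole_col i j (Suc j) T = take i d @ r # drop (Suc i) d" using split(1) by (simp add: hole_col_def d_def)
  moreover have "hole_col i (Suc j) j ?T = take i c @ r # drop (Suc i) c"
    using split(2) col_set_entry[OF s i, of j r] by (simp add: hole_col_def c_def)
  moreover have "hole_col i (Suc j) (Suc j) ?T = take i d @ drop (Suc i) d"
    using col_set_entry[OF s i, of "Suc j" r] by (simp add: hole_col_def d_def)
  ultimately have key: "rev (hole_col i j j T) @ rev (hole_col i j (Suc j) T) \<approx> rev (hole_col i (Suc j) j ?T) @ rev (hole_col i (Suc j) (Suc j) ?T)"
    by (simp only:)
  have "hole_word n i j T \<approx> hole_word n i (Suc j) ?T" unfolding hole_word_def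
  proof (rule concat_upt_cong[OF _ _ key])
    show "Suc j < n" using b right(5)[OF nth_mem[OF i(1)]] by simp
    show "rev (hole_col i j l T) = rev (hole_col i (Suc j) l ?T)" if "l < n" "l \<noteq> j" "l \<noteq> Suc j" for l
      using that col_set_entry[OF s i, of l r] by (simp add: hole_col_def)
  qed
  then show ?case using right(3)[OF hT n] knuth_trans by blast
qed

section \<open>Berele insertion of column words\<close>

abbreviation "singles \<equiv> map (\<lambda>x :: letter. [x])"

text \<open>The bound is stated for the rows in which the letters end up, one below those in which
  \<open>c\<close> stands before; it keeps the bar that would cause the exception out of each
  row.\<close>

lemma insert_column:
  assumes "sorted_wrt (<) (a # c)" "\<And>m. m < length (a # c) \<Longrightarrow> 2 * (length u + m) + 2 \<le> letter_code ((a # c) ! m)"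
  shows "insert_from (length u) a (singles (u @ c)) = singles (u @ a # c)"
  using assms
proof (induction c arbitrary: a u)
  case Nil
  then show ?case by (subst insert_from.simps) simp
next
  case (Cons b c)
  have ab: "a < b" using Cons.prems(1) by simp
  have row: "singles (u @ b # c) ! length u = [b]" by (simp add: nth_append)
  have ne: "Barred (Suc (length u)) \<noteq> b" using Cons.prems(2)[of 1] by auto
  have fi: "first_index (\<lambda>x. a < x) [b] = 0" using ab by (simp add: first_index_def)
  have up: "set_entry (singles (u @ b # c)) (length u) 0 a = singles ((u @ [a]) @ c)"
    by (simp add: set_entry_def nth_append list_update_append)
  have "insert_from (length u) a (singles (u @ b # c)) = insert_from (length (u @ [a])) b (singles ((u @ [a]) @ c))"
    using ab ne fi up row by (subst insert_from.simps) (simp add: Let_def)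
  also have "\<dots> = singles ((u @ [a]) @ b # c)"
  proof (rule Cons.IH)
    show "sorted_wrt (<) (b # c)" using Cons.prems(1) by simp
    fix m assume "m < length (b # c)"
    then show "2 * (length (u @ [a]) + m) + 2 \<le> letter_code ((b # c) ! m)" using Cons.prems(2)[of "Suc m"] by simp
  qed
  finally show ?case by simp
qed

lemma P_column:
  assumes "sorted_wrt (<) c" "\<And>m. m < length c \<Longrightarrow> 2 * m + 2 \<le> letter_code (c ! m)"
  shows "P\<^sub>C (rev c) = singles c"
  using assms
proof (induction c)
  case (Cons a c)
  have "P\<^sub>C (rev c) = singles c"
  proof (rule Cons.IH)
    fix m assume "m < length c"
    then show "2 * m + 2 \<le> letter_code (c ! m)" using Cons.prems(2)[of "Suc m"] by simp
  qed (use Cons.prems in simp)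
  then show ?case using insert_column[of a c "[]"] Cons.prems by (simp add: P\<^sub>C_def berele_insert_def)
qed (simp add: P\<^sub>C_def)

lemma jdt_column: "jeu_de_taquin (singles (y @ e # d)) (length y) 0 = singles (y @ d)"
proof (induction d arbitrary: y e)
  case Nil
  have "filter (\<lambda>row. row \<noteq> []) (singles y) = singles y" by (simp add: filter_id_conv)
  then show ?case by (subst jeu_de_taquin.simps) (simp add: entry_def delete_corner_def nth_append list_update_append)
next
  case (Cons b d)
  have "jeu_de_taquin (singles (y @ e # b # d)) (length y) 0 = jeu_de_taquin (singles ((y @ [b]) @ b # d)) (length (y @ [b])) 0"
    by (subst jeu_de_taquin.simps) (simp add: entry_def set_entry_def nth_append list_update_append)
  also have "\<dots> = singles ((y @ [b]) @ d)" by (rule Cons.IH)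
  finally show ?case by simp
qed

text \<open>The letters bump one another downwards until the plain letter reaches the row of index
  \<open>length y + length u\<close>, whose only entry is its bar. Both disappear, and the rest
  \<open>d\<close> of the column slides up.\<close>

lemma insert_column_exception:
  assumes "a # c = u @ Plain (Suc (length y + length u)) # Barred (Suc (length y + length u)) # d"
    and "sorted_wrt (<) (a # c)" "\<And>m. m < length u \<Longrightarrow> 2 * (length y + m) + 2 \<le> letter_code (u ! m)"
  shows "insert_from (length y) a (singles (y @ c)) = singles (y @ u @ d)"
  using assms
proof (induction u arbitrary: a c y)
  case Nil
  then have a: "a = Plain (Suc (length y))" and c: "c = Barred (Suc (length y)) # d" by auto
  have row: "singles (y @ c) ! length y = [Barred (Suc (length y))]" by (simp add: nth_append c)
  have "insert_from (length y) a (singles (y @ c)) = jeu_de_taquin (singles (y @ a # d)) (length y) 0"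
    unfolding a using row by (subst insert_from.simps) (simp add: Let_def first_index_def c list_update_append)
  then show ?case using jdt_column by simp
next
  case (Cons a' u)
  then have a: "a' = a" and c: "c = u @ Plain (Suc (length y + Suc (length u))) # Barred (Suc (length y + Suc (length u))) # d" by auto
  have "c \<noteq> []" using c by simp
  then obtain b c' where b: "c = b # c'" by (meson neq_Nil_conv)
  have ab: "a < b" using Cons.prems(2) b by simp
  have row: "singles (y @ c) ! length y = [b]" by (simp add: nth_append b)
  have ne: "Barred (Suc (length y)) \<noteq> b"
  proof (cases u)
    case Nil
    then show ?thesis using b c by auto
  next
    case (Cons z u')
    then show ?thesis using Cons.prems(3)[of 1] b c by auto
  qed
  have fi: "first_index (\<lambda>x. a < x) [b] = 0" using ab by (simp add: first_index_def)
  have up: "set_entry (singles (y @ c)) (length y) 0 a = singles ((y @ [a]) @ c')"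
    by (simp add: set_entry_def nth_append list_update_append b)
  have "insert_from (length y) a (singles (y @ c)) = insert_from (length (y @ [a])) b (singles ((y @ [a]) @ c'))"
    using ab ne fi up row by (subst insert_from.simps) (simp add: Let_def b)
  also have "\<dots> = singles ((y @ [a]) @ u @ d)"
  proof (rule Cons.IH)
    show "b # c' = u @ Plain (Suc (length (y @ [a]) + length u)) # Barred (Suc (length (y @ [a]) + length u)) # d" using b c by simp
    show "sorted_wrt (<) (b # c')" using Cons.prems(2) b by simp
    fix m assume "m < length u"
    then show "2 * (length (y @ [a]) + m) + 2 \<le> letter_code (u ! m)" using Cons.prems(3)[of "Suc m"] by simp
  qed
  finally show ?case using a by simp
qed

text \<open>Without its smallest letter, which the word inserts last, \<open>c\<close> is a King
  column; that letter then sets off the exception. The bounds on \<open>u\<close> and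
  \<open>d\<close> say that \<open>u @ d\<close> is a King column, so it is its own
  insertion.\<close>

lemma P_column_exception:
  assumes c: "c = u @ Plain (Suc (length u)) # Barred (Suc (length u)) # d" "sorted_wrt (<) c"
    and u: "\<And>m. m < length u \<Longrightarrow> 2 * m + 2 \<le> letter_code (u ! m)"
    and d: "\<And>m. m < length d \<Longrightarrow> 2 * (Suc (length u) + m) + 2 \<le> letter_code (d ! m)"
  shows "P\<^sub>C (rev c) = P\<^sub>C (rev (u @ d))"
proof -
  have "c \<noteq> []" using c by simp
  then obtain a c' where a: "c = a # c'" by (meson neq_Nil_conv)
  have "P\<^sub>C (rev c') = singles c'"
  proof (rule P_column)
    show "sorted_wrt (<) c'" using c(2) unfolding a by simp
    fix m assume m: "m < length c'"
    have eq: "c' ! m = c ! Suc m" using a by simp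
    consider "Suc m < length u" | "Suc m = length u" | "m = length u" | k where "m = Suc (length u) + k"
      by (metis add.commute less_imp_add_positive linorder_neqE_nat not_less_eq add_Suc Suc_leI le_add_diff_inverse)
    then show "2 * m + 2 \<le> letter_code (c' ! m)"
    proof cases
      case 4
      then have "k < length d" using m arg_cong[OF c(1), of length] a by simp
      then show ?thesis using d[of k] 4 eq c(1) by (simp add: nth_append)
    qed (use u[of "Suc m"] c(1) eq in \<open>auto simp: nth_append\<close>)
  qed
  moreover have "insert_from 0 a (singles c') = singles (u @ d)"
    using insert_column_exception[of a c' u "[]" d] c a u by simp
  ultimately have "P\<^sub>C (rev c) = singles (u @ d)" using a by (simp add: P\<^sub>C_def berele_insert_def)
  also have "\<dots> = P\<^sub>C (rev (u @ d))"
  proof (rule P_column[symmetric])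
    show "sorted_wrt (<) (u @ d)" using c by (simp add: sorted_wrt_append)
    fix m assume m: "m < length (u @ d)"
    show "2 * m + 2 \<le> letter_code ((u @ d) ! m)"
    proof (cases "m < length u")
      case True
      then show ?thesis using u by (simp add: nth_append)
    next
      case False
      then have "m - length u < length d" using m by simp
      then show ?thesis using d[of "m - length u"] False by (simp add: nth_append)
    qed
  qed
  finally show ?thesis .
qed

section \<open>Insertion and type C equivalence\<close>

lemma typeC_refl: "typeC_equiv k w w" by (simp add: typeC_equiv_def)
lemma typeC_trans [trans]: "typeC_equiv k u v \<Longrightarrow> typeC_equiv k v w \<Longrightarrow> typeC_equiv k u w" by (simp add: typeC_equiv_def)

lemma words_iff: "w \<in> words k \<longleftrightarrow> set w \<subseteq> letters k" by (auto simp: words_def)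

lemma typeC_step_sym: "typeC_step k u v \<Longrightarrow> typeC_step k v u"
  unfolding typeC_step_def equiv5_def by (auto, metis+)

lemma typeC_sym: "typeC_equiv k u v \<Longrightarrow> typeC_equiv k v u"
  unfolding typeC_equiv_def using typeC_step_sym by (metis sympI symp_rtranclp sympD)

lemma knuth_typeC: "u \<approx> v \<Longrightarrow> u \<in> words k \<Longrightarrow> typeC_equiv k u v"
  unfolding knuth_equiv_def
proof (induction rule: equivclp_induct)
  case (step y z)
  have "set y = set u" "set z = set u"
    using knuth_set[of u y] knuth_set[of u z] step(1,2) unfolding knuth_equiv_def by (auto intro: equivclp_into_equivclp)
  then have "typeC_step k y z" using step(2,4) by (auto simp: typeC_step_def words_iff)
  then show ?case using step(3)[OF step(4)] unfolding typeC_equiv_def by simp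
qed (simp add: typeC_refl)

lemma typeC_append:
  assumes "typeC_equiv k u v" "x \<in> words k" shows "typeC_equiv k (u @ x) (v @ x)"
  using assms(1) unfolding typeC_equiv_def
proof (induction rule: rtranclp_induct)
  case (step y z)
  have "typeC_step k (y @ x) (z @ x)"
    using step(2) unfolding typeC_step_def
  proof (elim conjE disjE)
    assume y: "y \<in> words k" "z \<in> words k" and "equiv5 k y z"
    then obtain v c c' where e: "v \<in> words k" "c \<in> column_words k" "c' \<in> column_words k" "y \<approx> c @ v" "z \<approx> c' @ v" "P\<^sub>C c = P\<^sub>C c'"
      unfolding equiv5_def by blast
    have "equiv5 k (y @ x) (z @ x)" unfolding equiv5_def
      using e assms(2) knuth_context[OF e(4), of "[]" x] knuth_context[OF e(5), of "[]" x]
      by (intro bexI[of _ "v @ x"] bexI[of _ c] bexI[of _ c']) (auto simp: words_iff)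
    then show "y @ x \<in> words k \<and> z @ x \<in> words k \<and> (knuth_move (y @ x) (z @ x) \<or> knuth_move (z @ x) (y @ x) \<or> equiv5 k (y @ x) (z @ x))"
      using y assms(2) by (auto simp: words_iff)
  qed (use assms(2) knuth_move_context[of _ _ "[]" x] in \<open>auto simp: words_iff\<close>)
  then show ?case using step(3) by simp
qed simp

lemma letters_code: "x \<in> letters k \<Longrightarrow> 2 \<le> letter_code x"
  by (auto simp: letters_def)

lemma knuth_P: "u \<approx> v \<Longrightarrow> set u \<subseteq> letters k \<Longrightarrow> P\<^sub>C u = P\<^sub>C v"
  unfolding knuth_equiv_def
proof (induction rule: equivclp_induct)
  case (step y z)
  have "set y = set u" "set z = set u"
    using knuth_set[of u y] knuth_set[of u z] step(1,2) unfolding knuth_equiv_def by (auto intro: equivclp_into_equivclp)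
  then have "P\<^sub>C y = P\<^sub>C z" using step(2,4) knuth_move_berele[of y z] knuth_move_berele[of z y] letters_code by fastforce
  then show ?case using step by simp
qed simp

lemma typeC_P: "typeC_equiv k u v \<Longrightarrow> P\<^sub>C u = P\<^sub>C v"
  unfolding typeC_equiv_def
proof (induction rule: rtranclp_induct)
  case (step y z)
  have "P\<^sub>C y = P\<^sub>C z" using step(2) unfolding typeC_step_def
  proof (elim conjE disjE)
    assume y: "y \<in> words k" "z \<in> words k"
    have cd: "\<forall>x\<in>set y. 2 \<le> letter_code x" "\<forall>x\<in>set z. 2 \<le> letter_code x" using y letters_code by (auto simp: words_iff)
    { assume "knuth_move y z" then show ?thesis using knuth_move_berele cd by blast }
    { assume "knuth_move z y" then show ?thesis using knuth_move_berele[of z y] cd by simp }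
    assume "equiv5 k y z"
    then obtain v c c' where e: "y \<approx> c @ v" "z \<approx> c' @ v" "P\<^sub>C c = P\<^sub>C c'"
      unfolding equiv5_def by blast
    have "P\<^sub>C y = P\<^sub>C (c @ v)" "P\<^sub>C z = P\<^sub>C (c' @ v)" using knuth_P[OF e(1), of k] knuth_P[OF e(2), of k] y by (auto simp: words_iff)
    then show ?thesis using e(3) by (simp add: P\<^sub>C_def)
  qed
  then show ?case using step by simp
qed simp

text \<open>\<open>l\<close> is the column of the row above from which \<open>a\<close> has been
  bumped. It guarantees that \<open>a\<close> lands in column \<open>l\<close> or further left,
  below a smaller letter.\<close>

definition insertable :: "nat \<Rightarrow> letter \<Rightarrow> tableau \<Rightarrow> bool" where
  "insertable i a T \<longleftrightarrow> i = 0 \<or> (\<exists>l<length (T ! (i - 1)). T ! (i - 1) ! l < a \<and> (i < length T \<longrightarrow> l < length (T ! i) \<longrightarrow> a < T ! i ! l))"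

definition low_entries :: "tableau \<Rightarrow> bool" where
  "low_entries T \<longleftrightarrow> (\<forall>m l. m < length T \<longrightarrow> l < length (T ! m) \<longrightarrow> 2 * m + 2 \<le> letter_code (T ! m ! l))"

lemma ssyt_young: "ssyt T \<Longrightarrow> young T"
  unfolding young_def using ssyt_nth by blast

lemma ssyt_rows: "ssyt T \<Longrightarrow> rows_ok T" by (simp add: ssyt_def rows_ok_def)

text \<open>In the words, the letter in transit stands between the rows still to be visited and the
  rows already finished. One bump is \<open>row_insert\<close> carried out in this place.\<close>

lemma ssyt_bump:
  assumes s: "ssyt T" and l: "low_entries T" and i: "i < length T" and ins: "insertable i a T" and ca: "2 * i + 2 \<le> letter_code a"
    and jj: "j < length (T ! i)" "a < T ! i ! j" "\<And>k. k < j \<Longrightarrow> T ! i ! k \<le> a"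
  shows "ssyt (set_entry T i j a)" "low_entries (set_entry T i j a)" "insertable (Suc i) (T ! i ! j) (set_entry T i j a)"
    "word (drop i T) @ [a] @ word (take i T) \<approx> word (drop (Suc i) T) @ [T ! i ! j] @ word (take (Suc i) (set_entry T i j a))"
proof -
  let ?T = "set_entry T i j a"
  have ro: "rows_ok T" by (rule ssyt_rows[OF s])
  have v: "?T ! k ! l = (if k = i \<and> l = j then a else T ! k ! l)" for k l using i jj(1) by (auto simp: set_entry_def nth_list_update)
  have ro': "rows_ok ?T"
  proof (rule rows_ok_set_entry[OF ro i jj(1) jj(3)])
    show "a \<le> T ! i ! Suc j" if "Suc j < length (T ! i)" using row_sorted_nth[OF ro i, of j "Suc j"] that jj(2) by simp
  qed
  have up: "T ! m ! j < a" if m: "Suc m = i" for m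
  proof -
    obtain l where l: "l < length (T ! m)" "T ! m ! l < a" "l < length (T ! i) \<longrightarrow> a < T ! i ! l" using ins m i by (auto simp: insertable_def)
    have "j \<le> l"
    proof (rule ccontr)
      assume "\<not> j \<le> l"
      then show False using jj(3)[of l] l(3) jj(1) by auto
    qed
    then have "T ! m ! j \<le> T ! m ! l" using row_sorted_nth[OF ro, of m j l] l(1) m i by simp
    then show ?thesis using l(2) by simp
  qed
  show s': "ssyt ?T"
  proof (rule ssytI)
    show "\<forall>R\<in>set ?T. sorted R \<and> R \<noteq> []" using ro' by (simp add: rows_ok_def)
    fix m l assume "Suc m < length ?T" "l < length (?T ! Suc m)"
    then have m: "Suc m < length T" "l < length (T ! Suc m)" by (simp_all add: length_set_entry_nth)
    have "T ! m ! l < T ! Suc m ! l" "l < length (T ! m)" using ssyt_nth[OF s m] by auto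
    then show "l < length (?T ! m) \<and> ?T ! m ! l < ?T ! Suc m ! l"
      unfolding v length_set_entry_nth using up[of m] jj(2) by (auto intro: less_trans)
  qed
  show "low_entries ?T" using l ca unfolding low_entries_def v length_set_entry_nth by auto
  show "insertable (Suc i) (T ! i ! j) ?T"
    unfolding insertable_def using jj(1,2) ssyt_nth(2)[OF s, of i j] by (auto simp: v length_set_entry_nth intro!: exI[of _ j])
  have row: "T ! i = take j (T ! i) @ (T ! i ! j) # drop (Suc j) (T ! i)" by (rule id_take_nth_drop[OF jj(1)])
  have R': "?T ! i = take j (T ! i) @ a # drop (Suc j) (T ! i)" using i upd_conv_take_nth_drop[OF jj(1), of a] by (simp add: set_entry_def)
  have "take j (T ! i) @ (T ! i ! j) # drop (Suc j) (T ! i) @ [a] \<approx> (T ! i ! j) # take j (T ! i) @ a # drop (Suc j) (T ! i)"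
  proof (rule row_insert)
    show "sorted (take j (T ! i) @ (T ! i ! j) # drop (Suc j) (T ! i))" using row ro i by (simp add: rows_ok_def)
    show "\<forall>x\<in>set (take j (T ! i)). x \<le> a" using jj(1,3) by (auto simp: in_set_conv_nth)
  qed (rule jj(2))
  then have k: "T ! i @ [a] \<approx> [T ! i ! j] @ ?T ! i" using row R' by (metis append.assoc append_Cons append_Nil)
  have d: "word (drop i T) = word (drop (Suc i) T) @ T ! i" using Cons_nth_drop_Suc[OF i] by (metis word_simps(2))
  have tk: "take (Suc i) ?T = take i T @ [?T ! i]" using i by (simp add: take_Suc_conv_app_nth set_entry_def)
  show "word (drop i T) @ [a] @ word (take i T) \<approx> word (drop (Suc i) T) @ [T ! i ! j] @ word (take (Suc i) ?T)"
    using knuth_context[OF k, of "word (drop (Suc i) T)" "word (take i T)"] by (simp add: d tk)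
qed

lemma ssyt_hole_ok: "ssyt T \<Longrightarrow> i < length T \<Longrightarrow> j < length (T ! i) \<Longrightarrow> hole_ok T i j"
  unfolding hole_ok_def using ssyt_rows ssyt_young ssyt_nth(2) by blast

lemma col_0: "\<forall>R\<in>set T. R \<noteq> [] \<Longrightarrow> col 0 T = map (\<lambda>R. R ! 0) T"
  by (simp add: col_def filter_id_conv)

text \<open>Here \<open>T\<close> already has \<open>k\<close> in place of the first
  \<open>k\<close>-bar. The auxiliary \<open>S\<close> ignores the exception: the displaced
  \<open>k\<close>-bar is bumped as by Schensted into the next row, where it is smaller than
  everything and shifts the first column. \<open>S\<close> is semistandard but violates the King
  condition; its first column has \<open>k\<close>-bar right after \<open>k\<close>, and its other
  columns are those of \<open>T\<close>.\<close>

lemma exception_typeC: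
  assumes s: "ssyt T" and l: "low_entries T" and i: "i < length T" and T0: "T ! i ! 0 = Plain (Suc i)"
    and w: "word (drop (Suc i) T) @ [Barred (Suc i)] @ word (take (Suc i) T) \<in> words k"
    and s': "ssyt (jeu_de_taquin T i 0)"
  shows "typeC_equiv k (word (drop (Suc i) T) @ [Barred (Suc i)] @ word (take (Suc i) T)) (word (jeu_de_taquin T i 0))"
proof -
  let ?T = "jeu_de_taquin T i 0" and ?B = "Barred (Suc i)"
  define X where "X = drop (Suc i) T"
  define S where "S = take (Suc i) T @ shift_col ?B X"
  have ne: "\<forall>R\<in>set T. R \<noteq> []" using s by (simp add: ssyt_def)
  then have neX: "\<forall>R\<in>set X. R \<noteq> []" "\<forall>R\<in>set (take i T). R \<noteq> []" unfolding X_def by (auto dest: in_set_dropD in_set_takeD)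
  have Ti: "0 < length (T ! i)" using ne i by auto
  have tk: "take (Suc i) T = take i T @ [T ! i]" using i by (simp add: take_Suc_conv_app_nth)
  have "ssyt (take (Suc i) T @ X)" using s unfolding X_def by simp
  then have sX: "ssyt X" "ssyt (take (Suc i) T)" by (auto simp only: ssyt_append)
  have cX: "col m (take (Suc i) T) @ col m X = col m T" for m
    using col_simps(3)[of m "take (Suc i) T" X] unfolding X_def by simp
  have Xl: "?B < x" if xX: "x \<in> set (map (\<lambda>R. R ! 0) X)" for x
  proof -
    obtain R where R: "R \<in> set X" "x = R ! 0" using xX by auto
    then obtain m where m: "m < length X" "x = X ! m ! 0" unfolding in_set_conv_nth by blast
    then have "Suc i + m < length T" "x = T ! (Suc i + m) ! 0" "T ! (Suc i + m) \<noteq> []" using ne unfolding X_def by auto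
    then have "2 * (Suc i + m) + 2 \<le> letter_code x" using l unfolding low_entries_def by (metis length_greater_0_conv)
    then show ?thesis by (simp add: less_code)
  qed
  have hdX: "map hd X = map (\<lambda>R. R ! 0) X" using neX by (simp add: hd_conv_nth)
  have sw: "sorted_wrt (<) (?B # map hd X)"
    using ssyt_sorted_col[OF sX(1), of 0] col_0[OF neX(1)] Xl unfolding hdX by simp
  have wS: "word X @ [?B] @ word (take (Suc i) T) \<approx> word S"
    using knuth_context[OF word_shift_col[of X ?B], of "[]" "word (take (Suc i) T)"] sw sX(1) by (simp add: S_def ssyt_def)
  have ssS: "ssyt S"
  proof -
    have "X = [] \<or> ?B < hd (hd X)" using sw by (cases X) auto
    then have "ssyt (shift_col ?B X)" by (rule ssyt_shift_col[OF sX(1)])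
    moreover have "above (last (take (Suc i) T)) (hd (shift_col ?B X))"
    proof (cases X)
      case Nil
      then show ?thesis using Ti T0 by (auto simp: tk above_def less_code Suc_le_eq)
    next
      case (Cons R Y)
      have "Suc i < length T" using Cons unfolding X_def by (cases "Suc i < length T") auto
      moreover have "T ! Suc i = R" using Cons unfolding X_def by (rule nth_via_drop)
      ultimately have "above (T ! i) R" using s by (auto simp: ssyt_def successively_conv_nth)
      moreover have "R \<noteq> []" using neX Cons by simp
      ultimately show ?thesis using T0 Cons by (cases R) (auto simp: tk above_def less_code nth_Cons less_Suc_eq_0_disj split: nat.splits)
    qed
    ultimately show ?thesis unfolding S_def ssyt_append using sX(2) by simp
  qed
  define u where "u = col 0 (take i T)"
  define d where "d = col 0 X"
  have lu: "length u = i" unfolding u_def using col_0[OF neX(2)] i by simp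
  have cS: "col 0 S = u @ Plain (Suc (length u)) # Barred (Suc (length u)) # d"
    using col_shift_col(1)[OF neX(1), of ?B] Ti T0 lu by (simp add: S_def tk col_simps u_def d_def)
  have "col 0 (take (Suc i) T) = u @ [Plain (Suc i)]" using Ti T0 by (simp add: tk col_simps u_def)
  then have cT: "col 0 T = u @ Plain (Suc i) # d" using cX[of 0] by (simp add: d_def)
  have hc: "hole_col i 0 0 T = u @ d" using lu by (simp add: hole_col_def cT)
  have cl: "col m S = col m T" if "0 < m" for m
    by (simp only: S_def col_simps(3) col_shift_col(2)[OF neX(1) that] cX)
  \<comment> \<open>Any bound on the row lengths of the three tableaux will do; \<open>Suc n\<close>
    allows column 0 to be split off.\<close>
  define n where "n = sum_list (map length T) + sum_list (map length S) + sum_list (map length ?T)"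
  have n: "length R \<le> Suc n" if "R \<in> set T \<or> R \<in> set S \<or> R \<in> set ?T" for R
    using that member_le_sum_list[of "length R" "map length T"] member_le_sum_list[of "length R" "map length S"] member_le_sum_list[of "length R" "map length ?T"]
    by (auto simp: n_def)
  define v where "v = concat (map (\<lambda>m. rev (col m T)) [1..<Suc n])"
  have up: "[0..<Suc n] = 0 # [1..<Suc n]" by (simp add: upt_conv_Cons del: upt_Suc)
  have "col_word (Suc n) S = rev (col 0 S) @ v"
    unfolding col_word_def up v_def using cl by (auto intro!: arg_cong[where f = concat])
  then have kS: "word S \<approx> rev (col 0 S) @ v" using word_col_word[OF ssS, of "Suc n"] n by simp
  have "hole_word (Suc n) i 0 T = rev (u @ d) @ v"
    unfolding hole_word_def up v_def using hc by (auto simp: hole_col_def intro!: arg_cong[where f = concat])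
  moreover have "hole_word (Suc n) i 0 T \<approx> col_word (Suc n) ?T"
    by (rule hole_word_jdt[OF ssyt_hole_ok[OF s i Ti]]) (use n in auto)
  moreover have "word ?T \<approx> col_word (Suc n) ?T" using word_col_word[OF s', of "Suc n"] n by simp
  ultimately have kT: "word ?T \<approx> rev (u @ d) @ v" using knuth_sym knuth_trans by metis
  have kW: "word X @ [?B] @ word (take (Suc i) T) \<approx> rev (col 0 S) @ v" using wS kS knuth_trans by blast
  have lets: "set (rev (col 0 S) @ v) \<subseteq> letters k" using knuth_set[OF kW] w unfolding X_def words_iff by simp
  have sC: "sorted_wrt (<) (col 0 S)" by (rule ssyt_sorted_col[OF ssS])
  have sC': "sorted_wrt (<) (u @ d)" using sC unfolding cS by (simp add: sorted_wrt_append)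
  have P: "P\<^sub>C (rev (col 0 S)) = P\<^sub>C (rev (u @ d))"
  proof (rule P_column_exception[OF cS sC])
    fix m assume m: "m < length u"
    have "u ! m = T ! m ! 0" using m lu i col_0[OF neX(2)] by (simp add: u_def)
    moreover have "T ! m \<noteq> []" using ne m lu i by simp
    ultimately show "2 * m + 2 \<le> letter_code (u ! m)" using l m lu i unfolding low_entries_def by simp
  next
    fix m assume m: "m < length d"
    then have mX: "m < length X" using col_0[OF neX(1)] by (simp add: d_def)
    have "d ! m = T ! (Suc i + m) ! 0" using mX col_0[OF neX(1)] by (simp add: d_def X_def)
    moreover have "Suc i + m < length T" using mX by (simp add: X_def)
    moreover have "T ! (Suc i + m) \<noteq> []" using bspec[OF ne nth_mem[OF calculation(2)]] .
    ultimately have "2 * (Suc i + m) + 2 \<le> letter_code (d ! m)" using l unfolding low_entries_def by (metis length_greater_0_conv)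
    then show "2 * (Suc (length u) + m) + 2 \<le> letter_code (d ! m)" using lu by simp
  qed
  have cw: "rev (col 0 S) \<in> column_words k" "rev (u @ d) \<in> column_words k" "v \<in> words k"
    using sC sC' lets unfolding column_words_def words_iff cS by (auto simp: sorted_wrt_rev simp del: rev_append)
  have "equiv5 k (word X @ [?B] @ word (take (Suc i) T)) (word ?T)"
    unfolding equiv5_def using cw kW kT P by blast
  moreover have "word ?T \<in> words k" using knuth_set[OF kT] cw unfolding column_words_def words_iff by auto
  ultimately show ?thesis using w unfolding typeC_equiv_def X_def by (intro r_into_rtranclp) (simp add: typeC_step_def)
qed

text \<open>That the result is semistandard is taken as a hypothesis because the analysis by shapes
  provides it, through \<open>berele_layers\<close> and \<open>king_ssyt\<close>.\<close>

lemma insert_typeC: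
  assumes "ssyt T" "low_entries T" "insertable i a T" "i \<le> length T" "2 * i + 2 \<le> letter_code a"
    "word (drop i T) @ [a] @ word (take i T) \<in> words k" "ssyt (insert_from i a T)"
  shows "typeC_equiv k (word (drop i T) @ [a] @ word (take i T)) (word (insert_from i a T))"
  using assms
proof (induction i a T rule: insert_from_induct)
  case (new i a T)
  then show ?case by (simp add: typeC_refl)
next
  case ap: (append i a T)
  have "T[i := T ! i @ [a]] = take i T @ (T ! i @ [a]) # drop (Suc i) T" using ap(1) by (rule upd_conv_take_nth_drop)
  moreover have "word (drop i T) = word (drop (Suc i) T) @ T ! i" using Cons_nth_drop_Suc[OF ap(1)] by (metis word_simps(2))
  ultimately show ?case by (simp add: typeC_refl)
next
  case (bump i a T j T')
  note s = bump(7) and l = bump(8) and ins = bump(9) and ca = bump(11) and w = bump(12) and s' = bump(13)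
  note sb = ssyt_bump[OF s l bump(1) ins ca bump(2-4)]
  let ?T = "set_entry T i j a" and ?b = "T ! i ! j"
  have dr: "drop (Suc i) ?T = drop (Suc i) T" by (simp add: set_entry_def)
  have kk: "word (drop i T) @ [a] @ word (take i T) \<approx> word (drop (Suc i) ?T) @ [?b] @ word (take (Suc i) ?T)"
    using sb(4) unfolding dr .
  have w2: "word (drop (Suc i) ?T) @ [?b] @ word (take (Suc i) ?T) \<in> words k" using knuth_set[OF kk] w unfolding words_iff by simp
  have "typeC_equiv k (word (drop (Suc i) ?T) @ [?b] @ word (take (Suc i) ?T)) (word T')"
    using bump(6)[OF sb(1-3) _ bump(5)[OF ca] w2 s'] bump(1) by simp
  then show ?case using knuth_typeC[OF kk w] typeC_trans by blast
next
  case exc: (exception i a T j)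
  note s = exc(6) and l = exc(7) and ins = exc(8) and ca = exc(10) and w = exc(11) and s' = exc(12) and bar = exc(4)
  have ab: "a < T ! i ! j" using exc(2) bar by (simp add: less_code)
  have le: "T ! i ! k \<le> a" if "k < j" for k using before_barred[OF ssyt_rows[OF s] exc(1) exc(3-5) that] exc(2) by simp
  note sb = ssyt_bump[OF s l exc(1) ins ca exc(3) ab le]
  let ?T = "set_entry T i j a"
  have len: "0 < length (?T ! i)" "j < length (?T ! i)" "i < length ?T" using exc(1,3) by (auto simp: length_set_entry_nth)
  \<comment> \<open>The King condition bounds the first entry of the row from below by
    \<open>k\<close>, and the new \<open>k\<close> bounds it from above. So the hole starts in the
    first column.\<close>
  have T0: "?T ! i ! 0 = Plain (Suc i)"
  proof -
    have "?T ! i ! 0 \<le> ?T ! i ! j" by (rule row_sorted_nth[OF ssyt_rows[OF sb(1)] len(3) _ len(2)]) simp_all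
    moreover have "?T ! i ! j = Plain (Suc i)" using exc(1-3) by (simp add: set_entry_def)
    moreover have "2 * i + 2 \<le> letter_code (?T ! i ! 0)" using sb(2) len unfolding low_entries_def by blast
    ultimately show ?thesis by (intro letter_code_inject) (simp add: le_code)
  qed
  have fi: "first_index (\<lambda>b. b = Plain (Suc i)) (?T ! i) = 0" by (cases "?T ! i") (use len T0 in \<open>auto simp: first_index_def\<close>)
  have dr: "drop (Suc i) ?T = drop (Suc i) T" by (simp add: set_entry_def)
  have kk: "word (drop i T) @ [a] @ word (take i T) \<approx> word (drop (Suc i) ?T) @ [Barred (Suc i)] @ word (take (Suc i) ?T)"
    using sb(4) unfolding dr bar .
  have w2: "word (drop (Suc i) ?T) @ [Barred (Suc i)] @ word (take (Suc i) ?T) \<in> words k" using knuth_set[OF kk] w unfolding words_iff by simp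
  have "typeC_equiv k (word (drop (Suc i) ?T) @ [Barred (Suc i)] @ word (take (Suc i) ?T)) (word (jeu_de_taquin ?T i 0))"
    by (rule exception_typeC[OF sb(1,2) len(3) T0 w2]) (use s' fi in simp_all)
  then show ?case unfolding fi using knuth_typeC[OF kk w] typeC_trans by blast
qed

lemma king_low_entries: "king T \<Longrightarrow> low_entries T"
  unfolding low_entries_def
proof (intro allI impI)
  fix m l assume k: "king T" and m: "m < length T" "l < length (T ! m)"
  show "2 * m + 2 \<le> letter_code (T ! m ! l)"
  proof (rule ccontr)
    assume "\<not> 2 * m + 2 \<le> letter_code (T ! m ! l)"
    then have "shape T (letter_code (T ! m ! l)) m = 0" using k by (simp add: king_def low_ok_def)
    moreover have "int l < shape T (letter_code (T ! m ! l)) m" by (rule iffD1[OF shape_nth order_refl]) (use k m in \<open>simp_all add: king_def\<close>)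
    ultimately show False by simp
  qed
qed

lemma typeC_words: "typeC_equiv k u v \<Longrightarrow> u \<in> words k \<Longrightarrow> v \<in> words k"
  unfolding typeC_equiv_def by (induction rule: rtranclp_induct) (auto simp: typeC_step_def)

lemma word_P: "w \<in> words k \<Longrightarrow> king (P\<^sub>C w) \<and> typeC_equiv k w (word (P\<^sub>C w))"
proof (induction w rule: rev_induct)
  case Nil
  then show ?case by (simp add: P\<^sub>C_def king_def rows_ok_def cols_ok_def low_ok_def shape_def typeC_refl)
next
  case (snoc x w)
  let ?T = "P\<^sub>C w"
  have w: "w \<in> words k" "[x] \<in> words k" "2 \<le> letter_code x" using snoc.prems letters_code[of x k] by (auto simp: words_iff)
  have k: "king ?T" "typeC_equiv k w (word ?T)" using snoc.IH w by auto
  have k': "king (berele_insert ?T x)" using berele_layers[OF k(1) w(3)] by blast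
  have e: "typeC_equiv k (w @ [x]) (word ?T @ [x])" by (rule typeC_append[OF k(2) w(2)])
  have ww: "word ?T @ [x] \<in> words k" by (rule typeC_words[OF e snoc.prems])
  have "typeC_equiv k (word ?T @ [x]) (word (berele_insert ?T x))"
    using insert_typeC[of ?T 0 x k] king_ssyt[OF k(1)] king_low_entries[OF k(1)] king_ssyt[OF k'] w(3) ww
    by (simp add: insertable_def berele_insert_def)
  then show ?case using k' e typeC_trans by (simp add: P\<^sub>C_def)
qed

theorem corollary3p18:
  fixes k :: nat and w w' :: "letter list"
  assumes "0 < k" and "w \<in> words k" and "w' \<in> words k"
  shows "typeC_equiv k w w' \<longleftrightarrow> P\<^sub>C w = P\<^sub>C w'"
proof
  assume "P\<^sub>C w = P\<^sub>C w'"
  then show "typeC_equiv k w w'" using word_P[OF assms(2)] word_P[OF assms(3)] typeC_sym typeC_trans by metis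
qed (rule typeC_P)

end
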